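(* For each odd prime $p$ let $X_p$ be the Legendre sequence of length $p$. Let $R$ and $T>0$ be real numbers, and let $r$ and $t\ge 0$ be integers that may depend on $p$. Then the following hold, as $p\to\infty$: (i) If $r/p\to R$ and $t/p\to T$, then $F(X_p^{r,t})\to g(R,T)$. (ii) If $r/(2p)\to R$ and $t/(2p)\to T$, then $F(N(X_p)^{r,t})\to g(R+\tfrac14,T)$. (iii) If $r/(4p)\to R$ and $t/(4p)\to T$, then $F(P(X_p)^{r,t})\to g(R,T)$.
   Context: A binary sequence of length $t>1$ is an element $A=(a_0,\dots,a_{t-1})\in\{-1,1\}^t$. Its aperiodic autocorrelation at shift $u\in\{0,\dots,t-1\}$ is $c_u=\sum_{j=0}^{t-u-1}a_ja_{j+u}$, and its merit factor is $F(A)=\dfrac{t^2}{2\sum_{u=1}^{t-1}c_u^2}$. A binary sequence $(a_0,\dots,a_{n-1})$ is identified with the polynomial $A(z)=\sum_{j=0}^{n-1}a_jz^j$, of which it is called the coefficient sequence; $F(A)$ denotes the merit factor of the coefficient sequence. Extend $a_j$ to all $j\in\mathbb{Z}$ by $a_{j+n}=a_j$. For integers $r$ and $t\ge0$ define $A^{r,t}(z)=\sum_{j=0}^{t-1}a_{j+r}z^j$ (a sequence of length $t$). Define two polynomials of length $4n$: $$N(A)(z)=\sum_{j=0}^{4n-1}(-1)^{j(j-1)/2}a_jz^j,\qquad P(A)(z)=\sum_{j=0}^{4n-1}(-1)^{j(j-1)^2/2}a_jz^j.$$ In $N(A)^{r,t}$ and $P(A)^{r,t}$ the operation $(\cdot)^{r,t}$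 is applied to the length-$4n$ sequences $N(A)$ and $P(A)$, extended with period $4n$. For an odd prime $p$, let $(j\mid p)$ be the Legendre symbol (equal to $0$ if $p\mid j$). The Legendre sequence of length $p$ is the coefficient sequence of $X_p(z)=1+\sum_{j=1}^{p-1}(j\mid p)\,z^j$. The function $g:\mathbb{R}\times\mathbb{R}^+\to\mathbb{R}$ is defined by $$\frac{1}{g(R,T)}=1-\frac{4T}{3}+4\sum_{m\in\mathbb{N}}\max\Big(0,1-\frac{m}{T}\Big)^2+\sum_{m\in\mathbb{Z}}\max\Big(0,1-\Big|1+\frac{2R-m}{T}\Big|\Big)^2,$$ where $\mathbb{N}$ is the set of positive integers. *)

theory Defs
  imports "HOL-Analysis.Analysis" "HOL-Number_Theory.Number_Theory"
begin

text \<open>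
  A sequence (a_0, ..., a_(n-1)), equivalently the polynomial of which it is the
  coefficient sequence, is the list of its n coefficients. The list fixes the length n
  explicitly.
\<close>

definition autocorr :: "int list \<Rightarrow> nat \<Rightarrow> int" where
  "autocorr A u = (\<Sum>j<length A - u. A ! j * A ! (j + u))"

text \<open>
  The merit factor is meant for binary sequences of length greater than 1. For these the
  denominator is nonzero, because the autocorrelation at shift \<open>length A - 1\<close> is 1 or -1.
\<close>

definition merit_factor :: "int list \<Rightarrow> real" where
  "merit_factor A =
     (real (length A))\<^sup>2 / (2 * (\<Sum>u = 1..length A - 1. (real_of_int (autocorr A u))\<^sup>2))"

definition periodic_ext :: "int list \<Rightarrow> int \<Rightarrow> int" where
  "periodic_ext A j = A ! nat (j mod int (length A))"

text \<open>\<open>rotate_seq A r t\<close> is the sequence $A^{r,t}$ of length t.\<close>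

definition rotate_seq :: "int list \<Rightarrow> int \<Rightarrow> nat \<Rightarrow> int list" where
  "rotate_seq A r t = map (\<lambda>j. periodic_ext A (int j + r)) [0..<t]"

text \<open>
  In the exponents of the next two definitions, the natural-number subtraction truncates only
  at \<open>j = 0\<close>, where the factor \<open>j\<close> vanishes, and the division by 2 is exact.
\<close>

definition N_seq :: "int list \<Rightarrow> int list" where
  "N_seq A = map (\<lambda>j. (- 1) ^ (j * (j - 1) div 2) * periodic_ext A (int j)) [0..<4 * length A]"

definition P_seq :: "int list \<Rightarrow> int list" where
  "P_seq A = map (\<lambda>j. (- 1) ^ (j * (j - 1)\<^sup>2 div 2) * periodic_ext A (int j)) [0..<4 * length A]"

definition legendre_seq :: "nat \<Rightarrow> int list" where
  "legendre_seq p = map (\<lambda>j. if j = 0 then 1 else Legendre (int j) (int p)) [0..<p]"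

text \<open>
  For \<open>T > 0\<close> only finitely many terms of each of the two sums are nonzero, so both are
  summable.
\<close>

definition g_fun :: "real \<Rightarrow> real \<Rightarrow> real" where
  "g_fun R T = 1 / (1 - 4 * T / 3
      + 4 * (\<Sum>\<^sub>\<infinity>m\<in>{m::nat. m > 0}. (max 0 (1 - real m / T))\<^sup>2)
      + (\<Sum>\<^sub>\<infinity>m\<in>(UNIV :: int set). (max 0 (1 - \<bar>1 + (2 * R - real_of_int m) / T\<bar>))\<^sup>2))"

text \<open>The filter for a limit as p tends to infinity through the odd primes.\<close>

definition odd_primes_at_top :: "nat filter" where
  "odd_primes_at_top = inf at_top (principal {p. prime p \<and> odd p})"

end

theory Submission
  imports Defs "HOL-Real_Asymp.Real_Asymp"
begin

text \<open>
  For a sequence \<open>x\<close> of \<open>t\<close> signs let \<open>E\<close> be the sum of the squares of its autocorrelations at all shifts,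
  positive, negative and zero. Equivalently, \<open>E\<close> is the sum of \<open>x\<^sub>i x\<^sub>j x\<^sub>k x\<^sub>l\<close> over all positions
  with \<open>i + j = k + l\<close>, and the merit factor is \<open>1 / (E / t\<^sup>2 - 1)\<close> (\<open>merit_factor_eq\<close>). So the
  theorem is a statement about the asymptotics of \<open>E / t\<^sup>2\<close>. All three families have, at the
  positions that are not multiples of \<open>p\<close>, the entries \<open>\<epsilon> j * chi j\<close>, where \<open>chi\<close> is the Legendre symbol and the
  signs \<open>\<epsilon>\<close> have period 4: constant, \<open>+ + - -\<close> or \<open>+ + - +\<close>. The boundedly many multiples of \<open>p\<close> influence
  \<open>E\<close> by \<open>o(t\<^sup>2)\<close> only (\<open>energy_filled\<close>).

  The Legendre symbol is its own Fourier transform up to the Gauss sum, whose absolute value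
  is \<open>sqrt p\<close>. Expanding all four symbols in \<open>E\<close> gives (\<open>energy_expansion\<close>)
  a sum \<open>p\<^sup>-\<^sup>2 \<Sum> W(a, b, c) K(a, b, c)\<close> over residues \<open>a, b, c\<close>, where \<open>W\<close> is the complete correlation of the
  Legendre symbol with shifts \<open>0, a, b, c\<close> (\<open>quad_correlation\<close>) and \<open>K\<close> involves only \<open>\<epsilon>\<close>. If the four shifts coincide in
  pairs, \<open>W\<close> is \<open>p\<close> up to a bounded error, and otherwise \<open>W = O(p\<^sup>3\<^sup>/\<^sup>4)\<close> (\<open>quad_correlation_estimate\<close>).
  On the other hand, \<open>K\<close> is an average of products of four Dirichlet kernels, so the sum of \<open>\<bar>K\<bar>\<close> is
  \<open>O(p\<^sup>3 log\<^sup>4 p)\<close> (\<open>sum_norm_kernel\<close>, \<open>sum_norm_twisted_sum\<close>). Hence the shifts that are not paired contribute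
  \<open>o(p\<^sup>2)\<close> altogether.

  The bound for \<open>W\<close> replaces the Weil bound by an elementary averaging argument. Inversion of the
  variable turns \<open>W\<close> into a character sum over a cubic. The fourth moment of these sums over all
  cubics is at most \<open>3 p\<^sup>6\<close> (\<open>cubic_fourth_moment\<close>), because one can change the value of a cubic at one
  point freely without changing its values at three other points. But affine substitutions and
  scaling give every cubic with two different given roots an orbit of order \<open>p\<^sup>3\<close>, on which the absolute value of the
  sum is constant. So its fourth power is \<open>O(p\<^sup>3)\<close> (\<open>cubic_char_sum_bound\<close>).

  The paired shifts contribute the main term. Summing over the free frequency of a pairing
  leads back to positions, which must now satisfy \<open>i \<equiv> k\<close>, \<open>j \<equiv> k\<close> or \<open>i + j \<equiv> 0\<close> modulo \<open>p\<close>; the triple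
  that is paired in all three ways at once is subtracted twice. So the main term (\<open>main_term_eq\<close>) consists of sums of
  squares of the correlations of \<open>\<epsilon>\<close> with shifts and reflections of itself. Over an interval of length
  \<open>l\<close> these are \<open>\<plusminus>l + O(1)\<close> or \<open>O(1)\<close>, depending on a congruence modulo \<open>d = 1, 2, 4\<close> in the three
  cases (\<open>sign_pattern\<close>). Thus the sequence behaves like one of period \<open>d p\<close>, and in units of
  that period the main term tends to the finite sums in the definition of \<open>g_fun\<close>, with \<open>- 4 T / 3\<close>
  coming from the subtracted term (\<open>main_term_estimate\<close>, \<open>merit_factor_limit\<close>). For \<open>+ + - -\<close> the
  reflected correlation is large at odd instead of even points, whence \<open>R + 1 / 4\<close>.

  Finally, the limit of \<open>E / t\<^sup>2 - 1\<close> has to be positive, for otherwise the merit factors would be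
  unbounded; this is verified directly (\<open>inverse_merit_positive\<close>).
\<close>

section \<open>The Legendre symbol modulo an odd prime\<close>

text \<open>
  Residues modulo \<open>p\<close> are represented by integers throughout, and functions on the residue field by
  functions on the integers that are periodic modulo \<open>p\<close>: a type of residues would depend on
  \<open>p\<close>, whereas the theorem lets \<open>p\<close> tend to infinity.
\<close>
locale odd_prime_modulus =
  fixes p :: nat
  assumes prime_p: "prime p" and odd_p: "odd p"
begin

abbreviation residues_mod :: "int set" where
  "residues_mod \<equiv> {0..<int p}"

definition chi :: "int \<Rightarrow> real" where
  "chi j = real_of_int (Legendre j (int p))"

lemma p_ge_3: "p \<ge> 3"
  using prime_ge_2_nat[OF prime_p] odd_p by (cases "p = 2") auto

lemma prime_int_p: "prime (int p)"
  using prime_p by simp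

definition periodic_mod :: "(int \<Rightarrow> 'b) \<Rightarrow> bool" where
  "periodic_mod f \<longleftrightarrow> (\<forall>x. f (x mod int p) = f x)"

lemma periodic_modI: "(\<And>x y. [x = y] (mod int p) \<Longrightarrow> f x = f y) \<Longrightarrow> periodic_mod f"
  unfolding periodic_mod_def cong_def by (metis mod_mod_trivial)

lemma sum_affine_residues:
  fixes f :: "int \<Rightarrow> 'b::comm_monoid_add"
  assumes f: "periodic_mod f" and \<alpha>: "\<not> int p dvd \<alpha>"
  shows "(\<Sum>x\<in>residues_mod. f (\<beta> + \<alpha> * x)) = (\<Sum>x\<in>residues_mod. f x)"
proof -
  let ?h = "\<lambda>x. (\<beta> + \<alpha> * x) mod int p"
  have "inj_on ?h residues_mod"
  proof (rule inj_onI)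
    fix x y assume xy: "x \<in> residues_mod" "y \<in> residues_mod" "?h x = ?h y"
    then have "int p dvd (\<beta> + \<alpha> * x) - (\<beta> + \<alpha> * y)"
      by (simp add: mod_eq_dvd_iff)
    then have "int p dvd \<alpha> * (x - y)" by (simp add: algebra_simps)
    then have "int p dvd x - y"
      using \<alpha> prime_int_p prime_dvd_mult_iff by blast
    then have "x mod int p = y mod int p" by (simp add: mod_eq_dvd_iff)
    then show "x = y" using xy by simp
  qed
  moreover have "?h ` residues_mod \<subseteq> residues_mod" using p_ge_3 by auto
  ultimately have "bij_betw ?h residues_mod residues_mod"
    by (simp add: bij_betw_def endo_inj_surj)
  then have "(\<Sum>x\<in>residues_mod. f (?h x)) = (\<Sum>x\<in>residues_mod. f x)"
    by (rule sum.reindex_bij_betw)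
  then show ?thesis using f unfolding periodic_mod_def by simp
qed

lemma sum_shift_residues:
  fixes f :: "int \<Rightarrow> 'b::comm_monoid_add"
  assumes "periodic_mod f"
  shows "(\<Sum>x\<in>residues_mod. f (x + \<beta>)) = (\<Sum>x\<in>residues_mod. f x)"
  using sum_affine_residues[OF assms, of 1 \<beta>] p_ge_3 by (simp add: add.commute)

text \<open>
  By Fermat, \<open>x ^ (p - 2)\<close> is an inverse of \<open>x\<close>; a power has the advantage over a choice of
  inverse of being a total function of the integer \<open>x\<close>.
\<close>
lemma bij_betw_inverse_residues:
  "bij_betw (\<lambda>x. x ^ (p - 2) mod int p) {1..<int p} {1..<int p}"
  and inverse_residue: "\<And>x. \<not> int p dvd x \<Longrightarrow> [x * x ^ (p - 2) = 1] (mod int p)"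
proof -
  show inv: "[x * x ^ (p - 2) = 1] (mod int p)" if "\<not> int p dvd x" for x
  proof -
    define a where "a = nat (x mod int p)"
    have a: "int a = x mod int p" using p_ge_3 by (simp add: a_def)
    have "\<not> p dvd a"
      using that a by (metis dvd_mod_iff dvd_refl int_dvd_int_iff)
    then have "[int (a ^ (p - 1)) = int 1] (mod int p)"
      using fermat_theorem[OF prime_p] cong_int_iff by blast
    then have "[(x mod int p) ^ (p - 1) = 1] (mod int p)" using a by simp
    then have "[x ^ (p - 1) = 1] (mod int p)" by (simp add: cong_def power_mod)
    moreover have "p - 1 = Suc (p - 2)" using p_ge_3 by simp
    ultimately show ?thesis by simp
  qed
  let ?h = "\<lambda>x. x ^ (p - 2) mod int p"
  have nd: "\<not> int p dvd x" if "x \<in> {1..<int p}" for x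
    using that zdvd_not_zless by auto
  have inj: "inj_on ?h {1..<int p}"
  proof (rule inj_onI)
    fix x y assume xy: "x \<in> {1..<int p}" "y \<in> {1..<int p}" "?h x = ?h y"
    have "[x * (y * y ^ (p - 2)) = y * (x * x ^ (p - 2))] (mod int p)"
      using xy(3) by (metis (no_types, lifting) cong_def cong_scalar_left mult.left_commute)
    then have "[x * 1 = y * 1] (mod int p)"
      using inv[OF nd[OF xy(1)]] inv[OF nd[OF xy(2)]]
      by (meson cong_scalar_left cong_sym cong_trans)
    then show "x = y" using xy unfolding cong_def by simp
  qed
  moreover have "?h ` {1..<int p} \<subseteq> {1..<int p}"
  proof
    fix z assume "z \<in> ?h ` {1..<int p}"
    then obtain x where x: "x \<in> {1..<int p}" "z = ?h x" by blast
    have "\<not> int p dvd x ^ (p - 2)" using nd[OF x(1)] prime_int_p prime_dvd_power by blast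
    then have "z \<noteq> 0" using x by (simp add: dvd_eq_mod_eq_0)
    moreover have "0 \<le> z" "z < int p" using x p_ge_3 by auto
    ultimately show "z \<in> {1..<int p}" by auto
  qed
  ultimately show "bij_betw ?h {1..<int p} {1..<int p}"
    by (simp add: bij_betw_def endo_inj_surj)
qed

lemma chi_cong: "[x = y] (mod int p) \<Longrightarrow> chi x = chi y"
proof -
  assume xy: "[x = y] (mod int p)"
  have "[x = 0] (mod int p) \<longleftrightarrow> [y = 0] (mod int p)"
    using xy unfolding cong_def by simp
  moreover have "QuadRes (int p) x \<longleftrightarrow> QuadRes (int p) y"
    using xy unfolding QuadRes_def cong_def by simp
  ultimately show ?thesis by (simp add: chi_def Legendre_def)
qed

lemma periodic_chi [simp]: "periodic_mod chi"
  by (intro periodic_modI chi_cong)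

lemma chi_values: "chi x = 0 \<or> chi x = 1 \<or> chi x = -1"
  unfolding chi_def Legendre_def by auto

lemma chi_eq_0_iff: "chi x = 0 \<longleftrightarrow> int p dvd x"
  unfolding chi_def Legendre_def by (auto simp: cong_0_iff)

lemma abs_chi_le: "\<bar>chi x\<bar> \<le> 1"
  using chi_values[of x] by auto

lemma chi_square: "chi x * chi x = (if int p dvd x then 0 else 1)"
  using chi_values[of x] chi_eq_0_iff[of x] by auto

lemma chi_0 [simp]: "chi 0 = 0"
  by (simp add: chi_eq_0_iff)

lemma chi_1 [simp]: "chi 1 = 1"
proof -
  have "QuadRes (int p) 1" unfolding QuadRes_def by (intro exI[of _ 1]) (simp)
  moreover have "\<not> [1 = 0] (mod int p)" using p_ge_3 by (simp add: cong_0_iff)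
  ultimately show ?thesis by (simp add: chi_def Legendre_def)
qed

lemma chi_mult: "chi (x * y) = chi x * chi y"
proof -
  let ?L = "\<lambda>x. Legendre x (int p)"
  have e: "[?L x = x ^ ((p - 1) div 2)] (mod int p)" for x
    using euler_criterion[OF prime_p, of x] p_ge_3 by simp
  have "[?L (x * y) = ?L x * ?L y] (mod int p)"
    using e[of "x * y"] cong_mult[OF e[of x] e[of y]]
    by (metis cong_sym cong_trans power_mult_distrib)
  then have "int p dvd ?L (x * y) - ?L x * ?L y" by (simp add: cong_iff_dvd_diff)
  moreover have "\<bar>?L (x * y) - ?L x * ?L y\<bar> \<le> 2"
    unfolding Legendre_def by auto
  ultimately have "?L (x * y) - ?L x * ?L y = 0"
    using p_ge_3 dvd_imp_le_int[of "?L (x * y) - ?L x * ?L y" "int p"] by linarith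
  then show ?thesis unfolding chi_def by (simp flip: of_int_mult)
qed

text \<open>
  If all units were squares, squaring would permute the units; but it identifies 1 and -1.
\<close>
lemma exists_nonresidue: "\<exists>g. chi g = -1"
proof (rule ccontr)
  assume "\<nexists>g. chi g = -1"
  then have all: "chi g = 1" if "g \<in> {1..<int p}" for g
    using chi_values[of g] chi_eq_0_iff[of g] that zdvd_not_zless[of g "int p"] by auto
  let ?h = "\<lambda>x. x\<^sup>2 mod int p"
  have "{1..<int p} \<subseteq> ?h ` {1..<int p}"
  proof
    fix g assume g: "g \<in> {1..<int p}"
    then have "QuadRes (int p) g"
      using all[OF g] by (auto simp: chi_def Legendre_def split: if_splits)
    then obtain y where y: "[y\<^sup>2 = g] (mod int p)" unfolding QuadRes_def by blast
    then have "?h (y mod int p) = g" using g unfolding cong_def by (simp add: power_mod)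
    moreover from this have "y mod int p \<noteq> 0" using g by auto
    moreover have "0 \<le> y mod int p" "y mod int p < int p" using p_ge_3 by auto
    then have "y mod int p \<in> {1..<int p}" using \<open>y mod int p \<noteq> 0\<close> by simp
    ultimately show "g \<in> ?h ` {1..<int p}" by blast
  qed
  then have "card {1..<int p} \<le> card (?h ` {1..<int p})" by (intro card_mono) auto
  moreover have "card (?h ` {1..<int p}) \<le> card {1..<int p}" by (intro card_image_le) simp
  ultimately have "inj_on ?h {1..<int p}"
    by (intro eq_card_imp_inj_on) simp_all
  moreover have "?h 1 = ?h (int p - 1)"
    by (simp add: power2_eq_square algebra_simps mod_eq_dvd_iff)
  ultimately have "1 = int p - 1"
    using p_ge_3 by (subst (asm) inj_on_eq_iff) auto
  then show False using odd_p by presburger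
qed

lemma sum_chi: "(\<Sum>x\<in>residues_mod. chi x) = 0"
proof -
  obtain g where g: "chi g = -1" using exists_nonresidue by blast
  then have "\<not> int p dvd g" using chi_eq_0_iff[of g] by auto
  from sum_affine_residues[OF periodic_chi this, of 0]
  have "(\<Sum>x\<in>residues_mod. chi g * chi x) = (\<Sum>x\<in>residues_mod. chi x)"
    by (simp add: chi_mult)
  then show ?thesis using g by (simp add: sum_negf)
qed

end

section \<open>The fourth moment of cubic character sums\<close>

text \<open>
  The form in which every fourth power or product of four sums is expanded below.
\<close>
lemma sum_prod4:
  fixes f g h k :: "'i \<Rightarrow> 'r::comm_semiring_0"
  shows "sum f A * sum g B * sum h C * sum k D =
    (\<Sum>(a, b, c, d)\<in>A \<times> B \<times> C \<times> D. f a * g b * h c * k d)"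
  by (simp add: sum.cartesian_product [symmetric] sum_distrib_left [symmetric]
      sum_distrib_right [symmetric])

context odd_prime_modulus
begin

abbreviation residue_quads :: "(int \<times> int \<times> int \<times> int) set" where
  "residue_quads \<equiv> residues_mod \<times> residues_mod \<times> residues_mod \<times> residues_mod"

lemma card_residue_quads: "card residue_quads = p ^ 4"
  by (simp add: card_cartesian_product power4_eq_xxxx)

fun cubic :: "int \<times> int \<times> int \<times> int \<Rightarrow> int \<Rightarrow> int" where
  "cubic (c0, c1, c2, c3) x = c0 + c1 * x + c2 * x ^ 2 + c3 * x ^ 3"

definition cubic_char_sum :: "int \<times> int \<times> int \<times> int \<Rightarrow> real" where
  "cubic_char_sum c = (\<Sum>x\<in>residues_mod. chi (cubic c x))"

text \<open>
  The products of four factors that appear when the fourth power of a cubic sum is expanded and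
  the summation over all cubics is carried out first.
\<close>
definition cubic_correlation :: "int \<Rightarrow> int \<Rightarrow> int \<Rightarrow> int \<Rightarrow> real" where
  "cubic_correlation x1 x2 x3 x4 =
    (\<Sum>c\<in>residue_quads. chi (cubic c x1) * chi (cubic c x2) * chi (cubic c x3) * chi (cubic c x4))"

lemma chi_cubic_cong:
  assumes "[a0 = b0] (mod int p)" "[a1 = b1] (mod int p)" "[a2 = b2] (mod int p)" "[a3 = b3] (mod int p)"
  shows "chi (cubic (a0, a1, a2, a3) x) = chi (cubic (b0, b1, b2, b3) x)"
  using assms by (auto intro!: chi_cong cong_add cong_mult)

lemma sum_shift_quads:
  fixes g :: "int \<Rightarrow> int \<Rightarrow> int \<Rightarrow> int \<Rightarrow> real"
  assumes g: "\<And>a0 a1 a2 a3 b0 b1 b2 b3. \<lbrakk>[a0 = b0] (mod int p); [a1 = b1] (mod int p);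
      [a2 = b2] (mod int p); [a3 = b3] (mod int p)\<rbrakk> \<Longrightarrow> g a0 a1 a2 a3 = g b0 b1 b2 b3"
  shows "(\<Sum>(c0, c1, c2, c3)\<in>residue_quads. g (c0 + h0) (c1 + h1) (c2 + h2) (c3 + h3)) =
    (\<Sum>(c0, c1, c2, c3)\<in>residue_quads. g c0 c1 c2 c3)"
proof -
  have 3: "(\<Sum>c3\<in>residues_mod. g c0 c1 c2 (c3 + h3)) = (\<Sum>c3\<in>residues_mod. g c0 c1 c2 c3)" for c0 c1 c2
    by (rule sum_shift_residues) (auto intro!: periodic_modI g)
  have 2: "(\<Sum>c2\<in>residues_mod. \<Sum>c3\<in>residues_mod. g c0 c1 (c2 + h2) c3) =
      (\<Sum>c2\<in>residues_mod. \<Sum>c3\<in>residues_mod. g c0 c1 c2 c3)" for c0 c1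
    by (rule sum_shift_residues) (auto intro!: periodic_modI g sum.cong)
  have 1: "(\<Sum>c1\<in>residues_mod. \<Sum>c2\<in>residues_mod. \<Sum>c3\<in>residues_mod. g c0 (c1 + h1) c2 c3) =
      (\<Sum>c1\<in>residues_mod. \<Sum>c2\<in>residues_mod. \<Sum>c3\<in>residues_mod. g c0 c1 c2 c3)" for c0
    by (rule sum_shift_residues) (auto intro!: periodic_modI g sum.cong)
  have 0: "(\<Sum>c0\<in>residues_mod. \<Sum>c1\<in>residues_mod. \<Sum>c2\<in>residues_mod. \<Sum>c3\<in>residues_mod. g (c0 + h0) c1 c2 c3) =
      (\<Sum>c0\<in>residues_mod. \<Sum>c1\<in>residues_mod. \<Sum>c2\<in>residues_mod. \<Sum>c3\<in>residues_mod. g c0 c1 c2 c3)"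
    by (rule sum_shift_residues) (auto intro!: periodic_modI g sum.cong)
  show ?thesis
    by (simp add: sum.cartesian_product [symmetric] 3 2 1 0)
qed

text \<open>
  Adding multiples \<open>s * h\<close> of a cubic \<open>h\<close> that vanishes at the other three points permutes the
  cubics, leaves three of the four values alone and moves the value at the isolated point through
  all residues. The sum over \<open>s\<close> then is a complete sum of the Legendre symbol, which is 0.
  This is where the degree matters: a cubic can vanish at three prescribed points.
\<close>
lemma cubic_correlation_isolated:
  assumes x: "x1 \<in> residues_mod" "x2 \<in> residues_mod" "x3 \<in> residues_mod" "x4 \<in> residues_mod"
    and ne: "x1 \<noteq> x2" "x1 \<noteq> x3" "x1 \<noteq> x4"
  shows "cubic_correlation x1 x2 x3 x4 = 0"
proof -
  define h where "h = (\<lambda>x. (x - x2) * (x - x3) * (x - x4))"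
  define h0 h1 h2 where "h0 = - (x2 * x3 * x4)" and "h1 = x2 * x3 + x2 * x4 + x3 * x4"
    and "h2 = - (x2 + x3 + x4)"
  have cub: "cubic (c0 + s * h0, c1 + s * h1, c2 + s * h2, c3 + s * 1) x = cubic (c0, c1, c2, c3) x + h x * s"
    for c0 c1 c2 c3 s x
    by (simp add: h_def h0_def h1_def h2_def algebra_simps power2_eq_square power3_eq_cube)
  have "\<not> int p dvd x1 - y" if "y \<in> residues_mod" "x1 \<noteq> y" for y
    using that x(1) by (metis atLeastLessThan_iff mod_eq_dvd_iff mod_pos_pos_trivial)
  then have nd: "\<not> int p dvd h x1"
    unfolding h_def using x ne prime_int_p by (simp add: prime_dvd_mult_iff)
  have h0': "h x2 = 0" "h x3 = 0" "h x4 = 0" by (simp_all add: h_def)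
  let ?g = "\<lambda>c. chi (cubic c x1) * chi (cubic c x2) * chi (cubic c x3) * chi (cubic c x4)"
  have shift: "(\<Sum>(c0, c1, c2, c3)\<in>residue_quads. ?g (c0 + s * h0, c1 + s * h1, c2 + s * h2, c3 + s * 1)) =
      cubic_correlation x1 x2 x3 x4" for s
  proof -
    have "(\<Sum>(c0, c1, c2, c3)\<in>residue_quads. ?g (c0 + s * h0, c1 + s * h1, c2 + s * h2, c3 + s * 1)) =
      (\<Sum>(c0, c1, c2, c3)\<in>residue_quads. ?g (c0, c1, c2, c3))"
      by (rule sum_shift_quads[where g = "\<lambda>c0 c1 c2 c3. ?g (c0, c1, c2, c3)"])
         (simp only: chi_cubic_cong)
    then show ?thesis
      by (simp only: cubic_correlation_def split_def prod.collapse)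
  qed
  have inner: "(\<Sum>s\<in>residues_mod. chi (v + h x1 * s)) = 0" for v
    using sum_affine_residues[OF periodic_chi nd, of v] sum_chi by simp
  \<comment> \<open>Averaging over \<open>s\<close> costs a factor \<open>p\<close>, which is divided out at the end.\<close>
  have "real p * cubic_correlation x1 x2 x3 x4 = (\<Sum>s\<in>residues_mod. cubic_correlation x1 x2 x3 x4)"
    by simp
  also have "\<dots> = (\<Sum>s\<in>residues_mod. \<Sum>(c0, c1, c2, c3)\<in>residue_quads.
      chi (cubic (c0, c1, c2, c3) x1 + h x1 * s) * (chi (cubic (c0, c1, c2, c3) x2)
        * chi (cubic (c0, c1, c2, c3) x3) * chi (cubic (c0, c1, c2, c3) x4)))"
    by (rule sum.cong[OF refl], subst shift[symmetric])
       (simp only: cub h0' mult_zero_left add_0_right mult.assoc)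
  also have "\<dots> = (\<Sum>(c0, c1, c2, c3)\<in>residue_quads. (\<Sum>s\<in>residues_mod.
      chi (cubic (c0, c1, c2, c3) x1 + h x1 * s)) * (chi (cubic (c0, c1, c2, c3) x2)
        * chi (cubic (c0, c1, c2, c3) x3) * chi (cubic (c0, c1, c2, c3) x4)))"
    by (subst sum.swap) (simp only: sum_distrib_right split_def)
  also have "\<dots> = 0" by (simp only: inner) simp
  finally show ?thesis using p_ge_3 by simp
qed

lemma cubic_correlation_permute:
  "cubic_correlation x1 x2 x3 x4 = cubic_correlation x2 x1 x3 x4"
  "cubic_correlation x1 x2 x3 x4 = cubic_correlation x3 x2 x1 x4"
  "cubic_correlation x1 x2 x3 x4 = cubic_correlation x4 x2 x3 x1"
  unfolding cubic_correlation_def by (simp_all add: mult_ac)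

lemma cubic_correlation_le: "cubic_correlation x1 x2 x3 x4 \<le> real p ^ 4"
proof -
  have "cubic_correlation x1 x2 x3 x4 \<le> (\<Sum>c\<in>residue_quads. 1)"
    unfolding cubic_correlation_def
  proof (rule sum_mono)
    fix c
    have "\<bar>chi (cubic c x1) * chi (cubic c x2) * chi (cubic c x3) * chi (cubic c x4)\<bar> \<le> 1"
      unfolding abs_mult by (intro mult_le_one abs_chi_le mult_nonneg_nonneg abs_ge_zero)
    then show "chi (cubic c x1) * chi (cubic c x2) * chi (cubic c x3) * chi (cubic c x4) \<le> 1"
      by linarith
  qed
  then show ?thesis using card_residue_quads by simp
qed

text \<open>
  A quadruple without an isolated point consists of two pairs of equal points, and there are only
  three ways of pairing.
\<close>
lemma cubic_correlation_paired:
  assumes "x1 \<in> residues_mod" "x2 \<in> residues_mod" "x3 \<in> residues_mod" "x4 \<in> residues_mod"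
  shows "cubic_correlation x1 x2 x3 x4 \<le> real p ^ 4 *
    (of_bool (x1 = x2) * of_bool (x3 = x4) + of_bool (x1 = x3) * of_bool (x2 = x4)
      + of_bool (x1 = x4) * of_bool (x2 = x3))"
proof (cases "(x1 = x2 \<and> x3 = x4) \<or> (x1 = x3 \<and> x2 = x4) \<or> (x1 = x4 \<and> x2 = x3)")
  case True
  have "real p ^ 4 * 1 \<le> real p ^ 4 *
    (of_bool (x1 = x2) * of_bool (x3 = x4) + of_bool (x1 = x3) * of_bool (x2 = x4)
      + of_bool (x1 = x4) * of_bool (x2 = x3))"
    using True by (intro mult_left_mono) auto
  then show ?thesis using cubic_correlation_le[of x1 x2 x3 x4] by linarith
next
  case False
  then have "(x1 \<noteq> x2 \<and> x1 \<noteq> x3 \<and> x1 \<noteq> x4) \<or> (x2 \<noteq> x1 \<and> x2 \<noteq> x3 \<and> x2 \<noteq> x4) \<or>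
    (x3 \<noteq> x2 \<and> x3 \<noteq> x1 \<and> x3 \<noteq> x4) \<or> (x4 \<noteq> x2 \<and> x4 \<noteq> x3 \<and> x4 \<noteq> x1)"
    by auto
  then have "cubic_correlation x1 x2 x3 x4 = 0"
  proof (elim disjE conjE)
    assume "x1 \<noteq> x2" "x1 \<noteq> x3" "x1 \<noteq> x4"
    then show ?thesis by (intro cubic_correlation_isolated assms)
  next
    assume "x2 \<noteq> x1" "x2 \<noteq> x3" "x2 \<noteq> x4"
    then show ?thesis by (subst cubic_correlation_permute(1)) (intro cubic_correlation_isolated assms)
  next
    assume "x3 \<noteq> x2" "x3 \<noteq> x1" "x3 \<noteq> x4"
    then show ?thesis by (subst cubic_correlation_permute(2)) (intro cubic_correlation_isolated assms)
  next
    assume "x4 \<noteq> x2" "x4 \<noteq> x3" "x4 \<noteq> x1"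
    then show ?thesis by (subst cubic_correlation_permute(3)) (intro cubic_correlation_isolated assms)
  qed
  then show ?thesis by simp
qed

text \<open>
  Each of the three pairings contributes at most \<open>p ^ 2\<close> quadruples of points, each with a correlation
  of at most \<open>p ^ 4\<close>. So over the \<open>p ^ 4\<close> cubics the sums have size about \<open>sqrt p\<close> on average.
\<close>
lemma cubic_fourth_moment: "(\<Sum>c\<in>residue_quads. cubic_char_sum c ^ 4) \<le> 3 * real p ^ 6"
proof -
  have "(\<Sum>c\<in>residue_quads. cubic_char_sum c ^ 4) =
    (\<Sum>c\<in>residue_quads. \<Sum>(x1, x2, x3, x4)\<in>residue_quads.
      chi (cubic c x1) * chi (cubic c x2) * chi (cubic c x3) * chi (cubic c x4))"
    by (intro sum.cong refl, simp only: cubic_char_sum_def power4_eq_xxxx, rule sum_prod4)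
  also have "\<dots> = (\<Sum>(x1, x2, x3, x4)\<in>residue_quads. cubic_correlation x1 x2 x3 x4)"
    unfolding cubic_correlation_def by (subst sum.swap) (simp only: split_def)
  also have "\<dots> \<le> (\<Sum>(x1, x2, x3, x4)\<in>residue_quads. real p ^ 4 *
    (of_bool (x1 = x2) * of_bool (x3 = x4) + of_bool (x1 = x3) * of_bool (x2 = x4)
      + of_bool (x1 = x4) * of_bool (x2 = x3)))"
    by (rule sum_mono) (use cubic_correlation_paired in auto)
  also have "\<dots> \<le> real p ^ 4 * (3 * real p ^ 2)"
  proof -
    have pairs: "(\<Sum>x\<in>residue_quads. of_bool (x \<in> \<phi> ` (residues_mod \<times> residues_mod))) \<le> real p ^ 2"
      for \<phi> :: "int \<times> int \<Rightarrow> int \<times> int \<times> int \<times> int"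
    proof -
      have "(\<Sum>x\<in>residue_quads. of_bool (x \<in> \<phi> ` (residues_mod \<times> residues_mod)))
        = real (card (residue_quads \<inter> \<phi> ` (residues_mod \<times> residues_mod)))"
        by (simp add: sum_of_bool_eq)
      also have "\<dots> \<le> real (card (\<phi> ` (residues_mod \<times> residues_mod)))"
        by (intro of_nat_mono card_mono) auto
      also have "\<dots> \<le> real (card (residues_mod \<times> residues_mod))"
        by (intro of_nat_mono card_image_le) auto
      finally show ?thesis by (simp add: card_cartesian_product power2_eq_square)
    qed
    let ?I = "\<lambda>\<phi> :: int \<times> int \<Rightarrow> int \<times> int \<times> int \<times> int.
      \<lambda>x. of_bool (x \<in> \<phi> ` (residues_mod \<times> residues_mod)) :: real"
    have "(\<Sum>(x1, x2, x3, x4)\<in>residue_quads. real p ^ 4 *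
      (of_bool (x1 = x2) * of_bool (x3 = x4) + of_bool (x1 = x3) * of_bool (x2 = x4)
        + of_bool (x1 = x4) * of_bool (x2 = x3)))
      = (\<Sum>x\<in>residue_quads. real p ^ 4 * (?I (\<lambda>(a, b). (a, a, b, b)) x
          + ?I (\<lambda>(a, b). (a, b, a, b)) x + ?I (\<lambda>(a, b). (a, b, b, a)) x))"
    proof (rule sum.cong[OF refl])
      fix x assume x: "x \<in> residue_quads"
      obtain a b c d where abcd: "x = (a, b, c, d)" by (cases x)
      have mem: "a \<in> residues_mod" "b \<in> residues_mod" "c \<in> residues_mod" "d \<in> residues_mod"
        using x abcd by auto
      have "(a, b, c, d) \<in> (\<lambda>(a, b). (a, a, b, b)) ` (residues_mod \<times> residues_mod) \<longleftrightarrow> a = b \<and> c = d"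
        "(a, b, c, d) \<in> (\<lambda>(a, b). (a, b, a, b)) ` (residues_mod \<times> residues_mod) \<longleftrightarrow> a = c \<and> b = d"
        "(a, b, c, d) \<in> (\<lambda>(a, b). (a, b, b, a)) ` (residues_mod \<times> residues_mod) \<longleftrightarrow> a = d \<and> b = c"
        using mem by (force simp: image_iff)+
      then show "(case x of (x1, x2, x3, x4) \<Rightarrow> real p ^ 4 *
        (of_bool (x1 = x2) * of_bool (x3 = x4) + of_bool (x1 = x3) * of_bool (x2 = x4)
          + of_bool (x1 = x4) * of_bool (x2 = x3))) = real p ^ 4 * (?I (\<lambda>(a, b). (a, a, b, b)) x
          + ?I (\<lambda>(a, b). (a, b, a, b)) x + ?I (\<lambda>(a, b). (a, b, b, a)) x)"
        by (simp only: abcd prod.case of_bool_conj)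
    qed
    also have "\<dots> \<le> real p ^ 4 * (real p ^ 2 + real p ^ 2 + real p ^ 2)"
      unfolding sum_distrib_left [symmetric] sum.distrib
      by (intro mult_left_mono add_mono pairs) auto
    finally show ?thesis by simp
  qed
  also have "\<dots> = 3 * real p ^ 6"
    by (simp add: eval_nat_numeral)
  finally show ?thesis .
qed

end

section \<open>A pointwise bound for cubic character sums\<close>

context odd_prime_modulus
begin

lemma cong_residues_eq: "\<lbrakk>x \<in> residues_mod; y \<in> residues_mod; [x = y] (mod int p)\<rbrakk> \<Longrightarrow> x = y"
  by (auto simp: cong_def)

text \<open>
  The coefficients are reduced modulo \<open>p\<close>, so that the orbit of a cubic lies in the index set of the
  fourth moment and equal cubics have equal coefficient vectors.
\<close>
definition cubic_from_roots :: "int \<Rightarrow> int \<Rightarrow> int \<Rightarrow> int \<Rightarrow> int \<times> int \<times> int \<times> int" where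
  "cubic_from_roots u r1 r2 r3 =
    (- u * r1 * r2 * r3 mod int p, u * (r1 * r2 + r1 * r3 + r2 * r3) mod int p,
     - u * (r1 + r2 + r3) mod int p, u mod int p)"

lemma cubic_from_roots_cong:
  "[cubic (cubic_from_roots u r1 r2 r3) x = u * ((x - r1) * (x - r2) * (x - r3))] (mod int p)"
proof -
  have "[cubic (cubic_from_roots u r1 r2 r3) x = - u * r1 * r2 * r3 + u * (r1 * r2 + r1 * r3 + r2 * r3) * x
    + (- u * (r1 + r2 + r3)) * x ^ 2 + u * x ^ 3] (mod int p)"
    unfolding cubic_from_roots_def cubic.simps
    by (intro cong_add cong_mult cong_refl) (simp_all add: cong_def)
  also have "- u * r1 * r2 * r3 + u * (r1 * r2 + r1 * r3 + r2 * r3) * x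
    + (- u * (r1 + r2 + r3)) * x ^ 2 + u * x ^ 3 = u * ((x - r1) * (x - r2) * (x - r3))"
    by (simp add: algebra_simps power2_eq_square power3_eq_cube)
  finally show ?thesis .
qed

lemma cubic_from_roots_in: "cubic_from_roots u r1 r2 r3 \<in> residue_quads"
  using p_ge_3 by (simp add: cubic_from_roots_def)

text \<open>
  The substitution \<open>x = b + a * y\<close> carries the cubic with roots \<open>e1, e2, e3\<close> to a multiple of the cubic
  with the transformed roots, and constant factors leave the sum as a sign.
\<close>
lemma cubic_char_sum_affine:
  assumes "\<not> int p dvd u" "\<not> int p dvd a"
  shows "\<bar>cubic_char_sum (cubic_from_roots u (b + a * e1) (b + a * e2) (b + a * e3))\<bar> =
    \<bar>\<Sum>y\<in>residues_mod. chi ((y - e1) * (y - e2) * (y - e3))\<bar>"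
proof -
  let ?f = "\<lambda>x. chi (u * ((x - (b + a * e1)) * (x - (b + a * e2)) * (x - (b + a * e3))))"
  have per: "periodic_mod ?f"
    by (intro periodic_modI chi_cong cong_mult cong_diff cong_refl)
  have "cubic_char_sum (cubic_from_roots u (b + a * e1) (b + a * e2) (b + a * e3)) =
      (\<Sum>x\<in>residues_mod. ?f x)"
    unfolding cubic_char_sum_def by (intro sum.cong refl chi_cong cubic_from_roots_cong)
  also have "\<dots> = (\<Sum>y\<in>residues_mod. ?f (b + a * y))"
    by (rule sum_affine_residues[OF per assms(2), symmetric])
  also have "\<dots> = (\<Sum>y\<in>residues_mod. chi (u * a ^ 3) * chi ((y - e1) * (y - e2) * (y - e3)))"
    by (intro sum.cong refl) (simp add: chi_mult [symmetric] algebra_simps power3_eq_cube)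
  also have "\<dots> = chi (u * a ^ 3) * (\<Sum>y\<in>residues_mod. chi ((y - e1) * (y - e2) * (y - e3)))"
    by (simp add: sum_distrib_left)
  finally have "\<bar>cubic_char_sum (cubic_from_roots u (b + a * e1) (b + a * e2) (b + a * e3))\<bar> =
    \<bar>chi (u * a ^ 3)\<bar> * \<bar>\<Sum>y\<in>residues_mod. chi ((y - e1) * (y - e2) * (y - e3))\<bar>"
    by (simp add: abs_mult)
  moreover have "\<not> int p dvd u * a ^ 3"
    using assms prime_int_p by (simp add: prime_dvd_mult_iff prime_dvd_power_iff)
  then have "\<bar>chi (u * a ^ 3)\<bar> = 1"
    using chi_values[of "u * a ^ 3"] chi_eq_0_iff[of "u * a ^ 3"] by auto
  ultimately show ?thesis by simp
qed

text \<open>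
  The leading coefficient of a cubic in the orbit determines \<open>u\<close>, and the images of the two different
  roots \<open>e1\<close> and \<open>e2\<close> determine the affine map. These two images are among the at most three roots
  of the cubic, which leaves at most nine possibilities.
\<close>
lemma cubic_orbit_fiber:
  fixes e1 e2 e3 :: int
  assumes e: "\<not> [e1 = e2] (mod int p)"
  defines "\<phi> \<equiv> \<lambda>(u, a, b). cubic_from_roots u (b + a * e1) (b + a * e2) (b + a * e3)"
  defines "X \<equiv> {1..<int p} \<times> {1..<int p} \<times> residues_mod"
  shows "card {x \<in> X. \<phi> x = c} \<le> 9"
proof (cases "{x \<in> X. \<phi> x = c} = {}")
  case False
  then obtain u0 a0 b0 where x0: "(u0, a0, b0) \<in> X" "\<phi> (u0, a0, b0) = c" by auto
  let ?r = "\<lambda>a b e. (b + a * e) mod int p"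
  define Z where "Z = {?r a0 b0 e1, ?r a0 b0 e2, ?r a0 b0 e3}"
  define \<psi> where "\<psi> = (\<lambda>(u::int, a, b). (?r a b e1, ?r a b e2))"
  have nd: "\<not> int p dvd x" if "x \<in> {1..<int p}" for x
    using that zdvd_not_zless by auto
  have "finite Z" "card Z \<le> 3" by (auto simp: Z_def card_insert_if)
  have u_eq: "u = u0" if "(u, a, b) \<in> X" "\<phi> (u, a, b) = c" for u a b
    using that x0 by (auto simp: \<phi>_def X_def cubic_from_roots_def)
  have root: "?r a b e \<in> Z" if x: "(u, a, b) \<in> X" "\<phi> (u, a, b) = c" and ee: "e = e1 \<or> e = e2" for u a b e
  proof -
    let ?x = "b + a * e"
    have "[cubic c ?x = u * ((?x - (b + a * e1)) * (?x - (b + a * e2)) * (?x - (b + a * e3)))] (mod int p)"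
      using cubic_from_roots_cong[of u "b + a * e1" "b + a * e2" "b + a * e3" ?x] x(2) by (simp add: \<phi>_def)
    then have "[cubic c ?x = 0] (mod int p)" using ee by auto
    moreover have "[cubic c ?x = u0 * ((?x - (b0 + a0 * e1)) * (?x - (b0 + a0 * e2)) * (?x - (b0 + a0 * e3)))] (mod int p)"
      using cubic_from_roots_cong[of u0 "b0 + a0 * e1" "b0 + a0 * e2" "b0 + a0 * e3" ?x] x0(2) by (simp add: \<phi>_def)
    ultimately have "int p dvd u0 * ((?x - (b0 + a0 * e1)) * (?x - (b0 + a0 * e2)) * (?x - (b0 + a0 * e3)))"
      by (metis cong_0_iff cong_sym cong_trans)
    moreover have "\<not> int p dvd u0" using x0(1) nd by (simp add: X_def)
    ultimately have "int p dvd ?x - (b0 + a0 * e1) \<or> int p dvd ?x - (b0 + a0 * e2) \<or> int p dvd ?x - (b0 + a0 * e3)"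
      using prime_int_p by (simp only: prime_dvd_mult_iff) blast
    then show ?thesis by (auto simp: Z_def mod_eq_dvd_iff)
  qed
  have "card {x \<in> X. \<phi> x = c} \<le> card (Z \<times> Z)"
  proof (rule card_inj_on_le)
    show "\<psi> ` {x \<in> X. \<phi> x = c} \<subseteq> Z \<times> Z"
      using root by (auto simp: \<psi>_def)
    show "finite (Z \<times> Z)" using \<open>finite Z\<close> by simp
    show "inj_on \<psi> {x \<in> X. \<phi> x = c}"
    proof (rule inj_onI)
      fix x y assume xy: "x \<in> {x \<in> X. \<phi> x = c}" "y \<in> {x \<in> X. \<phi> x = c}" "\<psi> x = \<psi> y"
      obtain u a b where x: "x = (u, a, b)" by (cases x)
      obtain u' a' b' where y: "y = (u', a', b')" by (cases y)
      have uu: "u = u'" using u_eq xy x y by blast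
      have c1: "[b + a * e1 = b' + a' * e1] (mod int p)" and c2: "[b + a * e2 = b' + a' * e2] (mod int p)"
        using xy(3) by (simp_all add: \<psi>_def x y cong_def)
      have "[(b + a * e1) - (b + a * e2) = (b' + a' * e1) - (b' + a' * e2)] (mod int p)"
        by (rule cong_diff[OF c1 c2])
      then have "int p dvd (a - a') * (e1 - e2)"
        by (simp add: cong_iff_dvd_diff algebra_simps)
      moreover have "\<not> int p dvd e1 - e2" using e by (simp add: cong_iff_dvd_diff)
      ultimately have "[a = a'] (mod int p)"
        using prime_int_p by (simp add: prime_dvd_mult_iff cong_iff_dvd_diff)
      then have aa: "a = a'" using xy x y by (intro cong_residues_eq) (auto simp: X_def)
      then have "[b = b'] (mod int p)" using c1 by (simp add: cong_iff_dvd_diff)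
      then have "b = b'" using xy x y by (intro cong_residues_eq) (auto simp: X_def)
      then show "x = y" using x y uu aa by simp
    qed
  qed
  also have "\<dots> = card Z * card Z" by (simp add: card_cartesian_product)
  also have "\<dots> \<le> 3 * 3" using \<open>card Z \<le> 3\<close> by (intro mult_mono) auto
  finally show ?thesis by simp
next
  case True
  then show ?thesis by (simp only: card.empty)
qed

text \<open>
  A single large sum would occur for the whole orbit of its cubic under affine substitution and
  scaling, hence for at least \<open>p * (p - 1)\<^sup>2 / 9\<close> cubics. This contradicts the fourth moment unless the
  sum is at most of order \<open>p powr (3 / 4)\<close>. The exponent is weaker than the 1/2 of the Weil
  bound, but any exponent below 1 is enough here.
\<close>
lemma cubic_char_sum_bound:
  fixes e1 e2 e3 :: int
  assumes e: "\<not> [e1 = e2] (mod int p)"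
  shows "(\<Sum>y\<in>residues_mod. chi ((y - e1) * (y - e2) * (y - e3))) ^ 4 \<le> 108 * real p ^ 3"
proof -
  define S where "S = (\<Sum>y\<in>residues_mod. chi ((y - e1) * (y - e2) * (y - e3)))"
  define \<phi> where "\<phi> = (\<lambda>(u, a, b). cubic_from_roots u (b + a * e1) (b + a * e2) (b + a * e3))"
  define X where "X = {1..<int p} \<times> {1..<int p} \<times> residues_mod"
  have nd: "\<not> int p dvd x" if "x \<in> {1..<int p}" for x
    using that zdvd_not_zless by auto
  have S4: "cubic_char_sum (\<phi> x) ^ 4 = S ^ 4" if "x \<in> X" for x
  proof -
    have "\<bar>cubic_char_sum (\<phi> x)\<bar> = \<bar>S\<bar>"
      using that nd by (auto simp: \<phi>_def X_def S_def intro!: cubic_char_sum_affine)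
    then show ?thesis by (metis power_even_abs even_numeral)
  qed
  have "finite X" by (simp add: X_def)
  have "card X = (p - 1) * (p - 1) * p"
  proof -
    have "nat (int p - 1) = p - 1" by linarith
    then show ?thesis by (simp add: X_def card_cartesian_product)
  qed
  then have cardX: "real (card X) = (real p - 1) * (real p - 1) * real p"
    using p_ge_3 by (simp add: of_nat_diff)
  have "real (card X) * S ^ 4 = (\<Sum>x\<in>X. cubic_char_sum (\<phi> x) ^ 4)"
    using S4 by simp
  also have "\<dots> = (\<Sum>c\<in>residue_quads. \<Sum>x\<in>{x \<in> X. \<phi> x = c}. cubic_char_sum (\<phi> x) ^ 4)"
  proof (rule sum.group[symmetric])
    show "\<phi> ` X \<subseteq> residue_quads"
      using cubic_from_roots_in unfolding \<phi>_def split_def by blast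
  qed (simp_all add: \<open>finite X\<close>)
  also have "\<dots> = (\<Sum>c\<in>residue_quads. real (card {x \<in> X. \<phi> x = c}) * cubic_char_sum c ^ 4)"
    by (intro sum.cong refl) simp
  also have "\<dots> \<le> (\<Sum>c\<in>residue_quads. 9 * cubic_char_sum c ^ 4)"
  proof (intro sum_mono mult_right_mono)
    fix c
    show "real (card {x \<in> X. \<phi> x = c}) \<le> 9"
      using cubic_orbit_fiber[OF e, of e3 c] by (simp add: \<phi>_def X_def)
  qed simp
  also have "\<dots> \<le> 9 * (3 * real p ^ 6)"
    unfolding sum_distrib_left [symmetric] by (intro mult_left_mono cubic_fourth_moment) simp
  finally have le: "(real p - 1) * (real p - 1) * real p * S ^ 4 \<le> 27 * real p ^ 6"
    by (simp add: cardX)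
  have "real p * real p \<le> 4 * ((real p - 1) * (real p - 1))"
  proof -
    have "real p \<le> 2 * (real p - 1)" using p_ge_3 by simp
    then have "real p * real p \<le> (2 * (real p - 1)) * (2 * (real p - 1))"
      by (intro mult_mono) auto
    then show ?thesis by (simp add: algebra_simps)
  qed
  then have "real p * real p * (real p * S ^ 4) \<le> 4 * ((real p - 1) * (real p - 1)) * (real p * S ^ 4)"
    by (intro mult_right_mono) auto
  also have "\<dots> \<le> 108 * real p ^ 6" using le by (simp only: mult_ac)
  finally have "real p ^ 3 * S ^ 4 \<le> real p ^ 3 * (108 * real p ^ 3)"
    by (simp add: eval_nat_numeral mult_ac)
  then show ?thesis using p_ge_3 by (simp add: S_def)
qed

end

section \<open>Correlations of four shifts of the Legendre symbol\<close>

context odd_prime_modulus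
begin

lemma sum_inverse_residues:
  fixes f :: "int \<Rightarrow> 'b::comm_monoid_add"
  shows "(\<Sum>y\<in>{1..<int p}. f (y ^ (p - 2) mod int p)) = (\<Sum>x\<in>{1..<int p}. f x)"
  by (rule sum.reindex_bij_betw[OF bij_betw_inverse_residues])

lemma sum_residues_split: "(\<Sum>x\<in>residues_mod. f x) = f 0 + (\<Sum>x\<in>{1..<int p}. f x)"
  for f :: "int \<Rightarrow> 'b::comm_monoid_add"
proof -
  have "residues_mod = insert 0 {1..<int p}" using p_ge_3 by auto
  then show ?thesis by simp
qed

lemma not_dvd_residue: "x \<in> {1..<int p} \<Longrightarrow> \<not> int p dvd x"
  using zdvd_not_zless by auto

text \<open>
  Multiply the argument by the square \<open>y * y\<close> and absorb one factor \<open>y\<close> into the inverse. Thus the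
  inversion of the summation variable turns a linear factor with root \<open>- a\<close> into one with root
  \<open>- 1 / a\<close>, and the linear factor with root 0 disappears.
\<close>
lemma chi_inverse_shift:
  assumes y: "\<not> int p dvd y"
  shows "chi (y ^ (p - 2) mod int p + a) = chi y * chi (1 + a * y)"
proof -
  have "chi (y ^ (p - 2) mod int p + a) = chi y * chi y * chi (y ^ (p - 2) + a)"
    using chi_square[of y] y chi_cong[of "y ^ (p - 2) mod int p + a" "y ^ (p - 2) + a"]
    by (simp add: cong_def mod_add_left_eq)
  also have "\<dots> = chi y * chi (y * y ^ (p - 2) + a * y)"
    by (simp add: chi_mult [symmetric] algebra_simps)
  also have "\<dots> = chi y * chi (1 + a * y)"
    using inverse_residue[OF y] by (intro arg_cong2[where f = "(*)"] refl chi_cong cong_add) simp_all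
  finally show ?thesis .
qed

lemma chi_inverse: "\<not> int p dvd y \<Longrightarrow> chi (y ^ (p - 2) mod int p) = chi y"
  using chi_inverse_shift[of y 0] by simp

lemma chi_pair_correlation:
  assumes "x \<in> residues_mod" "y \<in> residues_mod"
  shows "(\<Sum>m\<in>residues_mod. chi (m + x) * chi (m + y)) = real p * of_bool (x = y) - 1"
proof -
  let ?d = "y - x"
  have "periodic_mod (\<lambda>m. chi m * chi (m + ?d))"
    by (intro periodic_modI arg_cong2[where f = "(*)"] chi_cong cong_add) simp_all
  from sum_shift_residues[OF this, of x]
  have "(\<Sum>m\<in>residues_mod. chi (m + x) * chi (m + y)) = (\<Sum>m\<in>residues_mod. chi m * chi (m + ?d))"
    by (simp add: algebra_simps)
  also have "\<dots> = (\<Sum>m\<in>{1..<int p}. chi (m + 0) * chi (m + ?d))"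
    by (simp add: sum_residues_split)
  also have "\<dots> = (\<Sum>m\<in>{1..<int p}. chi (m ^ (p - 2) mod int p + 0) * chi (m ^ (p - 2) mod int p + ?d))"
    by (rule sum_inverse_residues[symmetric])
  also have "\<dots> = (\<Sum>m\<in>{1..<int p}. chi (1 + ?d * m))"
    using chi_square not_dvd_residue by (intro sum.cong refl) (simp add: chi_inverse_shift chi_inverse)
  also have "\<dots> = (\<Sum>m\<in>residues_mod. chi (1 + ?d * m)) - 1"
    by (simp add: sum_residues_split)
  also have "(\<Sum>m\<in>residues_mod. chi (1 + ?d * m)) = real p * of_bool (x = y)"
  proof (cases "x = y")
    case True
    then show ?thesis by simp
  next
    case False
    then have "\<not> int p dvd ?d"
      using assms cong_residues_eq[of y x] by (auto simp: cong_iff_dvd_diff)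
    from sum_affine_residues[OF periodic_chi this, of 1] show ?thesis
      using False sum_chi by simp
  qed
  finally show ?thesis .
qed

text \<open>
  One of the four shifts is normalised to 0, because only the differences of the shifts matter.
\<close>
definition quad_correlation :: "int \<Rightarrow> int \<Rightarrow> int \<Rightarrow> real" where
  "quad_correlation a b c = (\<Sum>m\<in>residues_mod. chi (m + a) * chi (m + b) * chi (m + c) * chi m)"

text \<open>
  The number of ways in which \<open>0, a, b, c\<close> (modulo \<open>p\<close>, all reduced) split into two pairs of equal
  numbers, except that the weight is 1 when all four are equal: all three indicators hold then,
  and the last term restores the value 1.
\<close>
definition pair_weight :: "int \<Rightarrow> int \<Rightarrow> int \<Rightarrow> real" where
  "pair_weight a b c = of_bool (b = 0 \<and> a = c) + of_bool (a = 0 \<and> b = c) + of_bool (c = 0 \<and> a = b)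
     - 2 * of_bool (a = 0 \<and> b = 0 \<and> c = 0)"

text \<open>
  If two shifts agree, the squared factor is 1 except at one point, and a correlation with two
  factors remains.
\<close>
lemma repeated_correlation:
  assumes "x \<in> residues_mod" "y \<in> residues_mod" "z \<in> residues_mod"
  shows "\<bar>(\<Sum>m\<in>residues_mod. chi (m + z) * chi (m + z) * (chi (m + x) * chi (m + y))) - real p * of_bool (x = y)\<bar> \<le> 2"
proof -
  define w where "w = (- z) mod int p"
  have w: "w \<in> residues_mod" using p_ge_3 by (simp add: w_def)
  have iff: "int p dvd m + z \<longleftrightarrow> m = w" if "m \<in> residues_mod" for m
  proof -
    have "int p dvd m + z \<longleftrightarrow> m mod int p = (- z) mod int p" by (simp add: mod_eq_dvd_iff)
    then show ?thesis using that by (simp add: w_def)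
  qed
  have "(\<Sum>m\<in>residues_mod. chi (m + z) * chi (m + z) * (chi (m + x) * chi (m + y)))
     = (\<Sum>m\<in>residues_mod. chi (m + x) * chi (m + y) - (if m = w then chi (w + x) * chi (w + y) else 0))"
    by (intro sum.cong refl) (auto simp: chi_square iff)
  also have "\<dots> = real p * of_bool (x = y) - 1 - chi (w + x) * chi (w + y)"
    using w assms by (simp add: sum_subtractf chi_pair_correlation)
  finally have "(\<Sum>m\<in>residues_mod. chi (m + z) * chi (m + z) * (chi (m + x) * chi (m + y))) - real p * of_bool (x = y)
    = - 1 - chi (w + x) * chi (w + y)" by simp
  moreover have "\<bar>chi (w + x) * chi (w + y)\<bar> \<le> 1"
    unfolding abs_mult by (intro mult_le_one abs_chi_le) auto
  ultimately show ?thesis by linarith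
qed

text \<open>
  Inversion reduces the four linear factors to three, so that the bound for cubics with roots
  \<open>- 1 / a, - 1 / b, - 1 / c\<close> applies; the residue 0 that inversion omits costs the additional 1.
\<close>
lemma quad_correlation_bound:
  assumes abc: "a \<in> {1..<int p}" "b \<in> {1..<int p}" "c \<in> {1..<int p}"
    and ne: "a \<noteq> b" 
  shows "\<bar>quad_correlation a b c\<bar> \<le> 5 * real p powr (3 / 4)"
proof -
  note nd = abc[THEN not_dvd_residue]
  let ?i = "\<lambda>x. x ^ (p - 2)"
  let ?f = "\<lambda>y. chi ((y - (- ?i a)) * (y - (- ?i b)) * (y - (- ?i c)))"
  define S where "S = (\<Sum>y\<in>residues_mod. ?f y)"
  have lin: "chi (1 + a * y) = chi a * chi (y - (- ?i a))" if "\<not> int p dvd a" for a y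
  proof -
    have "[a * (y - (- ?i a)) = 1 + a * y] (mod int p)"
      using cong_add[OF cong_refl[of "a * y"] inverse_residue[OF that]] by (simp add: algebra_simps)
    then show ?thesis using chi_cong chi_mult by metis
  qed
  have "quad_correlation a b c = (\<Sum>m\<in>{1..<int p}. chi (m + a) * chi (m + b) * chi (m + c) * chi (m + 0))"
    by (simp add: quad_correlation_def sum_residues_split)
  also have "\<dots> = (\<Sum>y\<in>{1..<int p}. (\<lambda>m. chi (m + a) * chi (m + b) * chi (m + c) * chi (m + 0)) (?i y mod int p))"
    by (rule sum_inverse_residues[symmetric])
  also have "\<dots> = (\<Sum>y\<in>{1..<int p}. (chi y * chi y) * (chi y * chi y) * (chi (1 + a * y) * chi (1 + b * y) * chi (1 + c * y)))"
    using not_dvd_residue by (intro sum.cong refl) (simp add: chi_inverse_shift chi_inverse mult_ac)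
  also have "\<dots> = (\<Sum>y\<in>{1..<int p}. chi (1 + a * y) * chi (1 + b * y) * chi (1 + c * y))"
    using not_dvd_residue by (intro sum.cong refl) (simp add: chi_square)
  also have "\<dots> = (\<Sum>y\<in>{1..<int p}. (chi a * chi b * chi c) * ?f y)"
    by (intro sum.cong refl, simp only: lin[OF nd(1)] lin[OF nd(2)] lin[OF nd(3)] chi_mult, simp only: mult_ac)
  also have "\<dots> = (chi a * chi b * chi c) * (S - ?f 0)"
    by (simp add: S_def sum_residues_split sum_distrib_left)
  finally have "\<bar>quad_correlation a b c\<bar> = \<bar>chi a * chi b * chi c\<bar> * \<bar>S - ?f 0\<bar>"
    by (simp only: abs_mult)
  also have "\<dots> \<le> 1 * \<bar>S - ?f 0\<bar>"
    unfolding abs_mult by (intro mult_right_mono mult_le_one abs_chi_le) auto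
  also have "\<dots> \<le> \<bar>S\<bar> + 1" 
    using abs_triangle_ineq4[of S "?f 0"] abs_chi_le[of "(0 - (- ?i a)) * (0 - (- ?i b)) * (0 - (- ?i c))"]
    by linarith
  finally have le: "\<bar>quad_correlation a b c\<bar> \<le> \<bar>S\<bar> + 1" .
  have "\<not> [- ?i a = - ?i b] (mod int p)"
  proof
    assume "[- ?i a = - ?i b] (mod int p)"
    then have "[?i a = ?i b] (mod int p)" by (simp add: cong_minus_minus_iff)
    then have "[b * (a * ?i a) = a * (b * ?i b)] (mod int p)"
      using cong_scalar_left[of "?i a" "?i b" "int p" "a * b"] by (simp add: mult_ac)
    moreover have "[b * (a * ?i a) = b * 1] (mod int p)" "[a * (b * ?i b) = a * 1] (mod int p)"
      using nd by (intro cong_scalar_left inverse_residue; simp)+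
    ultimately have "[b = a] (mod int p)"
      by (metis cong_sym cong_trans mult.right_neutral)
    then show False using ne abc cong_residues_eq[of b a] by auto
  qed
  from cubic_char_sum_bound[OF this, of "- ?i c"]
  have S4: "\<bar>S\<bar> ^ 4 \<le> 108 * real p ^ 3" by (simp add: S_def)
  have "\<bar>S\<bar> \<le> 4 * real p powr (3 / 4)"
  proof (rule power_le_imp_le_base[of _ 3])
    have "\<bar>S\<bar> ^ Suc 3 \<le> 108 * real p ^ 3" using S4 by simp
    also have "\<dots> \<le> 256 * real p ^ 3" by simp
    also have "\<dots> = (4 * real p powr (3 / 4)) ^ Suc 3"
      using p_ge_3 by (simp add: power_mult_distrib powr_power powr_numeral)
    finally show "\<bar>S\<bar> ^ Suc 3 \<le> (4 * real p powr (3 / 4)) ^ Suc 3" .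
  qed simp
  moreover have "1 \<le> real p powr (3 / 4)" using p_ge_3 by (intro ge_one_powr_ge_zero) auto
  ultimately show ?thesis using le by linarith
qed

lemma quad_correlation_estimate:
  assumes abc: "a \<in> residues_mod" "b \<in> residues_mod" "c \<in> residues_mod"
  shows "\<bar>quad_correlation a b c - real p * pair_weight a b c\<bar> \<le> 5 * real p powr (3 / 4)"
proof -
  have z: "0 \<in> residues_mod" using p_ge_3 by simp
  have "1 \<le> real p powr (3 / 4)" using p_ge_3 by (intro ge_one_powr_ge_zero) auto
  then have *: "u \<le> 2 \<Longrightarrow> u \<le> 5 * real p powr (3 / 4)" for u by linarith
  consider "a = 0" | "b = 0" | "c = 0" | "a = b"
    | "a \<noteq> 0" "b \<noteq> 0" "c \<noteq> 0" "a \<noteq> b" by blast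
  then show ?thesis
  proof cases
    case 1
    then have "pair_weight a b c = of_bool (b = c)" by (auto simp: pair_weight_def)
    then show ?thesis using repeated_correlation[OF abc(2,3) z] 1
      by (intro *) (simp add: quad_correlation_def mult_ac)
  next
    case 2
    then have "pair_weight a b c = of_bool (a = c)" by (auto simp: pair_weight_def)
    then show ?thesis using repeated_correlation[OF abc(1,3) z] 2
      by (intro *) (simp add: quad_correlation_def mult_ac)
  next
    case 3
    then have "pair_weight a b c = of_bool (a = b)" by (auto simp: pair_weight_def)
    then show ?thesis using repeated_correlation[OF abc(1,2) z] 3
      by (intro *) (simp add: quad_correlation_def mult_ac)
  next
    case 4
    then have "pair_weight a b c = of_bool (c = 0)" by (auto simp: pair_weight_def)
    then show ?thesis using repeated_correlation[OF abc(3) z abc(1)] 4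
      by (intro *) (simp add: quad_correlation_def mult_ac)
  next
    case 5
    then have "pair_weight a b c = 0" by (auto simp: pair_weight_def)
    then show ?thesis using quad_correlation_bound[of a b c] 5 abc by auto
  qed
qed

end

section \<open>Additive characters\<close>

definition additive_char :: "nat \<Rightarrow> int \<Rightarrow> complex" where
  "additive_char q x = cis (2 * pi * of_int x / real q)"

lemma additive_char_add: "additive_char q (x + y) = additive_char q x * additive_char q y"
  by (simp add: additive_char_def cis_mult add_divide_distrib distrib_left)

lemma additive_char_0 [simp]: "additive_char q 0 = 1"
  by (simp add: additive_char_def)

lemma additive_char_minus: "additive_char q (- x) = cnj (additive_char q x)"
  by (simp add: additive_char_def cis_cnj)

lemma additive_char_diff: "additive_char q (x - y) = additive_char q x * cnj (additive_char q y)"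
  using additive_char_add[of q x "- y"] by (simp add: additive_char_minus)

lemma additive_char_power: "additive_char q (int i * x) = additive_char q x ^ i"
  by (induction i) (simp_all add: distrib_right additive_char_add)

lemma norm_additive_char [simp]: "norm (additive_char q x) = 1"
  by (simp add: additive_char_def)

lemma additive_char_eq_1_iff:
  assumes "q > 0"
  shows "additive_char q x = 1 \<longleftrightarrow> int q dvd x"
proof
  assume "additive_char q x = 1"
  then have "cos (2 * pi * of_int x / real q) = 1"
    by (metis additive_char_def cis.sel(1) one_complex.sel(1))
  then obtain n :: int where "2 * pi * of_int x / real q = of_int n * 2 * pi"
    using cos_one_2pi_int by blast
  then have "of_int x = (of_int (n * int q) :: real)"
    using assms by (simp add: field_simps)
  then have "x = n * int q" by (simp only: of_int_eq_iff)
  then show "int q dvd x" by simp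
next
  assume "int q dvd x"
  then obtain n where "x = int q * n" by (elim dvdE)
  then have "additive_char q x = cis (2 * pi * of_int n)"
    using assms by (simp add: additive_char_def field_simps)
  then show "additive_char q x = 1" by simp
qed

lemma additive_char_cong:
  assumes "q > 0" "[x = y] (mod int q)"
  shows "additive_char q x = additive_char q y"
proof -
  have "additive_char q (x - y) = 1"
    using assms by (simp add: additive_char_eq_1_iff cong_iff_dvd_diff)
  then show ?thesis using additive_char_add[of q "x - y" y] by simp
qed

lemma additive_char_mult_modulus: "n > 0 \<Longrightarrow> additive_char (n * q) (int n * x) = additive_char q x"
  by (simp add: additive_char_def mult.assoc)

lemma sum_additive_char:
  assumes "q > 0"
  shows "(\<Sum>h\<in>{0..<int q}. additive_char q (h * x)) = of_nat q * of_bool (int q dvd x)"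
proof -
  have "(\<Sum>h\<in>{0..<int q}. additive_char q (h * x)) = (\<Sum>i<q. additive_char q (int i * x))"
    using sum.atLeast_int_lessThan_int_shift[of "\<lambda>h. additive_char q (h * x)" 0 q]
    by (simp add: atLeast0LessThan)
  also have "\<dots> = (\<Sum>i<q. additive_char q x ^ i)"
    by (simp only: additive_char_power)
  also have "\<dots> = of_nat q * of_bool (int q dvd x)"
  proof (cases "int q dvd x")
    case True
    then have "additive_char q x = 1" using additive_char_eq_1_iff[OF assms] by simp
    then show ?thesis using True by simp
  next
    case False
    have "additive_char q x ^ q = additive_char q (int q * x)"
      by (simp only: additive_char_power)
    also have "\<dots> = 1" using additive_char_eq_1_iff[OF assms] by simp
    finally show ?thesis
      using False additive_char_eq_1_iff[OF assms] by (simp add: geometric_sum)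
  qed
  finally show ?thesis .
qed

lemma norm_one_minus_additive_char:
  "norm (1 - additive_char q x) = 2 * \<bar>sin (pi * of_int x / real q)\<bar>"
  using dist_exp_i_1[of "2 * pi * of_int x / real q"]
  by (simp add: additive_char_def cis_conv_exp norm_minus_commute)

text \<open>
  The factor 2 is not optimal, but leaves room for the error bound \<open>x ^ 3 / 6\<close> of the approximation of
  \<open>sin x\<close> by \<open>x\<close>.
\<close>
lemma le_2_mult_sin:
  fixes x :: real
  assumes "0 \<le> x" "x \<le> pi / 2"
  shows "x \<le> 2 * sin x"
proof -
  have "\<bar>sin x - (\<Sum>m<3. sin_coeff m * x ^ m)\<bar> \<le> inverse (fact 3) * \<bar>x\<bar> ^ 3"
    by (rule Maclaurin_sin_bound)
  then have "\<bar>sin x - x\<bar> \<le> x ^ 3 / 6"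
    using assms by (simp add: eval_nat_numeral sin_coeff_def fact_numeral divide_simps)
  moreover have "x \<le> 1.6" using assms pi_approx by simp
  then have "x * (x * x) \<le> x * (1.6 * 1.6)" using assms by (intro mult_left_mono mult_mono) auto
  ultimately show ?thesis unfolding power3_eq_cube mult.assoc abs_le_iff by linarith
qed

lemma inverse_norm_one_minus_additive_char:
  assumes h: "h \<in> {1..<int q}"
  shows "1 / norm (1 - additive_char q h) \<le> real q * (1 / of_int h + 1 / of_int (int q - h))"
proof -
  have main: "1 / norm (1 - additive_char q h) \<le> real q / of_int h" if "1 \<le> h" "2 * h \<le> int q" for h
  proof -
    let ?x = "pi * of_int h / real q"
    have q: "real q > 0" using that by linarith
    have hq: "2 * real_of_int h \<le> real q" using that(2) by linarith
    have pos: "0 < of_int h / real q" using that q by simp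
    have "0 \<le> ?x" using that by simp
    moreover have "?x \<le> pi / 2" using hq q by (simp add: field_simps)
    ultimately have "?x \<le> 2 * sin ?x" by (rule le_2_mult_sin)
    also have "2 * sin ?x \<le> norm (1 - additive_char q h)"
      unfolding norm_one_minus_additive_char by simp
    finally have "?x \<le> norm (1 - additive_char q h)" .
    moreover have "of_int h / real q \<le> ?x"
      using pi_gt3 that q by (simp add: divide_right_mono)
    ultimately have "of_int h / real q \<le> norm (1 - additive_char q h)" by linarith
    then have "1 / norm (1 - additive_char q h) \<le> 1 / (of_int h / real q)"
      using pos by (intro divide_left_mono mult_pos_pos) linarith+
    then show ?thesis by simp
  qed
  show ?thesis
  proof (cases "2 * h \<le> int q")
    case True
    then have "1 / norm (1 - additive_char q h) \<le> real q / of_int h" using main h by simp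
    also have "\<dots> \<le> real q * (1 / of_int h + 1 / of_int (int q - h))"
      using h by (simp add: distrib_left)
    finally show ?thesis .
  next
    case False
    have "q > 0" using h by simp
    have "additive_char q (int q - h) = cnj (additive_char q h)"
      using additive_char_cong[OF \<open>q > 0\<close>, of "int q - h" "- h"]
      by (simp add: cong_iff_dvd_diff additive_char_minus)
    then have "norm (1 - additive_char q (int q - h)) = norm (cnj (1 - additive_char q h))" by simp
    then have "norm (1 - additive_char q (int q - h)) = norm (1 - additive_char q h)" by (simp only: complex_mod_cnj)
    then have "1 / norm (1 - additive_char q h) \<le> real q / of_int (int q - h)"
      using main[of "int q - h"] h False by simp
    also have "\<dots> \<le> real q * (1 / of_int h + 1 / of_int (int q - h))"
      using h by (simp add: distrib_left)
    finally show ?thesis .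
  qed
qed

lemma sum_inverse_norm_one_minus_additive_char:
  "(\<Sum>h\<in>{1..<int q}. 1 / norm (1 - additive_char q h)) \<le> 2 * real q * harm q"
proof -
  have H1: "(\<Sum>h\<in>{1..<int q}. 1 / real_of_int h) \<le> harm q"
  proof -
    have "(\<Sum>h\<in>{1..<int q}. 1 / real_of_int h) = (\<Sum>k\<in>{1..<q}. 1 / real k)"
      using sum.atLeast_int_lessThan_int_shift[of "\<lambda>h. 1 / real_of_int h" 1 q] by simp
    also have "\<dots> \<le> harm q"
      unfolding harm_def by (simp add: inverse_eq_divide) (intro sum_mono2; auto)
    finally show ?thesis .
  qed
  have H2: "(\<Sum>h\<in>{1..<int q}. 1 / real_of_int (int q - h)) = (\<Sum>h\<in>{1..<int q}. 1 / real_of_int h)"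
    by (rule sum.reindex_bij_witness[where i = "\<lambda>h. int q - h" and j = "\<lambda>h. int q - h"]) auto
  have "(\<Sum>h\<in>{1..<int q}. 1 / norm (1 - additive_char q h)) \<le>
      (\<Sum>h\<in>{1..<int q}. real q * (1 / of_int h + 1 / of_int (int q - h)))"
    by (intro sum_mono inverse_norm_one_minus_additive_char)
  also have "\<dots> = real q * ((\<Sum>h\<in>{1..<int q}. 1 / real_of_int h) + (\<Sum>h\<in>{1..<int q}. 1 / real_of_int (int q - h)))"
    by (simp only: sum_distrib_left sum.distrib distrib_left)
  also have "\<dots> \<le> real q * (harm q + harm q)"
    using H1 H2 by (intro mult_left_mono add_mono) auto
  finally show ?thesis by simp
qed

section \<open>Exponential sums with periodic coefficients\<close>

text \<open>
  A Dirichlet kernel of length \<open>t\<close> with coefficients \<open>\<epsilon>\<close>, evaluated at the frequency \<open>h / q\<close>.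
\<close>
definition twisted_sum :: "(int \<Rightarrow> real) \<Rightarrow> int \<Rightarrow> nat \<Rightarrow> nat \<Rightarrow> int \<Rightarrow> complex" where
  "twisted_sum \<epsilon> r t q h = (\<Sum>j\<in>{r..<r + int t}. of_real (\<epsilon> j) * additive_char q (h * j))"

lemma norm_sum_shift_diff_le:
  fixes f :: "int \<Rightarrow> 'a::real_normed_vector"
  assumes "\<And>j. norm (f j) \<le> 1"
  shows "norm ((\<Sum>j\<in>{r..<r + int t}. f j) - (\<Sum>j\<in>{r..<r + int t}. f (j + int k))) \<le> 2 * real k"
proof (induction k)
  case (Suc k)
  have step: "(\<Sum>j\<in>{r..<r + int t}. g j) - (\<Sum>j\<in>{r..<r + int t}. g (j + 1)) = g r - g (r + int t)"
    for g :: "int \<Rightarrow> 'a"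
  proof (induction t)
    case (Suc t)
    have "{r..<r + int (Suc t)} = insert (r + int t) {r..<r + int t}" by auto
    then show ?case using Suc by (simp add: algebra_simps)
  qed simp
  let ?s = "\<lambda>k. \<Sum>j\<in>{r..<r + int t}. f (j + int k)"
  have "?s k - ?s (Suc k) = f (r + int k) - f (r + int t + int k)"
    using step[of "\<lambda>j. f (j + int k)"] by (simp add: algebra_simps)
  then have "norm (?s k - ?s (Suc k)) \<le> 2"
    using norm_triangle_ineq4[of "f (r + int k)" "f (r + int t + int k)"] assms[of "r + int k"]
      assms[of "r + int t + int k"] by simp
  moreover have "?s 0 - ?s (Suc k) = (?s 0 - ?s k) + (?s k - ?s (Suc k))" by simp
  ultimately have "norm (?s 0 - ?s (Suc k)) \<le> 2 * real k + 2"
    using norm_triangle_ineq[of "?s 0 - ?s k" "?s k - ?s (Suc k)"] Suc by simp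
  then show ?case by (simp add: algebra_simps)
qed simp

lemma twisted_sum_cong:
  assumes "q > 0" "[h = h'] (mod int q)"
  shows "twisted_sum \<epsilon> r t q h = twisted_sum \<epsilon> r t q h'"
  unfolding twisted_sum_def
  by (intro sum.cong refl arg_cong2[where f = "(*)"] additive_char_cong assms(1) cong_mult assms(2) cong_refl)

lemma norm_twisted_sum_trivial:
  assumes "\<And>j. \<bar>\<epsilon> j\<bar> \<le> 1"
  shows "norm (twisted_sum \<epsilon> r t q h) \<le> real t"
proof -
  have "norm (twisted_sum \<epsilon> r t q h) \<le> (\<Sum>j\<in>{r..<r + int t}. 1)"
    unfolding twisted_sum_def by (intro sum_norm_le) (simp add: norm_mult assms)
  then show ?thesis by simp
qed

text \<open>
  Multiplication by \<open>additive_char q (4 * h)\<close> shifts the summation variable by a whole period of \<open>\<epsilon>\<close>,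
  so the difference telescopes to eight boundary terms. The signs thus cost no more than
  replacing the frequency \<open>h\<close> by \<open>4 * h\<close>.
\<close>
lemma norm_twisted_sum_telescope:
  assumes "\<And>j. \<bar>\<epsilon> j\<bar> \<le> 1" and per: "\<And>j. \<epsilon> (j + 4) = \<epsilon> j"
  shows "norm (1 - additive_char q (4 * h)) * norm (twisted_sum \<epsilon> r t q h) \<le> 8"
proof -
  let ?f = "\<lambda>j. of_real (\<epsilon> j) * additive_char q (h * j)"
  have "additive_char q (4 * h) * twisted_sum \<epsilon> r t q h = (\<Sum>j\<in>{r..<r + int t}. ?f (j + int 4))"
    unfolding twisted_sum_def sum_distrib_left
    by (intro sum.cong refl) (simp add: per distrib_left additive_char_add mult_ac)
  then have "(1 - additive_char q (4 * h)) * twisted_sum \<epsilon> r t q h =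
      (\<Sum>j\<in>{r..<r + int t}. ?f j) - (\<Sum>j\<in>{r..<r + int t}. ?f (j + int 4))"
    by (simp add: left_diff_distrib twisted_sum_def)
  moreover have "norm \<dots> \<le> 2 * real 4"
    by (rule norm_sum_shift_diff_le) (simp add: norm_mult assms)
  ultimately show ?thesis by (simp flip: norm_mult)
qed

lemma coprime_int_4: "odd q \<Longrightarrow> coprime (int q) 4"
  using coprime_power_right_iff[of "int q" 2 2] by simp

lemma sum_mult_4_residues:
  fixes f :: "int \<Rightarrow> real"
  assumes "odd q" 
  shows "(\<Sum>h\<in>{1..<int q}. f (4 * h mod int q)) = (\<Sum>h\<in>{1..<int q}. f h)"
proof (rule sum.reindex_bij_betw)
  let ?h = "\<lambda>h. 4 * h mod int q"
  have cop: "coprime (int q) 4"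
    by (rule coprime_int_4[OF assms])
  have "inj_on ?h {1..<int q}"
  proof (rule inj_onI)
    fix x y assume xy: "x \<in> {1..<int q}" "y \<in> {1..<int q}" "?h x = ?h y"
    then have "int q dvd 4 * (x - y)" by (simp add: mod_eq_dvd_iff algebra_simps)
    then have "int q dvd x - y" using cop coprime_dvd_mult_right_iff by blast
    then have "x mod int q = y mod int q" by (simp add: mod_eq_dvd_iff)
    then show "x = y" using xy by simp
  qed
  moreover have "?h ` {1..<int q} \<subseteq> {1..<int q}"
  proof
    fix z assume "z \<in> ?h ` {1..<int q}"
    then obtain x where x: "x \<in> {1..<int q}" "z = ?h x" by blast
    have "\<not> int q dvd 4 * x"
      using x cop coprime_dvd_mult_right_iff[of "int q" 4 x] zdvd_not_zless[of x "int q"] by auto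
    then have "z \<noteq> 0" using x by (simp add: dvd_eq_mod_eq_0)
    moreover have "0 \<le> z" "z < int q" using x by auto
    ultimately show "z \<in> {1..<int q}" by auto
  qed
  ultimately show "bij_betw ?h {1..<int q} {1..<int q}"
    by (simp add: bij_betw_def endo_inj_surj)
qed

text \<open>
  A discrete form of the logarithmic growth of Lebesgue constants. For odd \<open>q\<close>
  the frequencies \<open>4 * h\<close> run through all nonzero residues again.
\<close>
lemma sum_norm_twisted_sum:
  assumes eps: "\<And>j. \<bar>\<epsilon> j\<bar> \<le> 1" and per: "\<And>j. \<epsilon> (j + 4) = \<epsilon> j" and q: "odd q"
  shows "(\<Sum>h\<in>{0..<int q}. norm (twisted_sum \<epsilon> r t q h)) \<le> real t + 16 * real q * harm q"
proof -
  have "q > 0" using q by (auto intro: Nat.gr0I)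
  have "norm (twisted_sum \<epsilon> r t q h) \<le> 8 * (1 / norm (1 - additive_char q (4 * h mod int q)))"
    if "h \<in> {1..<int q}" for h
  proof -
    have "coprime (int q) 4"
      by (rule coprime_int_4[OF q])
    then have "\<not> int q dvd 4 * h"
      using that coprime_dvd_mult_right_iff[of "int q" 4 h] zdvd_not_zless[of h "int q"] by auto
    then have "norm (1 - additive_char q (4 * h)) > 0"
      using additive_char_eq_1_iff[OF \<open>q > 0\<close>, of "4 * h"] by auto
    moreover have "additive_char q (4 * h mod int q) = additive_char q (4 * h)"
      by (rule additive_char_cong[OF \<open>q > 0\<close>]) (simp add: cong_def)
    ultimately show ?thesis
      using norm_twisted_sum_telescope[of \<epsilon> q h r t, OF eps per] by (simp add: field_simps)
  qed
  then have "(\<Sum>h\<in>{1..<int q}. norm (twisted_sum \<epsilon> r t q h)) \<le>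
      (\<Sum>h\<in>{1..<int q}. 8 * (1 / norm (1 - additive_char q (4 * h mod int q))))"
    by (rule sum_mono)
  also have "\<dots> = 8 * (\<Sum>h\<in>{1..<int q}. 1 / norm (1 - additive_char q h))"
    unfolding sum_distrib_left [symmetric]
    by (subst sum_mult_4_residues[OF q, of "\<lambda>h. 1 / norm (1 - additive_char q h)"]) (rule refl)
  also have "\<dots> \<le> 8 * (2 * real q * harm q)"
    by (intro mult_left_mono sum_inverse_norm_one_minus_additive_char) simp
  finally have "(\<Sum>h\<in>{1..<int q}. norm (twisted_sum \<epsilon> r t q h)) \<le> 16 * real q * harm q" by simp
  moreover have "{0..<int q} = insert 0 {1..<int q}" using \<open>q > 0\<close> by auto
  ultimately show ?thesis
    using norm_twisted_sum_trivial[of \<epsilon> r t q 0, OF eps] by simp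
qed

section \<open>Fourier expansion of the sum of squared autocorrelations\<close>

text \<open>
  For a sequence on an interval of length \<open>t\<close>, the sum of the products over these quadruples is the sum of the
  squares of all its aperiodic autocorrelations, equivalently the fourth power of the \<open>L\<^sup>4\<close> norm of the
  associated polynomial on the unit circle.
\<close>
definition additive_quads :: "int \<Rightarrow> nat \<Rightarrow> (int \<times> int \<times> int \<times> int) set" where
  "additive_quads r t = {(j1, j2, j3, j4). j1 \<in> {r..<r + int t} \<and> j2 \<in> {r..<r + int t} \<and>
     j3 \<in> {r..<r + int t} \<and> j4 \<in> {r..<r + int t} \<and> j1 + j2 = j3 + j4}"

definition energy :: "(int \<Rightarrow> real) \<Rightarrow> int \<Rightarrow> nat \<Rightarrow> real" where
  "energy f r t = (\<Sum>(j1, j2, j3, j4)\<in>additive_quads r t. f j1 * f j2 * f j3 * f j4)"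

lemma additive_quads_altdef:
  "additive_quads r t = {x \<in> {r..<r + int t} \<times> {r..<r + int t} \<times> {r..<r + int t} \<times> {r..<r + int t}.
     case x of (j1, j2, j3, j4) \<Rightarrow> j1 + j2 = j3 + j4}"
  by (auto simp: additive_quads_def)

lemma finite_additive_quads [simp]: "finite (additive_quads r t)"
  unfolding additive_quads_altdef by (rule finite_subset[OF Collect_restrict]) auto

lemma additive_quadsD: "(j1, j2, j3, j4) \<in> additive_quads r t \<Longrightarrow> j1 + j2 = j3 + j4"
  by (simp add: additive_quads_def)

context odd_prime_modulus
begin

lemma p_pos: "p > 0" using p_ge_3 by simp

definition gauss_sum :: complex where
  "gauss_sum = (\<Sum>k\<in>residues_mod. of_real (chi k) * additive_char p k)"

text \<open>
  The Legendre symbol is, up to the Gauss sum, its own Fourier transform: this is the special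
  property of Legendre sequences behind their merit factors.
\<close>
lemma chi_fourier:
  "(\<Sum>k\<in>residues_mod. of_real (chi k) * additive_char p (k * j)) = of_real (chi j) * gauss_sum"
proof (cases "int p dvd j")
  case True
  then have "additive_char p (k * j) = 1" for k
    using additive_char_eq_1_iff[OF p_pos] by simp
  moreover have "chi j = 0" using True chi_eq_0_iff by simp
  ultimately show ?thesis using sum_chi by (simp flip: of_real_sum)
next
  case False
  have "periodic_mod (\<lambda>k. of_real (chi k) * additive_char p k)"
    by (intro periodic_modI arg_cong2[where f = "(*)"] arg_cong[where f = of_real] chi_cong
        additive_char_cong p_pos)
  from sum_affine_residues[OF this False, of 0]
  have "gauss_sum = (\<Sum>k\<in>residues_mod. of_real (chi j) * (of_real (chi k) * additive_char p (k * j)))"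
    unfolding gauss_sum_def by (simp add: chi_mult mult_ac)
  then have "of_real (chi j) * gauss_sum =
      of_real (chi j * chi j) * (\<Sum>k\<in>residues_mod. of_real (chi k) * additive_char p (k * j))"
    by (simp add: sum_distrib_left mult.assoc)
  then show ?thesis using False chi_square[of j] by simp
qed

lemma sum_chi_square: "(\<Sum>k\<in>residues_mod. chi k * chi k) = real p - 1"
  using chi_pair_correlation[of 0 0] p_pos by simp

text \<open>
  Parseval, applied to the Fourier transform of the Legendre symbol.
\<close>
lemma gauss_sum_norm: "gauss_sum * cnj gauss_sum = of_nat p"
proof -
  let ?F = "\<lambda>j. \<Sum>k\<in>residues_mod. of_real (chi k) * additive_char p (k * j)"
  have "of_real (real p - 1) * (gauss_sum * cnj gauss_sum) =
      (\<Sum>j\<in>residues_mod. of_real (chi j * chi j) * (gauss_sum * cnj gauss_sum))"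
    unfolding sum_distrib_right [symmetric] of_real_sum [symmetric] sum_chi_square ..
  also have "\<dots> = (\<Sum>j\<in>residues_mod. ?F j * cnj (?F j))"
    by (rule sum.cong[OF refl], simp only: chi_fourier, simp add: mult_ac)
  also have "\<dots> = (\<Sum>j\<in>residues_mod. \<Sum>k\<in>residues_mod. \<Sum>l\<in>residues_mod.
      of_real (chi k * chi l) * additive_char p (j * (k - l)))"
    by (simp add: sum_product additive_char_diff right_diff_distrib mult_ac)
  also have "\<dots> = (\<Sum>k\<in>residues_mod. \<Sum>l\<in>residues_mod. \<Sum>j\<in>residues_mod.
      of_real (chi k * chi l) * additive_char p (j * (k - l)))"
    by (subst sum.swap, rule sum.cong[OF refl], rule sum.swap)
  also have "\<dots> = (\<Sum>k\<in>residues_mod. \<Sum>l\<in>residues_mod. if l = k then of_nat p * of_real (chi k * chi k) else 0)"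
  proof (intro sum.cong refl)
    fix k l assume kl: "k \<in> residues_mod" "l \<in> residues_mod"
    have "int p dvd k - l \<longleftrightarrow> l = k"
      using kl cong_residues_eq[of k l] by (auto simp: cong_iff_dvd_diff)
    then show "(\<Sum>j\<in>residues_mod. of_real (chi k * chi l) * additive_char p (j * (k - l))) =
        (if l = k then of_nat p * of_real (chi k * chi k) else 0)"
      by (simp add: sum_distrib_left [symmetric] sum_additive_char[OF p_pos])
  qed
  also have "\<dots> = of_nat p * of_real (\<Sum>k\<in>residues_mod. chi k * chi k)"
    by (simp add: sum_distrib_left)
  also have "\<dots> = of_real (real p - 1) * of_nat p"
    by (simp add: sum_chi_square)
  finally show ?thesis using p_ge_3 by simp
qed

abbreviation residue_triples :: "(int \<times> int \<times> int) set" where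
  "residue_triples \<equiv> residues_mod \<times> residues_mod \<times> residues_mod"

text \<open>
  Each symbol is expanded by the previous formula, with conjugation for \<open>j3\<close> and \<open>j4\<close>. Since
  \<open>j1 + j2 = j3 + j4\<close>, the resulting phase is invariant under a common shift of the four frequencies;
  summing over this shift produces a complete correlation.
\<close>
lemma chi_quad_fourier:
  assumes j: "j1 + j2 = j3 + j4"
  shows "of_nat p ^ 2 * of_real (chi j1 * chi j2 * chi j3 * chi j4) =
    (\<Sum>(a, b, c)\<in>residue_triples. of_real (quad_correlation a b c) * additive_char p (a * j1 + b * j2 - c * j3))"
proof -
  let ?h = "\<lambda>k. of_real (chi k) :: complex"
  let ?e = "additive_char p"
  let ?F = "\<lambda>k1 k2 k3 k4. (?h k1 * ?e (k1 * j1)) * (?h k2 * ?e (k2 * j2))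
      * (?h k3 * cnj (?e (k3 * j3))) * (?h k4 * cnj (?e (k4 * j4)))"
  have cong: "?F a1 a2 a3 k = ?F b1 b2 b3 k"
    if "[a1 = b1] (mod int p)" "[a2 = b2] (mod int p)" "[a3 = b3] (mod int p)" for a1 a2 a3 b1 b2 b3 k
    using that
    by (intro arg_cong2[where f = "(*)"] arg_cong[where f = of_real] arg_cong[where f = cnj] refl chi_cong
        additive_char_cong p_pos cong_mult cong_refl)
  have cnj_fourier: "(\<Sum>k\<in>residues_mod. ?h k * cnj (?e (k * j))) = ?h j * cnj gauss_sum" for j
    using arg_cong[OF chi_fourier[of j], of cnj] by simp
  have "of_nat p ^ 2 * of_real (chi j1 * chi j2 * chi j3 * chi j4) =
     (?h j1 * gauss_sum) * (?h j2 * gauss_sum) * (?h j3 * cnj gauss_sum) * (?h j4 * cnj gauss_sum)"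
    by (simp flip: gauss_sum_norm add: power2_eq_square mult_ac)
  also have "\<dots> = (\<Sum>(k1, k2, k3, k4)\<in>residue_quads. ?F k1 k2 k3 k4)"
    unfolding chi_fourier [symmetric] cnj_fourier [symmetric] by (rule sum_prod4)
  also have "\<dots> = (\<Sum>(k1, k2, k3)\<in>residue_triples. \<Sum>k4\<in>residues_mod. ?F k1 k2 k3 k4)"
    by (simp add: sum.cartesian_product [symmetric])
  also have "\<dots> = (\<Sum>k4\<in>residues_mod. \<Sum>(k1, k2, k3)\<in>residue_triples. ?F k1 k2 k3 k4)"
    by (simp only: split_def sum.swap[of _ _ residue_triples])
  also have "\<dots> = (\<Sum>k4\<in>residues_mod. \<Sum>(a, b, c)\<in>residue_triples. ?F (a + k4) (b + k4) (c + k4) k4)"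
  proof (rule sum.cong[OF refl])
    fix m
    have 3: "(\<Sum>c\<in>residues_mod. ?F a b (c + m) m) = (\<Sum>c\<in>residues_mod. ?F a b c m)" for a b
      by (rule sum_shift_residues) (intro periodic_modI cong cong_refl)
    have 2: "(\<Sum>b\<in>residues_mod. \<Sum>c\<in>residues_mod. ?F a (b + m) c m) =
        (\<Sum>b\<in>residues_mod. \<Sum>c\<in>residues_mod. ?F a b c m)" for a
      by (rule sum_shift_residues) (intro periodic_modI sum.cong refl cong cong_refl)
    have 1: "(\<Sum>a\<in>residues_mod. \<Sum>b\<in>residues_mod. \<Sum>c\<in>residues_mod. ?F (a + m) b c m) =
        (\<Sum>a\<in>residues_mod. \<Sum>b\<in>residues_mod. \<Sum>c\<in>residues_mod. ?F a b c m)"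
      by (rule sum_shift_residues) (intro periodic_modI sum.cong refl cong cong_refl)
    show "(\<Sum>(a, b, c)\<in>residue_triples. ?F a b c m) = (\<Sum>(a, b, c)\<in>residue_triples. ?F (a + m) (b + m) (c + m) m)"
      unfolding sum.cartesian_product [symmetric] 3 2 1 ..
  qed
  also have "\<dots> = (\<Sum>(a, b, c)\<in>residue_triples. \<Sum>m\<in>residues_mod. ?F (a + m) (b + m) (c + m) m)"
    by (simp only: split_def sum.swap[of _ residues_mod residue_triples])
  also have "\<dots> = (\<Sum>(a, b, c)\<in>residue_triples.
      of_real (quad_correlation a b c) * ?e (a * j1 + b * j2 - c * j3))"
  proof (intro sum.cong refl, clarify)
    fix a b c
    have "?F (a + m) (b + m) (c + m) m =
        of_real (chi (m + a) * chi (m + b) * chi (m + c) * chi m) * ?e (a * j1 + b * j2 - c * j3)" for m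
    proof -
      have "?e ((a + m) * j1) * ?e ((b + m) * j2) * cnj (?e ((c + m) * j3)) * cnj (?e (m * j4))
        = ?e ((a + m) * j1 + (b + m) * j2 - (c + m) * j3 - m * j4)"
        by (simp add: additive_char_add additive_char_diff)
      also have "(a + m) * j1 + (b + m) * j2 - (c + m) * j3 - m * j4
        = a * j1 + b * j2 - c * j3 + m * (j1 + j2 - j3 - j4)" by (simp add: algebra_simps)
      also have "\<dots> = a * j1 + b * j2 - c * j3" using j by simp
      finally show ?thesis by (simp add: add.commute mult_ac)
    qed
    then show "(\<Sum>m\<in>residues_mod. ?F (a + m) (b + m) (c + m) m) =
        of_real (quad_correlation a b c) * ?e (a * j1 + b * j2 - c * j3)"
      by (simp only: quad_correlation_def of_real_sum sum_distrib_right)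
  qed
  finally show ?thesis .
qed

definition kernel :: "(int \<Rightarrow> real) \<Rightarrow> int \<Rightarrow> nat \<Rightarrow> int \<Rightarrow> int \<Rightarrow> int \<Rightarrow> complex" where
  "kernel \<epsilon> r t a b c = (\<Sum>(j1, j2, j3, j4)\<in>additive_quads r t.
     of_real (\<epsilon> j1 * \<epsilon> j2 * \<epsilon> j3 * \<epsilon> j4) * additive_char p (a * j1 + b * j2 - c * j3))"

lemma sum_kernel:
  fixes w :: "int \<Rightarrow> int \<Rightarrow> int \<Rightarrow> real"
  shows "(\<Sum>(a, b, c)\<in>residue_triples. of_real (w a b c) * kernel \<epsilon> r t a b c) =
    (\<Sum>(j1, j2, j3, j4)\<in>additive_quads r t. of_real (\<epsilon> j1 * \<epsilon> j2 * \<epsilon> j3 * \<epsilon> j4) *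
      (\<Sum>(a, b, c)\<in>residue_triples. of_real (w a b c) * additive_char p (a * j1 + b * j2 - c * j3)))"
  unfolding kernel_def split_def sum_distrib_left
  by (subst sum.swap) (simp only: mult_ac)

lemma energy_expansion:
  "of_nat p ^ 2 * of_real (energy (\<lambda>j. \<epsilon> j * chi j) r t) =
    (\<Sum>(a, b, c)\<in>residue_triples. of_real (quad_correlation a b c) * kernel \<epsilon> r t a b c)"
proof -
  have "of_nat p ^ 2 * (of_real (energy (\<lambda>j. \<epsilon> j * chi j) r t) :: complex) =
    (\<Sum>(j1, j2, j3, j4)\<in>additive_quads r t. of_real (\<epsilon> j1 * \<epsilon> j2 * \<epsilon> j3 * \<epsilon> j4) *
      (of_nat p ^ 2 * of_real (chi j1 * chi j2 * chi j3 * chi j4)))"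
    unfolding energy_def of_real_sum sum_distrib_left split_def
    by (intro sum.cong refl) (simp add: mult_ac)
  also have "\<dots> = (\<Sum>(j1, j2, j3, j4)\<in>additive_quads r t. of_real (\<epsilon> j1 * \<epsilon> j2 * \<epsilon> j3 * \<epsilon> j4) *
      (\<Sum>(a, b, c)\<in>residue_triples. of_real (quad_correlation a b c) * additive_char p (a * j1 + b * j2 - c * j3)))"
    by (rule sum.cong[OF refl], clarify) (simp only: chi_quad_fourier[OF additive_quadsD])
  finally show ?thesis by (simp only: sum_kernel)
qed

text \<open>
  Each way of pairing leaves one free frequency, and summing over it detects a congruence for the positions.
\<close>
lemma sum_pair_weight:
  "(\<Sum>(a, b, c)\<in>residue_triples. of_real (pair_weight a b c) * additive_char p (a * j1 + b * j2 - c * j3)) =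
    of_nat p * of_bool (int p dvd j1 - j3) + of_nat p * of_bool (int p dvd j2 - j3)
      + of_nat p * of_bool (int p dvd j1 + j2) - 2"
proof -
  let ?e = "\<lambda>a b c. additive_char p (a * j1 + b * j2 - c * j3)"
  have z: "0 \<in> residues_mod" using p_pos by simp
  have ofb: "(of_real (of_bool P) :: complex) = of_bool P" for P
    by (cases P) simp_all
  have A: "(\<Sum>(a, b, c)\<in>residue_triples. of_bool (b = 0 \<and> a = c) * ?e a b c) = of_nat p * of_bool (int p dvd j1 - j3)"
  proof -
    have "(\<Sum>(a, b, c)\<in>residue_triples. of_bool (b = 0 \<and> a = c) * ?e a b c)
      = (\<Sum>a\<in>residues_mod. \<Sum>b\<in>residues_mod. if b = 0 then \<Sum>c\<in>residues_mod. if c = a then ?e a 0 a else 0 else 0)"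
      unfolding sum.cartesian_product [symmetric] by (intro sum.cong refl) (auto intro!: sum.cong)
    also have "\<dots> = (\<Sum>a\<in>residues_mod. additive_char p (a * (j1 - j3)))"
      using z by (intro sum.cong refl) (simp add: right_diff_distrib)
    finally show ?thesis by (simp add: sum_additive_char[OF p_pos])
  qed
  have B: "(\<Sum>(a, b, c)\<in>residue_triples. of_bool (a = 0 \<and> b = c) * ?e a b c) = of_nat p * of_bool (int p dvd j2 - j3)"
  proof -
    have "(\<Sum>(a, b, c)\<in>residue_triples. of_bool (a = 0 \<and> b = c) * ?e a b c)
      = (\<Sum>a\<in>residues_mod. if a = 0 then \<Sum>b\<in>residues_mod. \<Sum>c\<in>residues_mod. if c = b then ?e 0 b b else 0 else 0)"
      unfolding sum.cartesian_product [symmetric] by (intro sum.cong refl) (auto intro!: sum.cong)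
    also have "\<dots> = (\<Sum>b\<in>residues_mod. additive_char p (b * (j2 - j3)))"
      using z by (simp add: right_diff_distrib)
    finally show ?thesis by (simp add: sum_additive_char[OF p_pos])
  qed
  have C: "(\<Sum>(a, b, c)\<in>residue_triples. of_bool (c = 0 \<and> a = b) * ?e a b c) = of_nat p * of_bool (int p dvd j1 + j2)"
  proof -
    have "(\<Sum>(a, b, c)\<in>residue_triples. of_bool (c = 0 \<and> a = b) * ?e a b c)
      = (\<Sum>a\<in>residues_mod. \<Sum>b\<in>residues_mod. if b = a then \<Sum>c\<in>residues_mod. if c = 0 then ?e a a 0 else 0 else 0)"
      unfolding sum.cartesian_product [symmetric] by (intro sum.cong refl) (auto intro!: sum.cong)
    also have "\<dots> = (\<Sum>a\<in>residues_mod. additive_char p (a * (j1 + j2)))"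
      using z by (intro sum.cong refl) (simp add: distrib_left)
    finally show ?thesis by (simp add: sum_additive_char[OF p_pos])
  qed
  have D: "(\<Sum>(a, b, c)\<in>residue_triples. of_bool (a = 0 \<and> b = 0 \<and> c = 0) * ?e a b c) = 1"
    using z by (subst sum.mono_neutral_right[where S = "{(0, 0, 0)}"]) auto
  have "(\<Sum>(a, b, c)\<in>residue_triples. of_real (pair_weight a b c) * ?e a b c) =
    (\<Sum>(a, b, c)\<in>residue_triples. of_bool (b = 0 \<and> a = c) * ?e a b c) +
    (\<Sum>(a, b, c)\<in>residue_triples. of_bool (a = 0 \<and> b = c) * ?e a b c) +
    (\<Sum>(a, b, c)\<in>residue_triples. of_bool (c = 0 \<and> a = b) * ?e a b c) -
    2 * (\<Sum>(a, b, c)\<in>residue_triples. of_bool (a = 0 \<and> b = 0 \<and> c = 0) * ?e a b c)"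
    unfolding sum_distrib_left sum.distrib [symmetric] sum_subtractf [symmetric] split_def
    by (intro sum.cong refl) (simp only: pair_weight_def of_real_add of_real_diff of_real_mult ofb
        of_real_numeral distrib_right left_diff_distrib mult.assoc)
  then show ?thesis unfolding A B C D by simp
qed

text \<open>
  What remains of the energy if each correlation \<open>quad_correlation a b c\<close> is replaced by \<open>p\<close> times its
  pair weight.
\<close>
definition main_term :: "(int \<Rightarrow> real) \<Rightarrow> int \<Rightarrow> nat \<Rightarrow> real" where
  "main_term \<epsilon> r t = (\<Sum>(j1, j2, j3, j4)\<in>additive_quads r t. \<epsilon> j1 * \<epsilon> j2 * \<epsilon> j3 * \<epsilon> j4 *
     (of_bool (int p dvd j1 - j3) + of_bool (int p dvd j2 - j3) + of_bool (int p dvd j1 + j2) - 2 / real p))"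

lemma main_term_expansion:
  "of_nat p ^ 2 * of_real (main_term \<epsilon> r t) =
    (\<Sum>(a, b, c)\<in>residue_triples. of_real (real p * pair_weight a b c) * kernel \<epsilon> r t a b c)"
proof -
  have "(\<Sum>(a, b, c)\<in>residue_triples. of_real (real p * pair_weight a b c) * kernel \<epsilon> r t a b c) =
    of_nat p * (\<Sum>(a, b, c)\<in>residue_triples. of_real (pair_weight a b c) * kernel \<epsilon> r t a b c)"
    by (simp add: sum_distrib_left split_def mult_ac)
  also have "\<dots> = of_nat p * (\<Sum>(j1, j2, j3, j4)\<in>additive_quads r t. of_real (\<epsilon> j1 * \<epsilon> j2 * \<epsilon> j3 * \<epsilon> j4) *
      (of_nat p * of_bool (int p dvd j1 - j3) + of_nat p * of_bool (int p dvd j2 - j3)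
      + of_nat p * of_bool (int p dvd j1 + j2) - 2))"
    by (simp only: sum_kernel sum_pair_weight)
  also have "\<dots> = of_nat p ^ 2 * of_real (main_term \<epsilon> r t)"
    unfolding main_term_def of_real_sum sum_distrib_left split_def
    using p_pos by (intro sum.cong refl) (simp add: field_simps power2_eq_square)
  finally show ?thesis ..
qed

lemma energy_error:
  "real p ^ 2 * \<bar>energy (\<lambda>j. \<epsilon> j * chi j) r t - main_term \<epsilon> r t\<bar> \<le>
    5 * real p powr (3 / 4) * (\<Sum>(a, b, c)\<in>residue_triples. norm (kernel \<epsilon> r t a b c))"
proof -
  have "of_nat p ^ 2 * of_real (energy (\<lambda>j. \<epsilon> j * chi j) r t - main_term \<epsilon> r t) =
    (\<Sum>(a, b, c)\<in>residue_triples. of_real (quad_correlation a b c - real p * pair_weight a b c) * kernel \<epsilon> r t a b c)"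
    by (simp only: of_real_diff right_diff_distrib energy_expansion main_term_expansion split_def
        sum_subtractf [symmetric] left_diff_distrib)
  then have "norm (of_nat p ^ 2 * of_real (energy (\<lambda>j. \<epsilon> j * chi j) r t - main_term \<epsilon> r t) :: complex) \<le>
    (\<Sum>(a, b, c)\<in>residue_triples. 5 * real p powr (3 / 4) * norm (kernel \<epsilon> r t a b c))"
    by (simp only:, intro sum_norm_le)
       (auto simp: norm_mult simp flip: of_real_diff of_nat_mult intro!: mult_right_mono quad_correlation_estimate)
  then show ?thesis
    by (simp add: norm_mult norm_power sum_distrib_left split_def flip: of_real_diff)
qed

text \<open>
  The condition \<open>j1 + j2 = j3 + j4\<close> is detected by characters of a modulus \<open>q \<ge> 2 * t\<close>, for which a
  congruence between sums of two positions is an equality. As \<open>q\<close> is a multiple of \<open>p\<close>, the frequencies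
  \<open>a / p\<close> are among the frequencies \<open>h / q\<close>.
\<close>
lemma kernel_eq:
  fixes \<epsilon> :: "int \<Rightarrow> real" and r :: int
  assumes q: "q = n * p" "n > 0" "2 * t \<le> q"
  defines "D \<equiv> twisted_sum \<epsilon> r t q"
  shows "of_nat q * kernel \<epsilon> r t a b c =
    (\<Sum>h\<in>{0..<int q}. D (h + int n * a) * D (h + int n * b) * cnj (D (h + int n * c)) * cnj (D h))"
proof -
  let ?J = "{r..<r + int t}"
  let ?Q = "?J \<times> ?J \<times> ?J \<times> ?J"
  let ?e = "additive_char q"
  have "q > 0" using q p_pos by simp
  have cnjD: "cnj (D h) = (\<Sum>j\<in>?J. of_real (\<epsilon> j) * cnj (?e (h * j)))" for h
    by (simp add: D_def twisted_sum_def)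
  let ?w = "\<lambda>(j1, j2, j3, j4). of_real (\<epsilon> j1 * \<epsilon> j2 * \<epsilon> j3 * \<epsilon> j4) * additive_char p (a * j1 + b * j2 - c * j3)"
  have summand: "(of_real (\<epsilon> j1) * ?e ((h + int n * a) * j1)) * (of_real (\<epsilon> j2) * ?e ((h + int n * b) * j2))
      * (of_real (\<epsilon> j3) * cnj (?e ((h + int n * c) * j3))) * (of_real (\<epsilon> j4) * cnj (?e (h * j4)))
      = ?w (j1, j2, j3, j4) * ?e (h * (j1 + j2 - j3 - j4))" for h j1 j2 j3 j4
  proof -
    have "?e ((h + int n * a) * j1) * ?e ((h + int n * b) * j2) * cnj (?e ((h + int n * c) * j3)) * cnj (?e (h * j4))
       = ?e ((h + int n * a) * j1 + (h + int n * b) * j2 - (h + int n * c) * j3 - h * j4)"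
      by (simp only: additive_char_add additive_char_diff)
    also have "(h + int n * a) * j1 + (h + int n * b) * j2 - (h + int n * c) * j3 - h * j4
       = int n * (a * j1 + b * j2 - c * j3) + h * (j1 + j2 - j3 - j4)"
      by (simp add: algebra_simps)
    also have "?e \<dots> = additive_char p (a * j1 + b * j2 - c * j3) * ?e (h * (j1 + j2 - j3 - j4))"
      by (simp only: additive_char_add q(1) additive_char_mult_modulus[OF q(2)])
    finally show ?thesis by (simp add: mult_ac)
  qed
  have "(\<Sum>h\<in>{0..<int q}. D (h + int n * a) * D (h + int n * b) * cnj (D (h + int n * c)) * cnj (D h)) =
    (\<Sum>h\<in>{0..<int q}. \<Sum>x\<in>?Q. ?w x * (case x of (j1, j2, j3, j4) \<Rightarrow> ?e (h * (j1 + j2 - j3 - j4))))"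
    by (rule sum.cong[OF refl], unfold cnjD, unfold D_def twisted_sum_def sum_prod4, rule sum.cong[OF refl])
       (simp only: split_paired_all prod.case summand)
  also have "\<dots> = (\<Sum>x\<in>?Q. ?w x * (case x of (j1, j2, j3, j4) \<Rightarrow> \<Sum>h\<in>{0..<int q}. ?e (h * (j1 + j2 - j3 - j4))))"
    by (subst sum.swap) (simp only: split_def sum_distrib_left)
  also have "\<dots> = (\<Sum>x\<in>?Q. if (case x of (j1, j2, j3, j4) \<Rightarrow> j1 + j2 = j3 + j4) then of_nat q * ?w x else 0)"
  proof (rule sum.cong[OF refl])
    fix x assume x: "x \<in> ?Q"
    obtain j1 j2 j3 j4 where xj: "x = (j1, j2, j3, j4)" by (cases x)
    then have j: "j1 \<in> ?J" "j2 \<in> ?J" "j3 \<in> ?J" "j4 \<in> ?J" using x by auto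
    have "int q dvd j1 + j2 - j3 - j4 \<longleftrightarrow> j1 + j2 = j3 + j4"
    proof
      assume dvd: "int q dvd j1 + j2 - j3 - j4"
      moreover have "\<bar>j1 + j2 - j3 - j4\<bar> < int q" using j q(3) by auto
      ultimately have "j1 + j2 - j3 - j4 = 0"
        using dvd_imp_le_int[of "j1 + j2 - j3 - j4" "int q"] by linarith
      then show "j1 + j2 = j3 + j4" by simp
    qed simp
    then show "?w x * (case x of (j1, j2, j3, j4) \<Rightarrow> \<Sum>h\<in>{0..<int q}. ?e (h * (j1 + j2 - j3 - j4))) =
      (if (case x of (j1, j2, j3, j4) \<Rightarrow> j1 + j2 = j3 + j4) then of_nat q * ?w x else 0)"
      by (simp add: xj sum_additive_char[OF \<open>q > 0\<close>])
  qed
  also have "\<dots> = (\<Sum>x\<in>additive_quads r t. of_nat q * ?w x)"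
    unfolding additive_quads_altdef by (rule sum.inter_filter[symmetric]) simp
  also have "\<dots> = of_nat q * kernel \<epsilon> r t a b c"
    unfolding kernel_def by (simp only: sum_distrib_left)
  finally show ?thesis ..
qed

text \<open>
  For fixed \<open>h\<close> the three frequencies vary independently, each over part of a complete residue system
  modulo \<open>q\<close>; so the triple sum splits into three factors, each at most the sum over all frequencies.
\<close>
lemma sum_norm_kernel:
  fixes \<epsilon> :: "int \<Rightarrow> real" and r :: int
  assumes q: "q = n * p" "n > 0" "2 * t \<le> q"
  defines "B \<equiv> (\<Sum>h\<in>{0..<int q}. norm (twisted_sum \<epsilon> r t q h))"
  shows "real q * (\<Sum>(a, b, c)\<in>residue_triples. norm (kernel \<epsilon> r t a b c)) \<le> B ^ 4"
proof -
  define D where "D = (\<lambda>h. norm (twisted_sum \<epsilon> r t q h))"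
  have "q > 0" using q p_pos by simp
  have B0: "B \<ge> 0" unfolding B_def by (intro sum_nonneg) simp
  have slice: "(\<Sum>a\<in>residues_mod. D (h + int n * a)) \<le> B" for h
  proof -
    let ?g = "\<lambda>a. (h + int n * a) mod int q"
    have "inj_on ?g residues_mod"
    proof (rule inj_onI)
      fix x y assume xy: "x \<in> residues_mod" "y \<in> residues_mod" "?g x = ?g y"
      then have "int n * int p dvd int n * (x - y)"
        using q(1) by (simp add: mod_eq_dvd_iff algebra_simps)
      then have "int p dvd x - y" using q(2) by simp
      then show "x = y" using xy by (intro cong_residues_eq) (simp_all add: cong_iff_dvd_diff)
    qed
    then have "(\<Sum>a\<in>residues_mod. D (?g a)) = (\<Sum>h\<in>?g ` residues_mod. D h)"
      by (simp add: sum.reindex)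
    also have "\<dots> \<le> B"
      unfolding B_def D_def using \<open>q > 0\<close> by (intro sum_mono2) auto
    also have "(\<Sum>a\<in>residues_mod. D (?g a)) = (\<Sum>a\<in>residues_mod. D (h + int n * a))"
      unfolding D_def by (intro sum.cong refl arg_cong[where f = norm] twisted_sum_cong \<open>q > 0\<close>) (simp add: cong_def)
    finally show ?thesis .
  qed
  have slice0: "(\<Sum>a\<in>residues_mod. D (h + int n * a)) \<ge> 0" for h
    unfolding D_def by (intro sum_nonneg) simp
  have "real q * (\<Sum>(a, b, c)\<in>residue_triples. norm (kernel \<epsilon> r t a b c)) =
    (\<Sum>(a, b, c)\<in>residue_triples. norm (of_nat q * kernel \<epsilon> r t a b c))"
    by (simp add: sum_distrib_left split_def norm_mult)
  also have "\<dots> \<le> (\<Sum>(a, b, c)\<in>residue_triples. \<Sum>h\<in>{0..<int q}.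
      D (h + int n * a) * D (h + int n * b) * D (h + int n * c) * D h)"
    unfolding split_def kernel_eq[OF q] D_def
    by (intro sum_mono sum_norm_le) (simp add: norm_mult)
  also have "\<dots> = (\<Sum>h\<in>{0..<int q}. \<Sum>(a, b, c)\<in>residue_triples.
      D (h + int n * a) * D (h + int n * b) * D (h + int n * c) * D h)"
    by (simp only: split_def sum.swap[of _ _ residue_triples])
  also have "\<dots> = (\<Sum>h\<in>{0..<int q}. (\<Sum>a\<in>residues_mod. D (h + int n * a)) * (\<Sum>a\<in>residues_mod. D (h + int n * a))
      * (\<Sum>a\<in>residues_mod. D (h + int n * a)) * D h)"
    by (simp add: sum.cartesian_product [symmetric] sum_distrib_left [symmetric] sum_distrib_right [symmetric])
  also have "\<dots> \<le> (\<Sum>h\<in>{0..<int q}. B * B * B * D h)"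
    by (intro sum_mono mult_mono slice slice0 mult_nonneg_nonneg B0) (simp_all add: D_def)
  also have "\<dots> = B ^ 4"
    unfolding B_def D_def by (simp add: sum_distrib_left [symmetric] power4_eq_xxxx)
  finally show ?thesis .
qed

end

section \<open>The main term in terms of correlations of the signs\<close>

lemma sum_symmetric_int:
  fixes f :: "int \<Rightarrow> real"
  assumes "t > 0" "\<And>u. f (- u) = f u"
  shows "(\<Sum>u\<in>{- int t<..<int t}. f u) = f 0 + 2 * (\<Sum>u = 1..t - 1. f (int u))"
proof -
  have "{- int t<..<int t} = {- int t<..<0} \<union> ({0} \<union> {0<..<int t})" using assms(1) by auto
  then have "(\<Sum>u\<in>{- int t<..<int t}. f u) = (\<Sum>u\<in>{- int t<..<0}. f u) + (f 0 + (\<Sum>u\<in>{0<..<int t}. f u))"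
    by (simp add: sum.union_disjoint)
  also have "(\<Sum>u\<in>{- int t<..<0}. f u) = (\<Sum>u\<in>{0<..<int t}. f u)"
    by (rule sum.reindex_bij_witness[where i = uminus and j = uminus]) (auto simp: assms)
  also have "(\<Sum>u\<in>{0<..<int t}. f u) = (\<Sum>u = 1..t - 1. f (int u))"
    by (rule sum.reindex_bij_witness[where i = int and j = nat]) (use assms in auto)
  finally show ?thesis by simp
qed

definition shift_corr :: "(int \<Rightarrow> real) \<Rightarrow> int \<Rightarrow> nat \<Rightarrow> int \<Rightarrow> real" where
  "shift_corr f r t u = (\<Sum>j\<in>{j \<in> {r..<r + int t}. j + u \<in> {r..<r + int t}}. f j * f (j + u))"

definition reflect_corr :: "(int \<Rightarrow> real) \<Rightarrow> int \<Rightarrow> nat \<Rightarrow> int \<Rightarrow> real" where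
  "reflect_corr f r t s = (\<Sum>j\<in>{j \<in> {r..<r + int t}. s - j \<in> {r..<r + int t}}. f j * f (s - j))"

lemma shift_corr_minus: "shift_corr f r t (- u) = shift_corr f r t u"
  unfolding shift_corr_def
  by (rule sum.reindex_bij_witness[where i = "\<lambda>j. j + u" and j = "\<lambda>j. j - u"]) auto

lemma additive_quads_solved: "(j1, j2, j3, j4) \<in> additive_quads r t \<longleftrightarrow>
    j4 = j1 + j2 - j3 \<and> j1 \<in> {r..<r + int t} \<and> j2 \<in> {r..<r + int t} \<and>
    j3 \<in> {r..<r + int t} \<and> j1 + j2 - j3 \<in> {r..<r + int t}"
  by (auto simp: additive_quads_def)

text \<open>
  A quadruple is determined by the difference \<open>u = j1 - j3 = j4 - j2\<close> and the positions \<open>j3\<close> and \<open>j2\<close>,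
  which vary independently for given \<open>u\<close>.
\<close>
lemma sum_additive_quads_difference:
  fixes \<phi> :: "int \<Rightarrow> real"
  shows "(\<Sum>(j1, j2, j3, j4)\<in>additive_quads r t. f j1 * f j2 * f j3 * f j4 * \<phi> (j1 - j3)) =
    (\<Sum>u\<in>{- int t<..<int t}. \<phi> u * (shift_corr f r t u)\<^sup>2)"
proof -
  let ?S = "\<lambda>u. {j \<in> {r..<r + int t}. j + u \<in> {r..<r + int t}}"
  have fin: "finite (?S u)" for u by (rule finite_subset[of _ "{r..<r + int t}"]) auto
  have "(\<Sum>(j1, j2, j3, j4)\<in>additive_quads r t. f j1 * f j2 * f j3 * f j4 * \<phi> (j1 - j3)) =
    (\<Sum>(u, j, k)\<in>(SIGMA u:{- int t<..<int t}. ?S u \<times> ?S u). \<phi> u * ((f j * f (j + u)) * (f k * f (k + u))))"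
    by (rule sum.reindex_bij_witness[where i = "\<lambda>(u, j, k). (j + u, k, j, k + u)"
          and j = "\<lambda>(j1, j2, j3, j4). (j1 - j3, j3, j2)"])
       (auto simp: additive_quads_solved add_diff_eq add.commute)
  also have "\<dots> = (\<Sum>u\<in>{- int t<..<int t}. \<Sum>(j, k)\<in>?S u \<times> ?S u. \<phi> u * ((f j * f (j + u)) * (f k * f (k + u))))"
    by (rule sum.Sigma[symmetric]) (simp, intro ballI finite_cartesian_product fin)
  also have "\<dots> = (\<Sum>u\<in>{- int t<..<int t}. \<phi> u * (shift_corr f r t u)\<^sup>2)"
    by (rule sum.cong[OF refl], simp only: shift_corr_def power2_eq_square sum_product
        sum.cartesian_product split_def, simp only: sum_distrib_left)
  finally show ?thesis .
qed

lemma energy_eq_sum_shift_corr: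
  "energy f r t = (\<Sum>u\<in>{- int t<..<int t}. (shift_corr f r t u)\<^sup>2)"
  using sum_additive_quads_difference[of f "\<lambda>_. 1" r t] by (simp add: energy_def)

lemma sum_additive_quads_difference':
  fixes \<phi> :: "int \<Rightarrow> real"
  shows "(\<Sum>(j1, j2, j3, j4)\<in>additive_quads r t. f j1 * f j2 * f j3 * f j4 * \<phi> (j2 - j3)) =
    (\<Sum>u\<in>{- int t<..<int t}. \<phi> u * (shift_corr f r t u)\<^sup>2)"
proof -
  have "(\<Sum>(j1, j2, j3, j4)\<in>additive_quads r t. f j1 * f j2 * f j3 * f j4 * \<phi> (j2 - j3)) =
    (\<Sum>(j1, j2, j3, j4)\<in>additive_quads r t. f j1 * f j2 * f j3 * f j4 * \<phi> (j1 - j3))"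
    by (rule sum.reindex_bij_witness[where i = "\<lambda>(j1, j2, j3, j4). (j2, j1, j3, j4)"
          and j = "\<lambda>(j1, j2, j3, j4). (j2, j1, j3, j4)"])
       (auto simp: additive_quads_def)
  then show ?thesis by (simp only: sum_additive_quads_difference)
qed

text \<open>
  Likewise a quadruple is determined by the sum \<open>s = j1 + j2 = j3 + j4\<close> and the positions \<open>j1\<close> and \<open>j3\<close>.
\<close>
lemma sum_additive_quads_sum:
  fixes \<phi> :: "int \<Rightarrow> real"
  shows "(\<Sum>(j1, j2, j3, j4)\<in>additive_quads r t. f j1 * f j2 * f j3 * f j4 * \<phi> (j1 + j2)) =
    (\<Sum>s\<in>{2 * r..2 * r + 2 * int t}. \<phi> s * (reflect_corr f r t s)\<^sup>2)"
proof -
  let ?S = "\<lambda>s. {j \<in> {r..<r + int t}. s - j \<in> {r..<r + int t}}"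
  have fin: "finite (?S u)" for u by (rule finite_subset[of _ "{r..<r + int t}"]) auto
  have "(\<Sum>(j1, j2, j3, j4)\<in>additive_quads r t. f j1 * f j2 * f j3 * f j4 * \<phi> (j1 + j2)) =
    (\<Sum>(s, j, k)\<in>(SIGMA s:{2 * r..2 * r + 2 * int t}. ?S s \<times> ?S s). \<phi> s * ((f j * f (s - j)) * (f k * f (s - k))))"
    by (rule sum.reindex_bij_witness[where i = "\<lambda>(s, j, k). (j, s - j, k, s - k)"
          and j = "\<lambda>(j1, j2, j3, j4). (j1 + j2, j1, j3)"])
       (auto simp: additive_quads_solved add_diff_eq add.commute)
  also have "\<dots> = (\<Sum>s\<in>{2 * r..2 * r + 2 * int t}. \<Sum>(j, k)\<in>?S s \<times> ?S s. \<phi> s * ((f j * f (s - j)) * (f k * f (s - k))))"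
    by (rule sum.Sigma[symmetric]) (simp, intro ballI finite_cartesian_product fin)
  also have "\<dots> = (\<Sum>s\<in>{2 * r..2 * r + 2 * int t}. \<phi> s * (reflect_corr f r t s)\<^sup>2)"
    by (rule sum.cong[OF refl], simp only: reflect_corr_def power2_eq_square sum_product
        sum.cartesian_product split_def, simp only: sum_distrib_left)
  finally show ?thesis .
qed

lemma (in odd_prime_modulus) main_term_eq:
  "main_term \<epsilon> r t = 2 * (\<Sum>u\<in>{- int t<..<int t}. of_bool (int p dvd u) * (shift_corr \<epsilon> r t u)\<^sup>2)
    + (\<Sum>s\<in>{2 * r..2 * r + 2 * int t}. of_bool (int p dvd s) * (reflect_corr \<epsilon> r t s)\<^sup>2)
    - 2 / real p * (\<Sum>u\<in>{- int t<..<int t}. (shift_corr \<epsilon> r t u)\<^sup>2)"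
proof -
  have "main_term \<epsilon> r t =
    (\<Sum>(j1, j2, j3, j4)\<in>additive_quads r t. \<epsilon> j1 * \<epsilon> j2 * \<epsilon> j3 * \<epsilon> j4 * of_bool (int p dvd j1 - j3))
    + (\<Sum>(j1, j2, j3, j4)\<in>additive_quads r t. \<epsilon> j1 * \<epsilon> j2 * \<epsilon> j3 * \<epsilon> j4 * of_bool (int p dvd j2 - j3))
    + (\<Sum>(j1, j2, j3, j4)\<in>additive_quads r t. \<epsilon> j1 * \<epsilon> j2 * \<epsilon> j3 * \<epsilon> j4 * of_bool (int p dvd j1 + j2))
    - 2 / real p * energy \<epsilon> r t"
    unfolding main_term_def energy_def sum_distrib_left sum.distrib [symmetric] sum_subtractf [symmetric] split_def
    by (intro sum.cong refl) (simp add: algebra_simps)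
  then show ?thesis
    by (simp only: sum_additive_quads_difference[where \<phi> = "\<lambda>u. of_bool (int p dvd u)"]
        sum_additive_quads_difference'[where \<phi> = "\<lambda>u. of_bool (int p dvd u)"]
        sum_additive_quads_sum[where \<phi> = "\<lambda>u. of_bool (int p dvd u)"] energy_eq_sum_shift_corr mult_2)
qed

lemma sum_period_4:
  fixes g :: "int \<Rightarrow> real"
  assumes per: "\<And>j. g (j + 4) = g j"
  shows "(\<Sum>j\<in>{a..<a + 4}. g j) = (\<Sum>j\<in>{0..<4}. g j)"
proof -
  have block: "(\<Sum>j\<in>{a..<a + 4}. g j) = g a + g (a + 1) + g (a + 2) + g (a + 3)" for a
  proof -
    have "{a..<a + 4} = {a, a + 1, a + 2, a + 3}" by auto
    then show ?thesis by simp
  qed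
  have step: "(\<Sum>j\<in>{a + 1..<a + 1 + 4}. g j) = (\<Sum>j\<in>{a..<a + 4}. g j)" for a
    unfolding block using per[of a] by (simp add: algebra_simps)
  show ?thesis
  proof (induction a rule: int_induct[where k = 0])
    case (step1 i)
    then show ?case using step[of i] by simp
  next
    case (step2 i)
    then show ?case using step[of "i - 1"] by simp
  qed simp
qed

lemma sum_interval_period_4:
  fixes g :: "int \<Rightarrow> real"
  assumes per: "\<And>j. g (j + 4) = g j" and le: "\<And>j. \<bar>g j\<bar> \<le> 1"
  shows "\<bar>(\<Sum>j\<in>{a..<a + int l}. g j) - real l * ((\<Sum>j\<in>{0..<4}. g j) / 4)\<bar> \<le> 6"
proof (induction l arbitrary: a rule: less_induct)
  case (less l)
  let ?S = "\<Sum>j\<in>{0..<4}. g j"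
  have triv: "\<bar>\<Sum>j\<in>{a..<a + int l}. g j\<bar> \<le> real l" for a l
    using sum_norm_le[of "{a..<a + int l}" g "\<lambda>_. 1"] le by simp
  show ?case
  proof (cases "l < 4")
    case True
    have "\<bar>?S\<bar> \<le> 4" using triv[of 0 4] by simp
    then have "\<bar>real l * (?S / 4)\<bar> \<le> 3 * 1"
      unfolding abs_mult using True by (intro mult_mono) auto
    moreover have "\<bar>\<Sum>j\<in>{a..<a + int l}. g j\<bar> \<le> 3" using triv[of a l] True by linarith
    ultimately show ?thesis by linarith
  next
    case False
    then obtain k where k: "l = k + 4" by (metis add.commute le_Suc_ex not_less)
    have "{a..<a + int l} = {a..<a + 4} \<union> {a + 4..<a + 4 + int k}" using k by auto
    then have "(\<Sum>j\<in>{a..<a + int l}. g j) = (\<Sum>j\<in>{a..<a + 4}. g j) + (\<Sum>j\<in>{a + 4..<a + 4 + int k}. g j)"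
      by (simp add: sum.union_disjoint)
    also have "(\<Sum>j\<in>{a..<a + 4}. g j) = ?S" by (rule sum_period_4[where g = g, OF per])
    finally have "(\<Sum>j\<in>{a..<a + int l}. g j) - real l * (?S / 4)
      = (\<Sum>j\<in>{a + 4..<a + 4 + int k}. g j) - real k * (?S / 4)"
      using k by (simp add: field_simps)
    then show ?thesis using less[of k "a + 4"] k by simp
  qed
qed

text \<open>
  The sum over \<open>l\<close> consecutive integers is \<open>l / 4\<close> times the sum over a period up to a bounded error, so the
  squares differ by \<open>O(l)\<close>.
\<close>
lemma square_sum_interval_period_4:
  fixes g :: "int \<Rightarrow> real"
  assumes per: "\<And>j. g (j + 4) = g j" and le: "\<And>j. \<bar>g j\<bar> \<le> 1"
    and S: "(\<Sum>j\<in>{0..<4}. g j)\<^sup>2 = 16 * of_bool P"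
  shows "\<bar>(\<Sum>j\<in>{a..<a + int l}. g j)\<^sup>2 - of_bool P * (real l)\<^sup>2\<bar> \<le> 12 * real l"
proof -
  define x where "x = (\<Sum>j\<in>{a..<a + int l}. g j)"
  define y where "y = real l * ((\<Sum>j\<in>{0..<4}. g j) / 4)"
  have xy: "\<bar>x - y\<bar> \<le> 6" unfolding x_def y_def by (rule sum_interval_period_4[where g = g, OF per le])
  have "\<bar>x\<bar> \<le> real l"
    unfolding x_def using sum_norm_le[of "{a..<a + int l}" g "\<lambda>_. 1"] le by simp
  moreover have y2: "y\<^sup>2 = of_bool P * (real l)\<^sup>2"
    unfolding y_def power_mult_distrib power_divide S by simp
  then have "y\<^sup>2 \<le> (real l)\<^sup>2" by (cases P) simp_all
  then have "\<bar>y\<bar> \<le> real l" using abs_le_square_iff[of y "real l"] by simp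
  ultimately have "\<bar>x + y\<bar> \<le> 2 * real l" by linarith
  then have "\<bar>x - y\<bar> * \<bar>x + y\<bar> \<le> 6 * (2 * real l)" using xy by (intro mult_mono) auto
  moreover have "\<bar>x - y\<bar> * \<bar>x + y\<bar> = \<bar>x\<^sup>2 - y\<^sup>2\<bar>"
    unfolding abs_mult [symmetric] by (simp add: power2_eq_square algebra_simps)
  ultimately show ?thesis using y2 by (simp add: x_def)
qed

text \<open>
  Signs of period 4 such that the periodic autocorrelation vanishes except at the multiples of \<open>d\<close>,
  where it is 4 or -4, and such that the correlation with the reversed sequence vanishes except at
  the points congruent to \<open>- \<sigma>\<close> modulo \<open>d\<close>. After multiplication by such signs, a sequence of odd period \<open>p\<close>
  behaves like one of period \<open>d * p\<close>, and \<open>\<sigma>\<close> becomes a shift of the rotation parameter.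
\<close>
definition sign_pattern :: "(int \<Rightarrow> real) \<Rightarrow> int \<Rightarrow> int \<Rightarrow> bool" where
  "sign_pattern \<epsilon> d \<sigma> \<longleftrightarrow> (\<forall>j. \<bar>\<epsilon> j\<bar> = 1) \<and> (\<forall>j. \<epsilon> (j + 4) = \<epsilon> j) \<and>
    (\<forall>u. (\<Sum>j\<in>{0..<4}. \<epsilon> j * \<epsilon> (j + u))\<^sup>2 = 16 * of_bool (d dvd u)) \<and>
    (\<forall>s. (\<Sum>j\<in>{0..<4}. \<epsilon> j * \<epsilon> (s - j))\<^sup>2 = 16 * of_bool (d dvd s + \<sigma>))"

text \<open>
  The positions \<open>j\<close> with \<open>j\<close> and \<open>j + u\<close> in the interval form an interval of length \<open>t - \<bar>u\<bar>\<close>.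
\<close>
lemma shift_corr_sign_pattern:
  assumes "sign_pattern \<epsilon> d \<sigma>"
  shows "\<bar>(shift_corr \<epsilon> r t u)\<^sup>2 - of_bool (d dvd u) * (max 0 (real t - of_int \<bar>u\<bar>))\<^sup>2\<bar> \<le> 12 * real t"
proof -
  let ?l = "nat (int t - \<bar>u\<bar>)"
  let ?a = "max r (r - u)"
  have "{j \<in> {r..<r + int t}. j + u \<in> {r..<r + int t}} = {?a..<?a + int ?l}" by auto
  then have corr: "shift_corr \<epsilon> r t u = (\<Sum>j\<in>{?a..<?a + int ?l}. \<epsilon> j * \<epsilon> (j + u))"
    by (simp only: shift_corr_def)
  have per: "\<epsilon> (j + 4) * \<epsilon> (j + 4 + u) = \<epsilon> j * \<epsilon> (j + u)" for j
    using assms unfolding sign_pattern_def by (metis add.assoc add.commute)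
  have l: "real ?l = max 0 (real t - of_int \<bar>u\<bar>)" by auto
  have "\<bar>(shift_corr \<epsilon> r t u)\<^sup>2 - of_bool (d dvd u) * (real ?l)\<^sup>2\<bar> \<le> 12 * real ?l"
    unfolding corr using assms
    by (intro square_sum_interval_period_4 per) (simp_all add: sign_pattern_def abs_mult)
  also have "12 * real ?l \<le> 12 * real t" by simp
  finally show ?thesis by (simp only: l)
qed

text \<open>
  The positions \<open>j\<close> with \<open>j\<close> and \<open>s - j\<close> in the interval form an interval, whose length decreases
  linearly with the distance of \<open>s\<close> from \<open>2 * r + t - 1\<close>, the sum of the two ends.
\<close>
lemma reflect_corr_sign_pattern:
  assumes "sign_pattern \<epsilon> d \<sigma>"
  shows "\<bar>(reflect_corr \<epsilon> r t s)\<^sup>2 -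
    of_bool (d dvd s + \<sigma>) * (max 0 (real t - of_int \<bar>s - 2 * r - int t + 1\<bar>))\<^sup>2\<bar> \<le> 12 * real t"
proof -
  let ?l = "nat (int t - \<bar>s - 2 * r - int t + 1\<bar>)"
  let ?a = "max r (s - r - int t + 1)"
  have "{j \<in> {r..<r + int t}. s - j \<in> {r..<r + int t}} = {?a..<?a + int ?l}" by auto
  then have corr: "reflect_corr \<epsilon> r t s = (\<Sum>j\<in>{?a..<?a + int ?l}. \<epsilon> j * \<epsilon> (s - j))"
    by (simp only: reflect_corr_def)
  have per: "\<epsilon> (j + 4) * \<epsilon> (s - (j + 4)) = \<epsilon> j * \<epsilon> (s - j)" for j
    using assms unfolding sign_pattern_def by (metis diff_add_cancel diff_diff_eq)
  have l: "real ?l = max 0 (real t - of_int \<bar>s - 2 * r - int t + 1\<bar>)" by auto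
  have "\<bar>(reflect_corr \<epsilon> r t s)\<^sup>2 - of_bool (d dvd s + \<sigma>) * (real ?l)\<^sup>2\<bar> \<le> 12 * real ?l"
    unfolding corr using assms
    by (intro square_sum_interval_period_4 per) (simp_all add: sign_pattern_def abs_mult)
  also have "12 * real ?l \<le> 12 * real t" by simp
  finally show ?thesis by (simp only: l)
qed

section \<open>Limit profiles\<close>

definition tent :: "real \<Rightarrow> real" where
  "tent x = max 0 (1 - \<bar>x\<bar>)"

text \<open>
  The two profiles are the limit shapes of the sums over \<open>u\<close> and \<open>s\<close> in the main term. Only
  finitely many terms of the series in the definition of \<open>g_fun\<close> are nonzero; they are cut
  off at a bound \<open>K\<close> that can be kept fixed while \<open>p\<close> varies. This makes continuity in the
  other arguments immediate.
\<close>
definition shift_profile :: "nat \<Rightarrow> real \<Rightarrow> real" where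
  "shift_profile K T = 1 + 2 * (\<Sum>m = 1..K. (tent (real m / T))\<^sup>2)"

definition reflect_profile :: "nat \<Rightarrow> real \<Rightarrow> real \<Rightarrow> real" where
  "reflect_profile K \<rho> T = (\<Sum>m\<in>{- int K..int K}. (tent (1 + (2 * \<rho> - of_int m) / T))\<^sup>2)"

lemma max_diff_eq_tent:
  assumes "t > 0"
  shows "max 0 (t - \<bar>x\<bar>) = t * tent (x / t)"
  using assms by (auto simp: tent_def max_def field_simps)

lemma sum_multiples_shift:
  assumes t: "t > 0" and q: "q > 0" and K: "t \<le> K * q"
  shows "(\<Sum>u\<in>{- int t<..<int t}. of_bool (int q dvd u) * (max 0 (real t - of_int \<bar>u\<bar>))\<^sup>2) =
    (real t)\<^sup>2 * shift_profile K (real t / real q)"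
proof -
  have "(\<Sum>u = 1..t - 1. of_bool (q dvd u) * (max 0 (real t - real u))\<^sup>2) =
    (\<Sum>u\<in>{u \<in> {1..t - 1}. q dvd u}. (max 0 (real t - real u))\<^sup>2)"
    by (rule sum.mono_neutral_cong_right) auto
  also have "\<dots> = (\<Sum>m\<in>{m \<in> {1..K}. m * q < t}. (max 0 (real t - real (m * q)))\<^sup>2)"
  proof (rule sum.reindex_bij_witness[where i = "\<lambda>m. m * q" and j = "\<lambda>u. u div q"])
    fix u assume u: "u \<in> {u \<in> {1..t - 1}. q dvd u}"
    then obtain m where m: "u = m * q" by (metis (no_types, lifting) dvdE mem_Collect_eq mult.commute)
    have "u < K * q" using u K t by auto
    then show "u div q \<in> {m \<in> {1..K}. m * q < t}" using u m q t by auto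
  qed (use q t in auto)
  also have "\<dots> = (\<Sum>m = 1..K. (max 0 (real t - real (m * q)))\<^sup>2)"
    by (rule sum.mono_neutral_left) (auto simp flip: of_nat_mult)
  also have "\<dots> = (\<Sum>m = 1..K. (real t)\<^sup>2 * (tent (real m / (real t / real q)))\<^sup>2)"
    using max_diff_eq_tent[of "real t" "real (m * q)" for m] t
    by (intro sum.cong refl) (simp add: power_mult_distrib)
  finally have "(\<Sum>u = 1..t - 1. of_bool (q dvd u) * (max 0 (real t - real u))\<^sup>2) =
    (real t)\<^sup>2 * (\<Sum>m = 1..K. (tent (real m / (real t / real q)))\<^sup>2)"
    by (simp add: sum_distrib_left)
  then show ?thesis
    using t by (subst sum_symmetric_int) (simp_all add: shift_profile_def distrib_left)
qed

text \<open>
  With \<open>s = m * (d * p) - \<sigma> * p\<close> the summation over \<open>s\<close> becomes one over \<open>m\<close>. The offset \<open>\<sigma>\<close> moves \<open>r / q\<close>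
  by \<open>\<sigma> / (2 * d)\<close>, and the \<open>1 / (2 * q)\<close> is there because the reflected interval is centred at
  \<open>2 * r + t - 1\<close> instead of \<open>2 * r + t\<close>.
\<close>
lemma sum_multiples_reflect:
  fixes p t K :: nat and d \<sigma> r :: int
  assumes t: "t > 0" and p: "p > 0" and d: "d > 0"
    and \<sigma>: "\<And>n. d dvd n * int p + \<sigma> \<longleftrightarrow> d dvd n + \<sigma>"
    and K: "2 * \<bar>r\<bar> + 2 * int t + \<bar>\<sigma>\<bar> * int p \<le> int K * (d * int p)"
  defines "q \<equiv> of_int d * real p"
  shows "(\<Sum>s\<in>{2 * r..2 * r + 2 * int t}. of_bool (int p dvd s \<and> d dvd s + \<sigma>) *
      (max 0 (real t - of_int \<bar>s - 2 * r - int t + 1\<bar>))\<^sup>2) =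
    (real t)\<^sup>2 * reflect_profile K (of_int r / q + of_int \<sigma> / (2 * of_int d) - 1 / (2 * q)) (real t / q)"
proof -
  let ?f = "\<lambda>s. (max 0 (real t - of_int \<bar>s - 2 * r - int t + 1\<bar>))\<^sup>2"
  let ?s = "\<lambda>m. m * (d * int p) - \<sigma> * int p"
  let ?I = "{2 * r..2 * r + 2 * int t}"
  have dp: "d * int p > 0" using d p by simp
  have q: "q > 0" using d p by (simp add: q_def)
  have "(\<Sum>s\<in>?I. of_bool (int p dvd s \<and> d dvd s + \<sigma>) * ?f s) = (\<Sum>s\<in>{s \<in> ?I. int p dvd s \<and> d dvd s + \<sigma>}. ?f s)"
    by (rule sum.mono_neutral_cong_right) auto
  also have "\<dots> = (\<Sum>m\<in>{m \<in> {- int K..int K}. ?s m \<in> ?I}. ?f (?s m))"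
  proof (rule sum.reindex_bij_witness[where i = ?s and j = "\<lambda>s. (s + \<sigma> * int p) div (d * int p)"])
    fix s assume s: "s \<in> {s \<in> ?I. int p dvd s \<and> d dvd s + \<sigma>}"
    then obtain n where n: "s = n * int p" by (metis (no_types, lifting) dvdE mem_Collect_eq mult.commute)
    then have "d dvd n + \<sigma>" using s \<sigma>[of n] by simp
    then obtain m where m: "n + \<sigma> = d * m" by (elim dvdE)
    have "s + \<sigma> * int p = (n + \<sigma>) * int p" using n by (simp add: algebra_simps)
    also have "\<dots> = m * (d * int p)" unfolding m by (simp only: mult_ac)
    finally have sm: "s + \<sigma> * int p = m * (d * int p)" .
    then show "?s ((s + \<sigma> * int p) div (d * int p)) = s"
      using dp by (simp add: algebra_simps)
    have div: "(s + \<sigma> * int p) div (d * int p) = m"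
      unfolding sm by (rule nonzero_mult_div_cancel_right) (metis dp less_irrefl)
    have "\<bar>\<sigma> * int p\<bar> = \<bar>\<sigma>\<bar> * int p" by (simp add: abs_mult)
    then have "\<bar>s + \<sigma> * int p\<bar> \<le> 2 * \<bar>r\<bar> + 2 * int t + \<bar>\<sigma>\<bar> * int p"
      using s by auto
    then have "\<bar>m\<bar> * (d * int p) \<le> 2 * \<bar>r\<bar> + 2 * int t + \<bar>\<sigma>\<bar> * int p"
      using sm d by (simp add: abs_mult)
    also note K
    finally have "\<bar>m\<bar> * (d * int p) \<le> int K * (d * int p)" .
    then have "\<bar>m\<bar> \<le> int K" using dp by (simp add: mult_le_cancel_right)
    then show "(s + \<sigma> * int p) div (d * int p) \<in> {m \<in> {- int K..int K}. ?s m \<in> ?I}"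
      using s sm by (auto simp: div algebra_simps)
    show "?f (?s ((s + \<sigma> * int p) div (d * int p))) = ?f s"
      using \<open>?s ((s + \<sigma> * int p) div (d * int p)) = s\<close> by simp
  next
    fix m assume m: "m \<in> {m \<in> {- int K..int K}. ?s m \<in> ?I}"
    show "(?s m + \<sigma> * int p) div (d * int p) = m" using d p by simp
    have "?s m = (m * d - \<sigma>) * int p" by (simp add: algebra_simps)
    moreover from this have "d dvd ?s m + \<sigma>" using \<sigma>[of "m * d - \<sigma>"] by simp
    ultimately show "?s m \<in> {s \<in> ?I. int p dvd s \<and> d dvd s + \<sigma>}" using m by auto
  qed
  also have "\<dots> = (\<Sum>m\<in>{- int K..int K}. ?f (?s m))"
  proof (rule sum.mono_neutral_left)
    show "\<forall>m\<in>{- int K..int K} - {m \<in> {- int K..int K}. ?s m \<in> ?I}. ?f (?s m) = 0"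
    proof
      fix m assume m: "m \<in> {- int K..int K} - {m \<in> {- int K..int K}. ?s m \<in> ?I}"
      define s where "s = ?s m"
      have "s \<notin> ?I" using m by (simp add: s_def)
      then have "int t \<le> \<bar>s - 2 * r - int t + 1\<bar>" by auto
      then have "real t \<le> of_int \<bar>s - 2 * r - int t + 1\<bar>" by linarith
      then show "?f (?s m) = 0" unfolding s_def [symmetric] by simp
    qed
  qed auto
  also have "\<dots> = (\<Sum>m\<in>{- int K..int K}. (real t)\<^sup>2 *
    (tent (1 + (2 * (of_int r / q + of_int \<sigma> / (2 * of_int d) - 1 / (2 * q)) - of_int m) / (real t / q)))\<^sup>2)"
  proof (intro sum.cong refl)
    fix m
    let ?x = "of_int (?s m - 2 * r - int t + 1) :: real"
    let ?y = "1 + (2 * (of_int r / q + of_int \<sigma> / (2 * of_int d) - 1 / (2 * q)) - of_int m) / (real t / q)"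
    have "of_int \<sigma> / of_int d = of_int \<sigma> * real p / q" using d p by (simp add: q_def)
    then have "2 * (of_int r / q + of_int \<sigma> / (2 * of_int d) - 1 / (2 * q)) - of_int m
      = (2 * of_int r + of_int \<sigma> * real p - 1 - of_int m * q) / q"
      using q by (simp add: diff_divide_distrib add_divide_distrib)
    then have "?y = 1 + (2 * of_int r + of_int \<sigma> * real p - 1 - of_int m * q) / q / (real t / q)"
      by (simp only:)
    also have "\<dots> = (real t + (2 * of_int r + of_int \<sigma> * real p - 1 - of_int m * q)) / real t"
      using q t by (simp add: add_divide_distrib)
    also have "real t + (2 * of_int r + of_int \<sigma> * real p - 1 - of_int m * q) = - ?x"
      by (simp add: q_def)
    finally have "?y = - ?x / real t" .
    then have "tent ?y = tent (- (?x / real t))" by (simp only: minus_divide_left)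
    also have "\<dots> = tent (?x / real t)" by (simp only: tent_def abs_minus_cancel)
    finally show "?f (?s m) = (real t)\<^sup>2 * (tent ?y)\<^sup>2"
      using max_diff_eq_tent[of "real t" ?x] t by (simp add: power_mult_distrib)
  qed
  finally show ?thesis by (simp only: reflect_profile_def sum_distrib_left)
qed

lemma count_multiples:
  assumes "p > 0"
  shows "(\<Sum>u\<in>{a..a + int n}. of_bool (int p dvd u)) \<le> real n / real p + 2"
proof -
  let ?S = "{u \<in> {a..a + int n}. int p dvd u}"
  have "(\<Sum>u\<in>{a..a + int n}. of_bool (int p dvd u)) = real (card ?S)"
    by (simp add: sum_of_bool_eq Int_def)
  also have "card ?S \<le> card {a div int p..(a + int n) div int p}"
  proof (rule card_inj_on_le)
    show "inj_on (\<lambda>u. u div int p) ?S" using assms by (intro inj_onI) (auto elim!: dvdE)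
    show "(\<lambda>u. u div int p) ` ?S \<subseteq> {a div int p..(a + int n) div int p}"
      using assms by (auto intro!: zdiv_mono1)
  qed simp
  also have "real (card {a div int p..(a + int n) div int p}) \<le> real n / real p + 2"
  proof -
    have "real_of_int ((a + int n) div int p) \<le> of_int (a + int n) / real p"
      using real_of_int_div4[of "a + int n" "int p"] by simp
    moreover have "of_int a / real p - 1 \<le> real_of_int (a div int p)"
      using real_of_int_div3[of a "int p"] by simp
    ultimately have "real_of_int ((a + int n) div int p - a div int p + 1) \<le> real n / real p + 2"
      by (simp add: add_divide_distrib)
    moreover have "a div int p \<le> (a + int n) div int p"
      using assms by (intro zdiv_mono1) auto
    then have "real (card {a div int p..(a + int n) div int p}) =
        real_of_int ((a + int n) div int p - a div int p + 1)"
      by simp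
    ultimately show ?thesis by linarith
  qed
  finally show ?thesis by simp
qed

lemma sum_squares_shifted: "(\<Sum>m = 1..N. (T - real m)\<^sup>2) =
   real N * T\<^sup>2 - T * real N * (real N + 1) + real N * (real N + 1) * (2 * real N + 1) / 6"
  by (induction N) (simp_all add: algebra_simps power2_eq_square add_divide_distrib)

lemma shift_profile_closed_form:
  assumes T: "T > 0" and N: "real N \<le> T" "T \<le> real N + 1" and K: "N \<le> K"
  shows "shift_profile K T = 2 * T / 3 + (real N / 3 + (T - real N)\<^sup>2 - 2 * (T - real N) ^ 3 / 3) / T\<^sup>2"
proof -
  have "(\<Sum>m = 1..K. (tent (real m / T))\<^sup>2) = (\<Sum>m = 1..N. (tent (real m / T))\<^sup>2)"
  proof (rule sum.mono_neutral_right)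
    show "\<forall>m\<in>{1..K} - {1..N}. (tent (real m / T))\<^sup>2 = 0"
    proof
      fix m assume "m \<in> {1..K} - {1..N}"
      then have "real m \<ge> T" using N by auto
      then show "(tent (real m / T))\<^sup>2 = 0" using T by (simp add: tent_def)
    qed
  qed (use K in auto)
  also have "\<dots> = (\<Sum>m = 1..N. (T - real m)\<^sup>2 / T\<^sup>2)"
  proof (intro sum.cong refl)
    fix m assume "m \<in> {1..N}"
    then have "real m \<le> T" using N by auto
    then have "tent (real m / T) = (T - real m) / T" using T by (simp add: tent_def diff_divide_distrib)
    then show "(tent (real m / T))\<^sup>2 = (T - real m)\<^sup>2 / T\<^sup>2" by (simp add: power_divide)
  qed
  also have "\<dots> = (real N * T\<^sup>2 - T * real N * (real N + 1) + real N * (real N + 1) * (2 * real N + 1) / 6) / T\<^sup>2"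
    by (simp only: sum_divide_distrib [symmetric] sum_squares_shifted)
  finally have "shift_profile K T =
    1 + 2 * ((real N * T\<^sup>2 - T * real N * (real N + 1) + real N * (real N + 1) * (2 * real N + 1) / 6) / T\<^sup>2)"
    by (simp add: shift_profile_def)
  then show ?thesis using T by (simp add: field_simps power2_eq_square power3_eq_cube)
qed

text \<open>
  The profile is a Riemann sum with step 1 of the function \<open>(tent (x / T))\<^sup>2\<close>, whose integral over the
  real line is \<open>2 * T / 3\<close>; the closed form shows that the sum exceeds the integral, and by how little.
\<close>
lemma shift_profile_bounds:
  assumes T: "T > 0" and K: "T \<le> real K"
  shows "2 * T / 3 \<le> shift_profile K T" "shift_profile K T \<le> 2 * T / 3 + (T / 3 + 1) / T\<^sup>2"
proof -
  define N where "N = nat \<lfloor>T\<rfloor>"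
  define s where "s = T - real N"
  have N: "real N \<le> T" "T \<le> real N + 1" using T by (simp_all add: N_def)
  have "N \<le> K" using N K by linarith
  have s: "0 \<le> s" "s \<le> 1" using N by (simp_all add: s_def)
  then have s2: "s\<^sup>2 \<le> 1" by (simp add: power_le_one)
  have "s ^ 3 \<le> s\<^sup>2" using s by (intro power_decreasing) auto
  then have "0 \<le> real N / 3 + s\<^sup>2 - 2 * s ^ 3 / 3"
    using zero_le_power2[of s] of_nat_0_le_iff[of N, where 'a = real] by linarith
  moreover have "real N / 3 + s\<^sup>2 - 2 * s ^ 3 / 3 \<le> T / 3 + 1"
    using N s2 s zero_le_power[OF s(1), of 3] by linarith
  moreover note shift_profile_closed_form[OF T N \<open>N \<le> K\<close>]
  ultimately show "2 * T / 3 \<le> shift_profile K T" "shift_profile K T \<le> 2 * T / 3 + (T / 3 + 1) / T\<^sup>2"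
    by (simp_all add: s_def divide_right_mono)
qed

section \<open>Quantitative estimates for a fixed prime\<close>

context odd_prime_modulus
begin

text \<open>
  The three sums of squared correlations are replaced one by one. The first two extend only over
  multiples of \<open>p\<close>, of which there are \<open>O(t / p + 1)\<close>, and the third has weight \<open>2 / p\<close>; hence the
  errors \<open>O(t)\<close> of the individual squares add up to \<open>O(t * (t / p + 1))\<close>.
\<close>
lemma main_term_estimate:
  fixes d K t :: nat and \<sigma> r :: int
  assumes sp: "sign_pattern \<epsilon> (int d) \<sigma>" and d: "d > 0" "coprime d p"
    and \<sigma>: "int d dvd \<sigma> * (int p - 1)" and t: "t > 0"
    and K: "2 * \<bar>r\<bar> + 2 * int t + \<bar>\<sigma>\<bar> * int p \<le> int (K * (d * p))"
  defines "q \<equiv> real (d * p)"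
  shows "\<bar>main_term \<epsilon> r t - ((real t)\<^sup>2 * (2 * shift_profile K (real t / q)
      + reflect_profile K (of_int r / q + of_int \<sigma> / (2 * real d) - 1 / (2 * q)) (real t / q))
      - 2 / real p * ((real t)\<^sup>2 * shift_profile t (real t / real d)))\<bar> \<le> 12 * real t * (10 * real t / real p + 6)"
proof -
  let ?U = "{- int t<..<int t}" and ?S = "{2 * r..2 * r + 2 * int t}"
  let ?c = "\<lambda>u. (shift_corr \<epsilon> r t u)\<^sup>2" and ?b = "\<lambda>s. (reflect_corr \<epsilon> r t s)\<^sup>2"
  let ?L = "\<lambda>u. (max 0 (real t - of_int \<bar>u\<bar>))\<^sup>2"
  let ?M = "\<lambda>s. (max 0 (real t - of_int \<bar>s - 2 * r - int t + 1\<bar>))\<^sup>2"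
  have cop: "coprime (int d) (int p)" using d by simp
  have err: "\<bar>(\<Sum>u\<in>A. of_bool (Q u) * f u) - (\<Sum>u\<in>A. of_bool (Q u) * g u)\<bar> \<le> 12 * real t * (\<Sum>u\<in>A. of_bool (Q u))"
    if "\<And>u. \<bar>f u - g u\<bar> \<le> 12 * real t" for A :: "int set" and Q f g
  proof -
    have "\<bar>\<Sum>u\<in>A. of_bool (Q u) * (f u - g u)\<bar> \<le> (\<Sum>u\<in>A. \<bar>of_bool (Q u) * (f u - g u)\<bar>)"
      by (rule sum_abs)
    also have "\<dots> \<le> (\<Sum>u\<in>A. of_bool (Q u) * (12 * real t))"
      by (intro sum_mono) (auto simp: abs_mult that)
    also have "\<dots> = 12 * real t * (\<Sum>u\<in>A. of_bool (Q u))"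
      unfolding sum_distrib_right [symmetric] by (rule mult.commute)
    finally show ?thesis by (simp add: right_diff_distrib sum_subtractf)
  qed
  have U1: "(\<Sum>u\<in>?U. of_bool (int p dvd u)) \<le> 2 * real t / real p + 2"
  proof -
    have "(\<Sum>u\<in>?U. of_bool (int p dvd u)) \<le> (\<Sum>u\<in>{- int t..- int t + int (2 * t)}. of_bool (int p dvd u) :: real)"
      by (intro sum_mono2) auto
    also have "\<dots> \<le> 2 * real t / real p + 2"
      using count_multiples[OF p_pos, of "- int t" "2 * t"] by simp
    finally show ?thesis .
  qed
  have S1: "(\<Sum>s\<in>?S. of_bool (int p dvd s)) \<le> 2 * real t / real p + 2"
    using count_multiples[OF p_pos, of "2 * r" "2 * t"] by simp
  have U2: "(\<Sum>u\<in>?U. of_bool True) \<le> 2 * real t"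
    using t by simp
  have e1: "\<bar>(\<Sum>u\<in>?U. of_bool (int p dvd u) * ?c u) - (\<Sum>u\<in>?U. of_bool (int p dvd u) * (of_bool (int d dvd u) * ?L u))\<bar>
      \<le> 12 * real t * (2 * real t / real p + 2)"
    using err[of ?c "\<lambda>u. of_bool (int d dvd u) * ?L u" "\<lambda>u. int p dvd u" ?U, OF shift_corr_sign_pattern[OF sp, of r t]] mult_left_mono[OF U1, of "12 * real t"]
    by linarith
  have e2: "\<bar>(\<Sum>s\<in>?S. of_bool (int p dvd s) * ?b s) - (\<Sum>s\<in>?S. of_bool (int p dvd s) * (of_bool (int d dvd s + \<sigma>) * ?M s))\<bar>
      \<le> 12 * real t * (2 * real t / real p + 2)"
    using err[of ?b "\<lambda>s. of_bool (int d dvd s + \<sigma>) * ?M s" "\<lambda>u. int p dvd u" ?S, OF reflect_corr_sign_pattern[OF sp, of r t]] mult_left_mono[OF S1, of "12 * real t"]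
    by linarith
  have e3: "\<bar>(\<Sum>u\<in>?U. ?c u) - (\<Sum>u\<in>?U. of_bool (int d dvd u) * ?L u)\<bar> \<le> 12 * real t * (2 * real t)"
    using err[of ?c "\<lambda>u. of_bool (int d dvd u) * ?L u" "\<lambda>u. True" ?U, OF shift_corr_sign_pattern[OF sp, of r t]] mult_left_mono[OF U2, of "12 * real t"]
    by simp
  have "\<bar>2 / real p * (\<Sum>u\<in>?U. ?c u) - 2 / real p * (\<Sum>u\<in>?U. of_bool (int d dvd u) * ?L u)\<bar>
      = 2 / real p * \<bar>(\<Sum>u\<in>?U. ?c u) - (\<Sum>u\<in>?U. of_bool (int d dvd u) * ?L u)\<bar>"
    unfolding right_diff_distrib [symmetric] abs_mult by simp
  also have "\<dots> \<le> 2 / real p * (12 * real t * (2 * real t))"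
    by (intro mult_left_mono e3) simp
  finally have e3': "\<bar>2 / real p * (\<Sum>u\<in>?U. ?c u) - 2 / real p * (\<Sum>u\<in>?U. of_bool (int d dvd u) * ?L u)\<bar>
      \<le> 12 * real t * (4 * real t / real p)" by (simp add: mult_ac)
  have i1: "(\<Sum>u\<in>?U. of_bool (int p dvd u) * (of_bool (int d dvd u) * ?L u)) = (real t)\<^sup>2 * shift_profile K (real t / q)"
  proof -
    have "int (d * p) dvd u \<longleftrightarrow> int p dvd u \<and> int d dvd u" for u
      using cop divides_mult[of "int d" u "int p"] by (auto intro: dvd_mult_left dvd_mult_right)
    moreover have "t \<le> K * (d * p)"
    proof -
      have "0 \<le> \<bar>\<sigma>\<bar> * int p" by simp
      then have "int t \<le> int (K * (d * p))" using K by linarith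
      then show ?thesis by (simp only: of_nat_le_iff)
    qed
    ultimately show ?thesis
      using sum_multiples_shift[OF t, of "d * p" K] d p_pos by (simp add: q_def of_bool_conj mult.assoc)
  qed
  have i3: "(\<Sum>u\<in>?U. of_bool (int d dvd u) * ?L u) = (real t)\<^sup>2 * shift_profile t (real t / real d)"
    using sum_multiples_shift[OF t d(1), of t] d by simp
  have i2: "(\<Sum>s\<in>?S. of_bool (int p dvd s) * (of_bool (int d dvd s + \<sigma>) * ?M s)) =
     (real t)\<^sup>2 * reflect_profile K (of_int r / q + of_int \<sigma> / (2 * real d) - 1 / (2 * q)) (real t / q)"
  proof -
    have \<sigma>': "int d dvd n * int p + \<sigma> \<longleftrightarrow> int d dvd n + \<sigma>" for n
    proof -
      have "n * int p + \<sigma> = (n + \<sigma>) * int p - \<sigma> * (int p - 1)" by (simp add: algebra_simps)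
      then have "int d dvd n * int p + \<sigma> \<longleftrightarrow> int d dvd (n + \<sigma>) * int p"
        using \<sigma> by (simp only: dvd_diff_left_iff)
      then show ?thesis using cop coprime_dvd_mult_left_iff by blast
    qed
    show ?thesis
      using sum_multiples_reflect[where d = "int d" and \<sigma> = \<sigma>, OF t p_pos _ \<sigma>', of r K] K d
      by (simp add: q_def of_bool_conj mult.assoc)
  qed
  have combine: "\<bar>2 * A + B - C - (x * (2 * a + b) - c)\<bar> \<le> 3 * e + e'"
    if "\<bar>A - x * a\<bar> \<le> e" "\<bar>B - x * b\<bar> \<le> e" "\<bar>C - c\<bar> \<le> e'" for A B C a b c x e e' :: real
    using that unfolding distrib_left by (simp only: abs_le_iff mult.left_commute[of x 2]) linarith
  have "3 * (12 * real t * (2 * real t / real p + 2)) + 12 * real t * (4 * real t / real p)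
      = 12 * real t * (10 * real t / real p + 6)"
    by (simp add: algebra_simps)
  then show ?thesis
    using combine[OF e1[unfolded i1] e2[unfolded i2] e3'[unfolded i3]] unfolding main_term_eq by (simp only:)
qed

lemma energy_chi_error:
  assumes eps: "\<And>j. \<bar>\<epsilon> j\<bar> \<le> 1" and per: "\<And>j. \<epsilon> (j + 4) = \<epsilon> j"
    and n: "odd n" "2 * t \<le> n * p"
  shows "\<bar>energy (\<lambda>j. \<epsilon> j * chi j) r t - main_term \<epsilon> r t\<bar> \<le>
    5 * real p powr (3 / 4) * (real t + 16 * real (n * p) * harm (n * p)) ^ 4 / (real (n * p) * (real p)\<^sup>2)"
proof -
  let ?q = "n * p"
  have n0: "n > 0" using n by (auto intro: Nat.gr0I)
  have q0: "real ?q > 0" using n0 p_pos by simp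
  let ?Z = "\<Sum>(a, b, c)\<in>residue_triples. norm (kernel \<epsilon> r t a b c)"
  let ?B = "\<Sum>h\<in>{0..<int ?q}. norm (twisted_sum \<epsilon> r t ?q h)"
  have "real ?q * ?Z \<le> ?B ^ 4"
    by (rule sum_norm_kernel[OF refl n0 n(2)])
  also have "\<dots> \<le> (real t + 16 * real ?q * harm ?q) ^ 4"
    using n odd_p by (intro power_mono sum_norm_twisted_sum eps per sum_nonneg) auto
  finally have Z: "?Z \<le> (real t + 16 * real ?q * harm ?q) ^ 4 / real ?q"
    using q0 by (simp add: field_simps)
  have "real p ^ 2 * \<bar>energy (\<lambda>j. \<epsilon> j * chi j) r t - main_term \<epsilon> r t\<bar> \<le> 5 * real p powr (3 / 4) * ?Z"
    by (rule energy_error)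
  also have "\<dots> \<le> 5 * real p powr (3 / 4) * ((real t + 16 * real ?q * harm ?q) ^ 4 / real ?q)"
    by (intro mult_left_mono Z) simp
  finally have "\<bar>energy (\<lambda>j. \<epsilon> j * chi j) r t - main_term \<epsilon> r t\<bar> \<le>
      5 * real p powr (3 / 4) * ((real t + 16 * real ?q * harm ?q) ^ 4 / real ?q) / (real p)\<^sup>2"
    using p_pos by (subst pos_le_divide_eq) (simp_all only: mult.commute zero_less_power of_nat_0_less_iff)
  then show ?thesis by (simp only: times_divide_eq_right divide_divide_eq_left)
qed

text \<open>
  Legendre sequences have the entry 1, not 0, at the multiples of \<open>p\<close>.
\<close>
definition filled_chi :: "int \<Rightarrow> real" where
  "filled_chi j = (if int p dvd j then 1 else chi j)"

lemma abs_filled_chi: "\<bar>filled_chi j\<bar> = 1"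
  using chi_values[of j] chi_eq_0_iff[of j] by (auto simp: filled_chi_def)

text \<open>
  Only products that involve a multiple of \<open>p\<close> change, and these change by at most 1.
\<close>
lemma shift_corr_filled:
  assumes eps: "\<And>j. \<bar>\<epsilon> j\<bar> = 1"
  shows "\<bar>shift_corr (\<lambda>j. \<epsilon> j * filled_chi j) r t u - shift_corr (\<lambda>j. \<epsilon> j * chi j) r t u\<bar>
    \<le> 2 * (real t / real p + 2)"
proof -
  let ?J = "{r..<r + int t}"
  let ?A = "{j \<in> ?J. j + u \<in> ?J}"
  have fin: "finite ?A" by (rule finite_subset[of _ ?J]) auto
  have "\<bar>shift_corr (\<lambda>j. \<epsilon> j * filled_chi j) r t u - shift_corr (\<lambda>j. \<epsilon> j * chi j) r t u\<bar> \<le>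
    (\<Sum>j\<in>?A. \<bar>\<epsilon> j * filled_chi j * (\<epsilon> (j + u) * filled_chi (j + u)) - \<epsilon> j * chi j * (\<epsilon> (j + u) * chi (j + u))\<bar>)"
    unfolding shift_corr_def sum_subtractf [symmetric] by (rule sum_abs)
  also have "\<dots> \<le> (\<Sum>j\<in>?A. of_bool (int p dvd j) + of_bool (int p dvd j + u))"
  proof (intro sum_mono)
    fix j
    have "\<epsilon> j * filled_chi j * (\<epsilon> (j + u) * filled_chi (j + u)) - \<epsilon> j * chi j * (\<epsilon> (j + u) * chi (j + u))
      = \<epsilon> j * \<epsilon> (j + u) * (filled_chi j * filled_chi (j + u) - chi j * chi (j + u))"
      by (simp add: algebra_simps)
    then have "\<bar>\<epsilon> j * filled_chi j * (\<epsilon> (j + u) * filled_chi (j + u)) - \<epsilon> j * chi j * (\<epsilon> (j + u) * chi (j + u))\<bar>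
      = \<bar>filled_chi j * filled_chi (j + u) - chi j * chi (j + u)\<bar>"
      by (simp add: abs_mult eps)
    also have "\<dots> \<le> of_bool (int p dvd j) + of_bool (int p dvd j + u)"
    proof (cases "int p dvd j \<or> int p dvd j + u")
      case True
      then have zero: "chi j * chi (j + u) = 0" using chi_eq_0_iff by auto
      have "\<bar>filled_chi j * filled_chi (j + u) - chi j * chi (j + u)\<bar> = 1"
        unfolding zero by (simp add: abs_mult abs_filled_chi)
      then show ?thesis using True by auto
    qed (simp add: filled_chi_def)
    finally show "\<bar>\<epsilon> j * filled_chi j * (\<epsilon> (j + u) * filled_chi (j + u)) - \<epsilon> j * chi j * (\<epsilon> (j + u) * chi (j + u))\<bar>
      \<le> of_bool (int p dvd j) + of_bool (int p dvd j + u)" .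
  qed
  also have "\<dots> = (\<Sum>j\<in>?A. of_bool (int p dvd j)) + (\<Sum>j\<in>(\<lambda>j. j + u) ` ?A. of_bool (int p dvd j))"
    by (subst sum.reindex) (auto simp: sum.distrib inj_on_def)
  also have "\<dots> \<le> (\<Sum>j\<in>{r..r + int t}. of_bool (int p dvd j)) + (\<Sum>j\<in>{r..r + int t}. of_bool (int p dvd j))"
    by (intro add_mono sum_mono2) auto
  also have "\<dots> \<le> 2 * (real t / real p + 2)"
    using count_multiples[OF p_pos, of r t] by simp
  finally show ?thesis .
qed

text \<open>
  The autocorrelations change by a bounded amount if \<open>t / p\<close> is bounded. The mixed terms in the
  difference of the squares are split with a free weight \<open>\<eta>\<close>, which is finally chosen of order
  \<open>1 / sqrt t\<close>.
\<close>
lemma energy_filled: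
  assumes eps: "\<And>j. \<bar>\<epsilon> j\<bar> = 1" and \<eta>: "\<eta> > 0"
  shows "\<bar>energy (\<lambda>j. \<epsilon> j * filled_chi j) r t - energy (\<lambda>j. \<epsilon> j * chi j) r t\<bar> \<le>
    \<eta> * energy (\<lambda>j. \<epsilon> j * chi j) r t + (1 + 1 / \<eta>) * (2 * real t * (2 * (real t / real p + 2))\<^sup>2)"
proof -
  define x where "x = shift_corr (\<lambda>j. \<epsilon> j * filled_chi j) r t"
  define y where "y = shift_corr (\<lambda>j. \<epsilon> j * chi j) r t"
  define Z where "Z = 2 * (real t / real p + 2)"
  let ?U = "{- int t<..<int t}"
  have xy: "\<bar>x u - y u\<bar> \<le> Z" for u
    unfolding x_def y_def Z_def by (rule shift_corr_filled[OF eps])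
  have ptw: "\<bar>(x u)\<^sup>2 - (y u)\<^sup>2\<bar> \<le> \<eta> * (y u)\<^sup>2 + (1 + 1 / \<eta>) * Z\<^sup>2" for u
  proof -
    define e where "e = x u - y u"
    have e2: "e\<^sup>2 \<le> Z\<^sup>2" using xy[of u] by (simp add: e_def abs_le_square_iff flip: abs_le_square_iff)
    have "(x u)\<^sup>2 - (y u)\<^sup>2 = e\<^sup>2 + 2 * (y u * e)"
      by (simp add: e_def power2_eq_square algebra_simps)
    moreover have "\<bar>2 * (y u * e)\<bar> \<le> \<eta> * (y u)\<^sup>2 + e\<^sup>2 / \<eta>"
    proof -
      have "0 \<le> (\<eta> * \<bar>y u\<bar> - \<bar>e\<bar>)\<^sup>2" by simp
      then have "2 * \<eta> * (\<bar>y u\<bar> * \<bar>e\<bar>) \<le> \<eta>\<^sup>2 * (y u)\<^sup>2 + e\<^sup>2"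
        by (simp add: power2_diff power_mult_distrib algebra_simps)
      then have "\<eta> * (2 * (\<bar>y u\<bar> * \<bar>e\<bar>)) \<le> \<eta> * (\<eta> * (y u)\<^sup>2 + e\<^sup>2 / \<eta>)"
        using \<eta> by (simp add: distrib_left power2_eq_square mult_ac)
      then show ?thesis using \<eta> by (simp add: abs_mult)
    qed
    moreover have "e\<^sup>2 / \<eta> \<le> Z\<^sup>2 / \<eta>" using e2 \<eta> by (simp add: divide_right_mono)
    moreover have "(1 + 1 / \<eta>) * Z\<^sup>2 = Z\<^sup>2 + Z\<^sup>2 / \<eta>" by (simp add: distrib_right)
    ultimately show ?thesis using e2 zero_le_power2[of e] unfolding abs_le_iff by linarith
  qed
  have "\<bar>(\<Sum>u\<in>?U. (x u)\<^sup>2) - (\<Sum>u\<in>?U. (y u)\<^sup>2)\<bar> \<le> (\<Sum>u\<in>?U. \<bar>(x u)\<^sup>2 - (y u)\<^sup>2\<bar>)"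
    unfolding sum_subtractf [symmetric] by (rule sum_abs)
  also have "\<dots> \<le> (\<Sum>u\<in>?U. \<eta> * (y u)\<^sup>2 + (1 + 1 / \<eta>) * Z\<^sup>2)" by (intro sum_mono ptw)
  also have "\<dots> = \<eta> * (\<Sum>u\<in>?U. (y u)\<^sup>2) + real (card ?U) * ((1 + 1 / \<eta>) * Z\<^sup>2)"
    by (simp add: sum.distrib sum_distrib_left)
  also have "\<dots> \<le> \<eta> * (\<Sum>u\<in>?U. (y u)\<^sup>2) + 2 * real t * ((1 + 1 / \<eta>) * Z\<^sup>2)"
    using \<eta> by (intro add_left_mono mult_right_mono) auto
  finally show ?thesis
    unfolding energy_eq_sum_shift_corr x_def y_def Z_def by (simp add: mult_ac)
qed

end

section \<open>Positivity of the limiting inverse merit factor\<close>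

lemma tent_ge: "1 - \<bar>x\<bar> \<le> tent x" by (simp add: tent_def)

text \<open>
  Two consecutive points \<open>m\<close> lie on either side of the top of the tent, at distances \<open>x\<close> and
  \<open>1 / T - x\<close> from it; by convexity the sum of the two squares is smallest if these are equal.
\<close>
lemma reflect_profile_ge:
  assumes T: "T \<ge> 1 / 2" and K: "2 * \<bar>R\<bar> + T + 1 \<le> real K"
  shows "2 * (1 - 1 / (2 * T))\<^sup>2 \<le> reflect_profile K R T"
proof -
  define n where "n = \<lfloor>T + 2 * R\<rfloor>"
  define x where "x = (T + 2 * R - of_int n) / T"
  have x: "0 \<le> T + 2 * R - of_int n" "T + 2 * R - of_int n < 1"
    unfolding n_def by linarith+
  have T0: "T > 0" using T by linarith
  have x0: "0 \<le> x" "x \<le> 1 / T"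
    using x T0 by (simp_all add: x_def divide_right_mono)
  let ?f = "\<lambda>m. (tent (1 + (2 * R - of_int m) / T))\<^sup>2"
  have f1: "?f n = (tent x)\<^sup>2"
    using T0 by (simp add: x_def field_simps)
  have "1 + (2 * R - of_int (n + 1)) / T = x - 1 / T"
    using T0 by (simp add: x_def diff_divide_distrib add_divide_distrib)
  then have f2: "?f (n + 1) = (tent (x - 1 / T))\<^sup>2"
    by (simp only:)
  have "- real K \<le> of_int n" "of_int n + 1 \<le> real K"
    using x K T0 abs_ge_self[of R] abs_ge_minus_self[of R] by linarith+
  then have "{n, n + 1} \<subseteq> {- int K..int K}" by auto
  then have "(\<Sum>m\<in>{n, n + 1}. ?f m) \<le> reflect_profile K R T"
    unfolding reflect_profile_def by (intro sum_mono2) auto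
  then have ge: "(tent x)\<^sup>2 + (tent (x - 1 / T))\<^sup>2 \<le> reflect_profile K R T"
    using f1 f2 by simp
  define u v where "u = tent x" and "v = tent (x - 1 / T)"
  have "u \<ge> 1 - x" "v \<ge> 1 - (1 / T - x)"
    using tent_ge[of x] tent_ge[of "x - 1 / T"] x0 by (simp_all add: u_def v_def)
  then have uv: "u + v \<ge> 2 * (1 - 1 / (2 * T))" by simp
  have "1 - 1 / (2 * T) \<ge> 0" using T by (simp add: field_simps)
  then have "(2 * (1 - 1 / (2 * T)))\<^sup>2 \<le> (u + v)\<^sup>2" using uv by (intro power_mono) auto
  moreover have "(u + v)\<^sup>2 \<le> 2 * (u\<^sup>2 + v\<^sup>2)"
    using zero_le_power2[of "u - v"] by (simp add: power2_sum power2_diff)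
  ultimately have "2 * (1 - 1 / (2 * T))\<^sup>2 \<le> u\<^sup>2 + v\<^sup>2" unfolding power_mult_distrib by simp
  then show ?thesis using ge by (simp add: u_def v_def)
qed

lemma reflect_profile_nonneg: "reflect_profile K R T \<ge> 0"
  unfolding reflect_profile_def by (intro sum_nonneg) simp

lemma shift_profile_ge_1: "shift_profile K T \<ge> 1"
  unfolding shift_profile_def by (simp add: sum_nonneg)

lemma shift_profile_ge_first:
  assumes "T \<ge> 1" "T \<le> real K"
  shows "shift_profile K T \<ge> 1 + 2 * (1 - 1 / T)\<^sup>2"
proof -
  have "K \<ge> 1" using assms by linarith
  then have "(\<Sum>m\<in>{1}. (tent (real m / T))\<^sup>2) \<le> (\<Sum>m = 1..K. (tent (real m / T))\<^sup>2)"
    by (intro sum_mono2) auto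
  moreover have "tent (1 / T) = 1 - 1 / T" using assms by (simp add: tent_def)
  ultimately show ?thesis by (simp add: shift_profile_def)
qed

text \<open>
  Autocorrelations only show that the limit of the inverse merit factor is not negative, but the merit
  factor converges only if it is positive. For \<open>T \<le> 2\<close> the first terms of the profiles are
  sufficient; for \<open>T \<ge> 2\<close> twice the first profile compensates \<open>4 * T / 3\<close> and the second is already
  greater than 1.
\<close>
lemma inverse_merit_positive:
  assumes T: "T > 0" and K: "2 * \<bar>R\<bar> + T + 1 \<le> real K"
  shows "2 * shift_profile K T + reflect_profile K R T - 4 * T / 3 - 1 > 0"
proof -
  let ?b = "2 * (1 - 1 / (2 * T))\<^sup>2"
  have TK: "T \<le> real K" using K by linarith
  consider "T \<le> 1 / 2" | "1 / 2 \<le> T" "T \<le> 1" | "1 \<le> T" "T \<le> 2" | "2 \<le> T" by linarith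
  then show ?thesis
  proof cases
    case 1
    then show ?thesis using shift_profile_ge_1[of K T] reflect_profile_nonneg[of K R T] by linarith
  next
    case 2
    \<comment> \<open>The cubic below is this product plus 1/2.\<close>
    have "0 \<le> (T - 1 / 2)\<^sup>2 * (10 - 8 * T)" using 2 by (intro mult_nonneg_nonneg) auto
    then have "0 < 18 * T\<^sup>2 - 8 * T ^ 3 - 12 * T + 3"
      by (simp add: power2_eq_square power3_eq_cube algebra_simps)
    then have "1 + ?b - 4 * T / 3 > 0"
      using T by (simp add: field_simps power2_eq_square power3_eq_cube)
    then show ?thesis
      using reflect_profile_ge[OF 2(1) K] shift_profile_ge_1[of K T] by linarith
  next
    case 3
    have "T \<ge> 1 / 2" using 3 by simp
    \<comment> \<open>The cubic below is this product plus 1.\<close>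
    have "0 \<le> (T - 1)\<^sup>2 * (26 - 8 * T)" using 3 by (intro mult_nonneg_nonneg) auto
    then have "0 < 42 * T\<^sup>2 - 60 * T + 27 - 8 * T ^ 3"
      by (simp add: power2_eq_square power3_eq_cube algebra_simps)
    moreover have "1 + 4 * (1 - 1 / T)\<^sup>2 + ?b - 4 * T / 3
        = (42 * T\<^sup>2 - 60 * T + 27 - 8 * T ^ 3) / (6 * T\<^sup>2)"
      using T by (simp add: field_simps power2_eq_square power3_eq_cube)
    ultimately have "1 + 4 * (1 - 1 / T)\<^sup>2 + ?b - 4 * T / 3 > 0"
      using T by simp
    then show ?thesis
      using reflect_profile_ge[OF \<open>T \<ge> 1 / 2\<close> K] shift_profile_ge_first[OF 3(1) TK] by linarith
  next
    case 4
    have "T \<ge> 1 / 2" using 4 by simp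
    have "1 - 1 / (2 * T) \<ge> 3 / 4" using 4 by (simp add: field_simps)
    then have "(1 - 1 / (2 * T))\<^sup>2 \<ge> (3 / 4)\<^sup>2" by (intro power_mono) auto
    then have "?b > 1" by (simp add: power2_eq_square)
    then show ?thesis
      using reflect_profile_ge[OF \<open>T \<ge> 1 / 2\<close> K] shift_profile_bounds(1)[OF T TK] by linarith
  qed
qed

section \<open>Passage to the limit\<close>

lemma merit_factor_eq:
  assumes A: "length A = t" "t > 0" and x: "\<And>j. j < t \<Longrightarrow> real_of_int (A ! j) = x (r + int j)"
    and sgn: "\<And>j. \<bar>x j\<bar> = 1"
  shows "merit_factor A = 1 / (energy x r t / (real t)\<^sup>2 - 1)"
proof -
  have corr: "real_of_int (autocorr A u) = shift_corr x r t (int u)" for u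
  proof -
    have "real_of_int (autocorr A u) = (\<Sum>j<t - u. x (r + int j) * x (r + int j + int u))"
      using A x by (simp add: autocorr_def add.assoc)
    also have "\<dots> = shift_corr x r t (int u)"
      unfolding shift_corr_def
      by (rule sum.reindex_bij_witness[where j = "\<lambda>j. r + int j" and i = "\<lambda>j. nat (j - r)"]) auto
    finally show ?thesis .
  qed
  have sq: "x j * x j = 1" for j
    using abs_mult_self_eq[of "x j"] sgn[of j] by simp
  have "shift_corr x r t 0 = (\<Sum>j\<in>{r..<r + int t}. 1)"
    unfolding shift_corr_def using sq by (intro sum.cong) auto
  then have c0: "shift_corr x r t 0 = real t" by simp
  have "energy x r t = (real t)\<^sup>2 + 2 * (\<Sum>u = 1..t - 1. (real_of_int (autocorr A u))\<^sup>2)"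
    unfolding energy_eq_sum_shift_corr
    by (subst sum_symmetric_int) (simp_all add: A shift_corr_minus c0 corr)
  then have "energy x r t / (real t)\<^sup>2 - 1 = 2 * (\<Sum>u = 1..t - 1. (real_of_int (autocorr A u))\<^sup>2) / (real t)\<^sup>2"
    using A by (simp add: field_simps)
  then show ?thesis by (simp add: merit_factor_def A)
qed

lemma g_fun_eq_profiles:
  assumes T: "T > 0" and K: "2 * \<bar>R\<bar> + 2 * T \<le> real K"
  shows "g_fun R T = 1 / (2 * shift_profile K T + reflect_profile K R T - 4 * T / 3 - 1)"
proof -
  have "(\<Sum>\<^sub>\<infinity>m\<in>{m::nat. m > 0}. (max 0 (1 - real m / T))\<^sup>2) = (\<Sum>\<^sub>\<infinity>m\<in>{1..K}. (tent (real m / T))\<^sup>2)"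
  proof (rule infsum_cong_neutral)
    fix m assume m: "m \<in> {m::nat. m > 0} - {1..K}"
    then have "real m > real K" by auto
    then have "real m > T" using K T abs_ge_zero[of R] by linarith
    then show "(max 0 (1 - real m / T))\<^sup>2 = 0" using T by (simp add: max_def)
  qed (use T in \<open>auto simp: tent_def\<close>)
  then have A: "(\<Sum>\<^sub>\<infinity>m\<in>{m::nat. m > 0}. (max 0 (1 - real m / T))\<^sup>2) = (\<Sum>m = 1..K. (tent (real m / T))\<^sup>2)"
    by simp
  have "(\<Sum>\<^sub>\<infinity>m\<in>(UNIV :: int set). (max 0 (1 - \<bar>1 + (2 * R - real_of_int m) / T\<bar>))\<^sup>2)
    = (\<Sum>\<^sub>\<infinity>m\<in>{- int K..int K}. (tent (1 + (2 * R - of_int m) / T))\<^sup>2)"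
  proof (rule infsum_cong_neutral)
    fix m assume m: "m \<in> UNIV - {- int K..int K}"
    have "1 \<le> \<bar>1 + (2 * R - real_of_int m) / T\<bar>"
    proof (cases "m > int K")
      case True
      then have "2 * R - real_of_int m \<le> - 2 * T" using K abs_ge_self[of R] by linarith
      then have "(2 * R - real_of_int m) / T \<le> - 2" using T by (simp add: field_simps)
      then show ?thesis by linarith
    next
      case False
      then have "m < - int K" using m by auto
      then have "2 * R - real_of_int m \<ge> 0" using K T abs_ge_minus_self[of R] by linarith
      then have "(2 * R - real_of_int m) / T \<ge> 0" using T by simp
      then show ?thesis by linarith
    qed
    then show "(max 0 (1 - \<bar>1 + (2 * R - real_of_int m) / T\<bar>))\<^sup>2 = 0" by (simp add: max_def)
  qed (auto simp: tent_def)
  then have B: "(\<Sum>\<^sub>\<infinity>m\<in>(UNIV :: int set). (max 0 (1 - \<bar>1 + (2 * R - real_of_int m) / T\<bar>))\<^sup>2) = reflect_profile K R T"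
    by (simp add: reflect_profile_def)
  show ?thesis unfolding g_fun_def A B by (simp add: shift_profile_def algebra_simps)
qed

lemma tendsto_tent [tendsto_intros]:
  "(f \<longlongrightarrow> a) F \<Longrightarrow> ((\<lambda>x. tent (f x)) \<longlongrightarrow> tent a) F"
  unfolding tent_def by (intro tendsto_intros)

lemma tendsto_shift_profile:
  "\<lbrakk>(f \<longlongrightarrow> T) F; T \<noteq> 0\<rbrakk> \<Longrightarrow> ((\<lambda>x. shift_profile K (f x)) \<longlongrightarrow> shift_profile K T) F"
  unfolding shift_profile_def by (intro tendsto_intros)

lemma tendsto_reflect_profile:
  "\<lbrakk>(f \<longlongrightarrow> T) F; T \<noteq> 0; (g \<longlongrightarrow> R) F\<rbrakk> \<Longrightarrow>
    ((\<lambda>x. reflect_profile K (g x) (f x)) \<longlongrightarrow> reflect_profile K R T) F"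
  unfolding reflect_profile_def by (intro tendsto_intros)

lemma eventually_odd_primes_at_top: "eventually odd_prime_modulus odd_primes_at_top"
  unfolding odd_primes_at_top_def eventually_inf_principal by (simp add: odd_prime_modulus_def)

lemma odd_primes_at_top_le: "odd_primes_at_top \<le> at_top"
  unfolding odd_primes_at_top_def by simp

lemma harm_le_one_plus_ln: "n > 0 \<Longrightarrow> harm n \<le> 1 + ln (real n)"
proof -
  assume "n > 0"
  then obtain m where m: "n = Suc m" by (cases n) auto
  have "harm (Suc m) - ln (real (Suc m)) \<le> harm (Suc 0) - ln (real (Suc 0))"
    using decseqD[OF decseq_harm_diff_ln, of 0 m] by simp
  then show ?thesis by (simp add: m harm_def)
qed

text \<open>
  The limit theorem for Legendre sequences multiplied by a sign pattern. The number \<open>R\<close> is shifted by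
  \<open>\<sigma> / (2 * d)\<close>, which explains the \<open>1 / 4\<close> in the negaperiodic case \<open>d = 2\<close>, \<open>\<sigma> = 1\<close>.
\<close>
lemma merit_factor_limit:
  fixes d :: nat and \<sigma> :: int and \<epsilon> :: "int \<Rightarrow> real" and r :: "nat \<Rightarrow> int" and t :: "nat \<Rightarrow> nat"
    and A :: "nat \<Rightarrow> int list"
  assumes sp: "sign_pattern \<epsilon> (int d) \<sigma>" and d: "d > 0" and T: "T > 0"
    and cop: "\<And>p. odd_prime_modulus p \<Longrightarrow> coprime d p"
    and \<sigma>: "\<And>p. odd_prime_modulus p \<Longrightarrow> int d dvd \<sigma> * (int p - 1)"
    and r: "((\<lambda>p. real_of_int (r p) / real (d * p)) \<longlongrightarrow> R) odd_primes_at_top"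
    and t: "((\<lambda>p. real (t p) / real (d * p)) \<longlongrightarrow> T) odd_primes_at_top"
    and A: "\<And>p. length (A p) = t p"
    and A': "\<And>p j. \<lbrakk>odd_prime_modulus p; j < t p\<rbrakk> \<Longrightarrow> real_of_int (A p ! j) =
        \<epsilon> (r p + int j) * odd_prime_modulus.filled_chi p (r p + int j)"
  shows "((\<lambda>p. merit_factor (A p)) \<longlongrightarrow> g_fun (R + of_int \<sigma> / (2 * real d)) T) odd_primes_at_top"
proof -
  let ?F = odd_primes_at_top
  define R' where "R' = R + of_int \<sigma> / (2 * real d)"
  \<comment> \<open>One window for all large \<open>p\<close>: it covers the supports of the profiles at the limit parameters and
    at all parameters that are close to them.\<close>
  obtain K :: nat where "2 * \<bar>R\<bar> + 2 * \<bar>R'\<bar> + 2 * T + 6 + of_int \<bar>\<sigma>\<bar> \<le> real K"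
    using real_arch_simple by blast
  then have K: "2 * \<bar>R\<bar> + 2 * T + 4 + of_int \<bar>\<sigma>\<bar> \<le> real K" "2 * \<bar>R'\<bar> + 2 * T \<le> real K" "2 * \<bar>R'\<bar> + T + 1 \<le> real K"
    using T abs_ge_zero[of R] abs_ge_zero[of R'] abs_ge_zero[of \<sigma>] by linarith+
  define \<tau> where "\<tau> = (\<lambda>p. real (t p) / real (d * p))"
  define E where "E = (\<lambda>p. energy (\<lambda>j. \<epsilon> j * odd_prime_modulus.chi p j) (r p) (t p))"
  define E' where "E' = (\<lambda>p. energy (\<lambda>j. \<epsilon> j * odd_prime_modulus.filled_chi p j) (r p) (t p))"
  define M where "M = (\<lambda>p. odd_prime_modulus.main_term p \<epsilon> (r p) (t p))"
  define I where "I = (\<lambda>p. 2 * shift_profile K (\<tau> p)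
      + reflect_profile K (of_int (r p) / real (d * p) + of_int \<sigma> / (2 * real d) - 1 / (2 * real (d * p))) (\<tau> p)
      - 2 / real p * shift_profile (t p) (real (t p) / real d))"
  define L where "L = 2 * shift_profile K T + reflect_profile K R' T - 4 * T / 3"
  have eps: "\<bar>\<epsilon> j\<bar> = 1" "\<epsilon> (j + 4) = \<epsilon> j" for j
    using sp by (auto simp: sign_pattern_def)
  have p_inf: "filterlim (\<lambda>p. real p) at_top ?F"
    using filterlim_real_sequentially odd_primes_at_top_le by (rule filterlim_mono[OF _ order_refl])
  have inv_p: "((\<lambda>p. c / real p) \<longlongrightarrow> 0) ?F" for c :: real
    by (rule tendsto_divide_0[OF tendsto_const]) (rule filterlim_at_top_imp_at_infinity[OF p_inf])
  have ev_prime: "eventually odd_prime_modulus ?F" by (rule eventually_odd_primes_at_top)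
  have ev_low: "eventually (\<lambda>p. T / 2 < \<tau> p) ?F" and ev_up: "eventually (\<lambda>p. \<tau> p < T + 1) ?F"
    unfolding \<tau>_def by (rule order_tendstoD[OF t], use T in simp)+
  have ev_r: "eventually (\<lambda>p. \<bar>real_of_int (r p) / real (d * p)\<bar> < \<bar>R\<bar> + 1) ?F"
    using order_tendstoD(2)[OF tendsto_rabs[OF r], of "\<bar>R\<bar> + 1"] by simp
  have \<tau>: "(\<tau> \<longlongrightarrow> T) ?F" using t by (simp add: \<tau>_def)
  have t_eq: "real (t p) = \<tau> p * (real d * real p)" if "odd_prime_modulus p" for p
    using odd_prime_modulus.p_pos[OF that] d by (simp add: \<tau>_def)
  have ev_good: "eventually (\<lambda>p. odd_prime_modulus p \<and> T / 2 * real p \<le> real (t p) \<and>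
      real (t p) \<le> (T + 1) * real d * real p \<and> t p > 0) ?F"
    using ev_prime ev_low ev_up
  proof eventually_elim
    case (elim p)
    have p: "real p > 0" using odd_prime_modulus.p_pos[OF elim(1)] by simp
    have "T / 2 * real p \<le> \<tau> p * real p" using elim p by (intro mult_right_mono) auto
    also have "\<dots> \<le> real d * (\<tau> p * real p)"
      using d elim T p mult_right_mono[of 1 "real d" "\<tau> p * real p"] by simp
    finally have low: "T / 2 * real p \<le> real (t p)" using t_eq[OF elim(1)] by (simp add: mult_ac)
    moreover have "\<tau> p * (real d * real p) \<le> (T + 1) * (real d * real p)"
      using elim by (intro mult_right_mono) auto
    moreover have "0 < real (t p)" using low T p mult_pos_pos[of "T / 2" "real p"] by linarith
    ultimately show ?case using elim t_eq[OF elim(1)] by (simp add: mult_ac)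
  qed
  have t_inf: "filterlim (\<lambda>p. real (t p)) at_top ?F"
  proof (rule filterlim_at_top_mono[where f = "\<lambda>p. T / 2 * real p"])
    show "filterlim (\<lambda>p. T / 2 * real p) at_top ?F"
      using T by (intro filterlim_tendsto_pos_mult_at_top[OF tendsto_const _ p_inf]) auto
    show "eventually (\<lambda>p. T / 2 * real p \<le> real (t p)) ?F"
      using ev_good by eventually_elim auto
  qed
  have inv_t: "((\<lambda>p. c / real (t p)) \<longlongrightarrow> 0) ?F" for c :: real
    by (rule tendsto_divide_0[OF tendsto_const]) (rule filterlim_at_top_imp_at_infinity[OF t_inf])

  \<comment> \<open>The main term is asymptotic to its continuous model \<open>I\<close>.\<close>
  have main: "((\<lambda>p. M p / (real (t p))\<^sup>2 - I p) \<longlongrightarrow> 0) ?F"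
  proof (rule Lim_null_comparison)
    show "((\<lambda>p. 120 / real p + 72 / real (t p)) \<longlongrightarrow> 0) ?F"
      using tendsto_add[OF inv_p[of 120] inv_t[of 72]] by simp
    show "eventually (\<lambda>p. norm (M p / (real (t p))\<^sup>2 - I p) \<le> 120 / real p + 72 / real (t p)) ?F"
      using ev_good ev_r ev_up
    proof eventually_elim
      case (elim p)
      then have pr: "odd_prime_modulus p" and t0: "t p > 0" by auto
      have dp: "real (d * p) > 0" using odd_prime_modulus.p_pos[OF pr] d by simp
      have "\<bar>real_of_int (r p)\<bar> \<le> (\<bar>R\<bar> + 1) * real (d * p)"
        using elim(2) dp by (simp add: field_simps)
      moreover have "real (t p) \<le> (T + 1) * real (d * p)" using elim(1) by (simp add: mult_ac)
      moreover have "real p \<le> real (d * p)"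
        using d by (intro of_nat_mono) simp
      then have "of_int \<bar>\<sigma>\<bar> * real p \<le> of_int \<bar>\<sigma>\<bar> * real (d * p)"
        by (intro mult_left_mono) simp_all
      ultimately have "2 * \<bar>real_of_int (r p)\<bar> + 2 * real (t p) + of_int \<bar>\<sigma>\<bar> * real p
          \<le> (2 * \<bar>R\<bar> + 2 * T + 4 + of_int \<bar>\<sigma>\<bar>) * real (d * p)"
        by (simp only: distrib_right)
      also have "\<dots> \<le> real K * real (d * p)" using K(1) by (intro mult_right_mono) auto
      finally have "real_of_int (2 * \<bar>r p\<bar> + 2 * int (t p) + \<bar>\<sigma>\<bar> * int p) \<le> real_of_int (int (K * (d * p)))"
        by simp
      then have Kp: "2 * \<bar>r p\<bar> + 2 * int (t p) + \<bar>\<sigma>\<bar> * int p \<le> int (K * (d * p))"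
        by (simp only: of_int_le_iff)
      have "\<bar>M p - (real (t p))\<^sup>2 * I p\<bar> \<le> 12 * real (t p) * (10 * real (t p) / real p + 6)"
        using odd_prime_modulus.main_term_estimate[OF pr sp d cop[OF pr] \<sigma>[OF pr] t0 Kp]
        unfolding M_def I_def \<tau>_def by (simp only: right_diff_distrib mult_ac)
      then have "\<bar>M p - (real (t p))\<^sup>2 * I p\<bar> / (real (t p))\<^sup>2 \<le>
          12 * real (t p) * (10 * real (t p) / real p + 6) / (real (t p))\<^sup>2"
        by (intro divide_right_mono) auto
      also have "\<dots> = 120 / real p + 72 / real (t p)"
        using t0 by (simp add: field_simps power2_eq_square)
      also have "\<bar>M p - (real (t p))\<^sup>2 * I p\<bar> / (real (t p))\<^sup>2 = \<bar>(M p - (real (t p))\<^sup>2 * I p) / (real (t p))\<^sup>2\<bar>"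
        by simp
      also have "(M p - (real (t p))\<^sup>2 * I p) / (real (t p))\<^sup>2 = M p / (real (t p))\<^sup>2 - I p"
        using t0 by (simp add: diff_divide_distrib)
      finally show ?case by simp
    qed
  qed

  \<comment> \<open>The model converges: its last term tends to \<open>4 * T / 3\<close> because the profile is close to its
    integral when its argument \<open>t / d\<close> is large.\<close>
  have ideal: "(I \<longlongrightarrow> L) ?F"
  proof -
    have "((\<lambda>p. 2 / real p * shift_profile (t p) (real (t p) / real d) - 4 * \<tau> p / 3) \<longlongrightarrow> 0) ?F"
    proof (rule Lim_null_comparison)
      have "((\<lambda>p. 2 / real p * ((real d / 3) / real (t p) + (real d / real (t p))\<^sup>2)) \<longlongrightarrow> 0 * (0 + 0\<^sup>2)) ?F"
        by (intro tendsto_intros inv_p inv_t)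
      then show "((\<lambda>p. 2 / real p * ((real d / 3) / real (t p) + (real d / real (t p))\<^sup>2)) \<longlongrightarrow> 0) ?F" by simp
      show "eventually (\<lambda>p. norm (2 / real p * shift_profile (t p) (real (t p) / real d) - 4 * \<tau> p / 3) \<le>
          2 / real p * ((real d / 3) / real (t p) + (real d / real (t p))\<^sup>2)) ?F"
        using ev_good
      proof eventually_elim
        case (elim p)
        let ?x = "real (t p) / real d"
        have p: "real p > 0" using odd_prime_modulus.p_pos elim by auto
        have x: "?x > 0" "?x \<le> real (t p)" using d elim by (simp_all add: field_simps)
        have "4 * \<tau> p / 3 = 2 / real p * (2 * ?x / 3)"
          by (simp add: \<tau>_def)
        then have "norm (2 / real p * shift_profile (t p) ?x - 4 * \<tau> p / 3)
            = \<bar>2 / real p * (shift_profile (t p) ?x - 2 * ?x / 3)\<bar>"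
          by (simp only: right_diff_distrib real_norm_def)
        also have "\<dots> = 2 / real p * (shift_profile (t p) ?x - 2 * ?x / 3)"
          using shift_profile_bounds(1)[OF x] p by (intro abs_of_nonneg mult_nonneg_nonneg) auto
        also have "\<dots> \<le> 2 / real p * ((?x / 3 + 1) / ?x\<^sup>2)"
          using shift_profile_bounds(2)[OF x] p by (intro mult_left_mono) auto
        also have "(?x / 3 + 1) / ?x\<^sup>2 = (real d / 3) / real (t p) + (real d / real (t p))\<^sup>2"
          using elim d by (simp add: field_simps power2_eq_square)
        finally show ?case .
      qed
    qed
    then have a: "((\<lambda>p. (2 / real p * shift_profile (t p) (real (t p) / real d) - 4 * \<tau> p / 3) + 4 * \<tau> p / 3)
        \<longlongrightarrow> 0 + 4 * T / 3) ?F"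
      by (intro tendsto_intros \<tau>) auto
    have "((\<lambda>p. of_int (r p) / real (d * p) + of_int \<sigma> / (2 * real d) - (1 / (2 * real d)) / real p) \<longlongrightarrow> R + of_int \<sigma> / (2 * real d) - 0) ?F"
      by (intro tendsto_intros r inv_p)
    then have b: "((\<lambda>p. of_int (r p) / real (d * p) + of_int \<sigma> / (2 * real d) - 1 / (2 * real (d * p))) \<longlongrightarrow> R') ?F"
      by (simp add: R'_def mult.assoc)
    have "T \<noteq> 0" using T by simp
    have "(I \<longlongrightarrow> 2 * shift_profile K T + reflect_profile K R' T - 4 * T / 3) ?F"
      unfolding I_def using a
      by (intro tendsto_intros tendsto_shift_profile tendsto_reflect_profile \<tau> b \<open>T \<noteq> 0\<close>) simp
    then show ?thesis by (simp add: L_def)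
  qed

  \<comment> \<open>A fixed odd multiple \<open>n * p\<close> of \<open>p\<close> serves as the modulus of the auxiliary characters.\<close>
  obtain n :: nat where n: "odd n" "2 * (T + 1) * real d \<le> real n"
  proof -
    obtain k :: nat where "2 * (T + 1) * real d \<le> real k" using real_arch_simple by blast
    then show ?thesis by (intro that[of "2 * k + 1"]) auto
  qed
  have n0: "n > 0" using n(1) by (auto intro: Nat.gr0I)
  \<comment> \<open>The contribution of the unpaired correlations is smaller than \<open>t\<^sup>2\<close> by a factor of order
    \<open>p powr (- 1 / 4) * (ln p) ^ 4\<close>.\<close>
  have error: "((\<lambda>p. (E p - M p) / (real (t p))\<^sup>2) \<longlongrightarrow> 0) ?F"
  proof (rule Lim_null_comparison)
    let ?h = "\<lambda>p. 20 * real n ^ 3 / T\<^sup>2 * (real p powr (- 1 / 4) * (17 + 16 * ln (real n * real p)) ^ 4)"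
    have "((\<lambda>p. real p powr (- 1 / 4) * (17 + 16 * ln (real n * real p)) ^ 4) \<longlongrightarrow> 0) at_top"
      using n0 by real_asymp
    then have "((\<lambda>p. real p powr (- 1 / 4) * (17 + 16 * ln (real n * real p)) ^ 4) \<longlongrightarrow> 0) ?F"
      by (rule filterlim_mono[OF _ order_refl odd_primes_at_top_le])
    from tendsto_mult[OF tendsto_const[of "20 * real n ^ 3 / T\<^sup>2"] this]
    show "(?h \<longlongrightarrow> 0) ?F" by simp
    show "eventually (\<lambda>p. norm ((E p - M p) / (real (t p))\<^sup>2) \<le> ?h p) ?F"
      using ev_good
    proof eventually_elim
      case (elim p)
      then have pr: "odd_prime_modulus p" and t0: "t p > 0" by auto
      have p: "real p > 0" using odd_prime_modulus.p_pos[OF pr] by simp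
      let ?q = "real n * real p"
      let ?l = "17 + 16 * ln ?q"
      have q: "?q \<ge> 1" using n0 odd_prime_modulus.p_pos[OF pr]
        by (metis One_nat_def Suc_leI nat_0_less_mult_iff of_nat_1 of_nat_le_iff of_nat_mult)
      have tq: "2 * real (t p) \<le> ?q"
      proof -
        have "2 * real (t p) \<le> 2 * ((T + 1) * real d * real p)" using elim by (intro mult_left_mono) auto
        also have "\<dots> = 2 * (T + 1) * real d * real p" by (simp only: mult.assoc)
        also have "\<dots> \<le> ?q" using n(2) by (intro mult_right_mono) auto
        finally show ?thesis .
      qed
      then have "real (2 * t p) \<le> real (n * p)" by simp
      then have tq': "2 * t p \<le> n * p" by (simp only: of_nat_le_iff)
      have "harm (n * p) \<le> 1 + ln ?q"
        using harm_le_one_plus_ln[of "n * p"] n0 odd_prime_modulus.p_pos[OF pr] by simp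
      then have "16 * ?q * harm (n * p) \<le> 16 * ?q * (1 + ln ?q)" using q by (intro mult_left_mono) auto
      then have "real (t p) + 16 * real (n * p) * harm (n * p) \<le> ?q * ?l"
        using tq by (simp add: algebra_simps)
      then have pow: "(real (t p) + 16 * real (n * p) * harm (n * p)) ^ 4 \<le> (?q * ?l) ^ 4"
        by (intro power_mono) (auto intro!: add_nonneg_nonneg mult_nonneg_nonneg harm_nonneg)
      have "\<bar>E p - M p\<bar> \<le> 5 * real p powr (3 / 4) * (real (t p) + 16 * real (n * p) * harm (n * p)) ^ 4 / (real (n * p) * (real p)\<^sup>2)"
        unfolding E_def M_def
        by (rule odd_prime_modulus.energy_chi_error[OF pr _ _ n(1) tq']) (simp_all add: eps)
      also have "\<dots> \<le> 5 * real p powr (3 / 4) * (?q * ?l) ^ 4 / (real (n * p) * (real p)\<^sup>2)"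
        using pow by (intro divide_right_mono mult_left_mono) auto
      also have "\<dots> = 5 * real n ^ 3 * real p * real p powr (3 / 4) * ?l ^ 4"
        using p n0 by (simp add: power_mult_distrib field_simps eval_nat_numeral)
      finally have EM: "\<bar>E p - M p\<bar> \<le> 5 * real n ^ 3 * real p * real p powr (3 / 4) * ?l ^ 4" .
      have "(T / 2 * real p)\<^sup>2 \<le> (real (t p))\<^sup>2" using elim T by (intro power_mono) auto
      then have "\<bar>E p - M p\<bar> / (real (t p))\<^sup>2 \<le> (5 * real n ^ 3 * real p * real p powr (3 / 4) * ?l ^ 4) / (T / 2 * real p)\<^sup>2"
        using EM T p by (intro frac_le) auto
      also have "\<dots> = 20 * real n ^ 3 / T\<^sup>2 * (real p powr (3 / 4) / real p * ?l ^ 4)"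
        using p T by (simp add: power2_eq_square field_simps)
      also have "real p powr (3 / 4) / real p = real p powr (- 1 / 4)"
        using p powr_diff[of "real p" "3 / 4" 1] by simp
      finally show ?case by simp
    qed
  qed

  have "((\<lambda>p. (E p - M p) / (real (t p))\<^sup>2 + (M p / (real (t p))\<^sup>2 - I p) + I p) \<longlongrightarrow> 0 + 0 + L) ?F"
    by (intro tendsto_add error main ideal)
  then have EL: "((\<lambda>p. E p / (real (t p))\<^sup>2) \<longlongrightarrow> L) ?F"
    by (simp add: diff_divide_distrib)

  \<comment> \<open>Filling in the zeros of the symbol does not matter; here \<open>\<eta> = 1 / sqrt t\<close>.\<close>
  have fill: "((\<lambda>p. (E' p - E p) / (real (t p))\<^sup>2) \<longlongrightarrow> 0) ?F"
  proof (rule Lim_null_comparison)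
    let ?Z = "\<lambda>p. 2 * (real d * \<tau> p + 2)"
    let ?s = "\<lambda>p. inverse (sqrt (real (t p)))"
    let ?h = "\<lambda>p. ?s p * (E p / (real (t p))\<^sup>2) + (1 / real (t p) + ?s p) * (2 * (?Z p)\<^sup>2)"
    have s0: "(?s \<longlongrightarrow> 0) ?F"
      by (intro tendsto_inverse_0_at_top filterlim_compose[OF sqrt_at_top] t_inf)
    have "(?h \<longlongrightarrow> 0 * L + (0 + 0) * (2 * (2 * (real d * T + 2))\<^sup>2)) ?F"
      by (intro tendsto_intros s0 EL inv_t \<tau>)
    then show "(?h \<longlongrightarrow> 0) ?F" by simp
    have split: "(a + b * (2 * x * z)) / x\<^sup>2 = a / x\<^sup>2 + b / x * (2 * z)" if "x > 0" for a b x z :: real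
      using that by (simp add: add_divide_distrib power2_eq_square)
    show "eventually (\<lambda>p. norm ((E' p - E p) / (real (t p))\<^sup>2) \<le> ?h p) ?F"
      using ev_good
    proof eventually_elim
      case (elim p)
      then have pr: "odd_prime_modulus p" and t0: "real (t p) > 0" by auto
      have s: "?s p > 0" using t0 by simp
      have Z: "2 * (real (t p) / real p + 2) = ?Z p"
        using d by (simp add: \<tau>_def)
      have "\<bar>E' p - E p\<bar> \<le> ?s p * E p + (1 + 1 / ?s p) * (2 * real (t p) * (?Z p)\<^sup>2)"
        unfolding E'_def E_def Z [symmetric]
        by (rule odd_prime_modulus.energy_filled[OF pr eps(1) s])
      then have "\<bar>E' p - E p\<bar> / (real (t p))\<^sup>2 \<le>
          (?s p * E p + (1 + 1 / ?s p) * (2 * real (t p) * (?Z p)\<^sup>2)) / (real (t p))\<^sup>2"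
        by (intro divide_right_mono) auto
      also have "\<dots> = ?s p * (E p / (real (t p))\<^sup>2) + ((1 + 1 / ?s p) / real (t p)) * (2 * (?Z p)\<^sup>2)"
        by (simp only: split[OF t0] times_divide_eq_right)
      also have "(1 + 1 / ?s p) / real (t p) = 1 / real (t p) + ?s p"
        using t0 by (simp add: add_divide_distrib) (simp add: divide_simps)
      finally show ?case by simp
    qed
  qed
  have "((\<lambda>p. (E' p - E p) / (real (t p))\<^sup>2 + E p / (real (t p))\<^sup>2) \<longlongrightarrow> 0 + L) ?F"
    by (intro tendsto_add fill EL)
  then have E'L: "((\<lambda>p. E' p / (real (t p))\<^sup>2) \<longlongrightarrow> L) ?F"
    by (simp add: diff_divide_distrib)
  have pos: "L - 1 > 0"
    using inverse_merit_positive[OF T K(3)] by (simp add: L_def)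
  have "((\<lambda>p. 1 / (E' p / (real (t p))\<^sup>2 - 1)) \<longlongrightarrow> 1 / (L - 1)) ?F"
    using pos by (intro tendsto_intros E'L) auto
  moreover have "eventually (\<lambda>p. 1 / (E' p / (real (t p))\<^sup>2 - 1) = merit_factor (A p)) ?F"
    using ev_good
  proof eventually_elim
    case (elim p)
    then have pr: "odd_prime_modulus p" and t0: "t p > 0" by auto
    show ?case
      unfolding E'_def
      by (rule merit_factor_eq[OF A t0, symmetric])
         (use A'[OF pr] eps(1) odd_prime_modulus.abs_filled_chi[OF pr] in \<open>simp_all add: abs_mult\<close>)
  qed
  ultimately have "((\<lambda>p. merit_factor (A p)) \<longlongrightarrow> 1 / (L - 1)) ?F"
    by (rule Lim_transform_eventually)
  also have "1 / (L - 1) = g_fun R' T"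
    using g_fun_eq_profiles[OF T K(2)] by (simp add: L_def)
  finally show ?thesis by (simp add: R'_def)
qed

section \<open>The three families of sequences\<close>

lemma sign_pattern_const: "sign_pattern (\<lambda>_. 1) 1 0"
  by (simp add: sign_pattern_def)

text \<open>
  The pattern \<open>+ + - -\<close>, which changes sign under a shift by 2.
\<close>
definition negaperiodic_sign :: "int \<Rightarrow> real" where
  "negaperiodic_sign j = (if j mod 4 \<in> {0, 1} then 1 else - 1)"

text \<open>
  The pattern \<open>+ + - +\<close>, whose periodic autocorrelation vanishes at all nonzero shifts.
\<close>
definition perfect_sign :: "int \<Rightarrow> real" where
  "perfect_sign j = (if j mod 4 = 2 then - 1 else 1)"

lemma int_cases_mod_4:
  fixes u :: int
  obtains k where "u = 4 * k" | k where "u = 4 * k + 1" | k where "u = 4 * k + 2" | k where "u = 4 * k + 3"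
proof -
  have u: "u = 4 * (u div 4) + u mod 4" by simp
  have "u mod 4 = 0 \<or> u mod 4 = 1 \<or> u mod 4 = 2 \<or> u mod 4 = 3" by presburger
  then show ?thesis using that u by (metis add.right_neutral)
qed

lemma sum_over_4: "(\<Sum>j\<in>{0..<4::int}. f j) = f 0 + f 1 + f 2 + (f 3 :: real)"
proof -
  have "{0..<4::int} = {0, 1, 2, 3}" by auto
  then show ?thesis by simp
qed

lemma mod_4_shift:
  fixes c k :: int
  shows "(c + 4 * k) mod 4 = c mod 4" "(c + (4 * k + e)) mod 4 = (c + e) mod 4"
    "(c - 4 * k) mod 4 = c mod 4" "(4 * k + e - c) mod 4 = (e - c) mod 4" "(4 * k - c) mod 4 = (- c) mod 4"
    "(4 * k + e) mod 4 = e mod 4"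
  by presburger+

lemma sign_pattern_negaperiodic: "sign_pattern negaperiodic_sign 2 1"
  unfolding sign_pattern_def
proof (intro conjI allI)
  fix u :: int
  show "\<bar>negaperiodic_sign u\<bar> = 1" by (simp add: negaperiodic_sign_def)
  show "negaperiodic_sign (u + 4) = negaperiodic_sign u" by (simp add: negaperiodic_sign_def)
  show "(\<Sum>j\<in>{0..<4}. negaperiodic_sign j * negaperiodic_sign (j + u))\<^sup>2 = 16 * of_bool (2 dvd u)"
    unfolding sum_over_4
    by (cases u rule: int_cases_mod_4; hypsubst) (simp_all add: negaperiodic_sign_def mod_4_shift)
  show "(\<Sum>j\<in>{0..<4}. negaperiodic_sign j * negaperiodic_sign (u - j))\<^sup>2 = 16 * of_bool (2 dvd u + 1)"
    unfolding sum_over_4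
    by (cases u rule: int_cases_mod_4; hypsubst) (simp_all add: negaperiodic_sign_def mod_4_shift)
qed

lemma sign_pattern_perfect: "sign_pattern perfect_sign 4 0"
  unfolding sign_pattern_def
proof (intro conjI allI)
  fix u :: int
  show "\<bar>perfect_sign u\<bar> = 1" by (simp add: perfect_sign_def)
  show "perfect_sign (u + 4) = perfect_sign u" by (simp add: perfect_sign_def)
  show "(\<Sum>j\<in>{0..<4}. perfect_sign j * perfect_sign (j + u))\<^sup>2 = 16 * of_bool (4 dvd u)"
    unfolding sum_over_4 dvd_eq_mod_eq_0
    by (cases u rule: int_cases_mod_4; hypsubst) (simp_all add: perfect_sign_def mod_4_shift)
  show "(\<Sum>j\<in>{0..<4}. perfect_sign j * perfect_sign (u - j))\<^sup>2 = 16 * of_bool (4 dvd u + 0)"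
    unfolding sum_over_4 dvd_eq_mod_eq_0
    by (cases u rule: int_cases_mod_4; hypsubst) (simp_all add: perfect_sign_def mod_4_shift)
qed

lemma nat_cases_mod_4:
  fixes k :: nat
  obtains m where "k = 4 * m" | m where "k = 4 * m + 1" | m where "k = 4 * m + 2" | m where "k = 4 * m + 3"
proof -
  have k: "k = 4 * (k div 4) + k mod 4" by simp
  have "k mod 4 = 0 \<or> k mod 4 = 1 \<or> k mod 4 = 2 \<or> k mod 4 = 3" by presburger
  then show ?thesis using that k by (metis add.right_neutral)
qed

lemma half_eq: "a = 2 * b \<Longrightarrow> a div 2 = b" for a b :: nat
  by simp

lemma N_seq_sign: "real_of_int ((- 1) ^ (k * (k - 1) div 2)) = negaperiodic_sign (int k)"
proof (cases k rule: nat_cases_mod_4)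
  case (1 m)
  have "k * (k - 1) = 2 * (2 * (m * (k - 1)))" using 1 by simp
  then have "k * (k - 1) div 2 = 2 * (m * (k - 1))" by (rule half_eq)
  then show ?thesis using 1 by (simp add: negaperiodic_sign_def)
next
  case (2 m)
  have "k * (k - 1) = 2 * (2 * (k * m))" using 2 by simp
  then have "k * (k - 1) div 2 = 2 * (k * m)" by (rule half_eq)
  then show ?thesis using 2 by (simp add: negaperiodic_sign_def)
next
  case (3 m)
  have "k * (k - 1) = 2 * ((2 * m + 1) * (4 * m + 1))" using 3 by simp
  then have "k * (k - 1) div 2 = (2 * m + 1) * (4 * m + 1)" by (rule half_eq)
  then show ?thesis using 3 by (simp add: negaperiodic_sign_def)
next
  case (4 m)
  have "k * (k - 1) = 2 * ((4 * m + 3) * (2 * m + 1))" using 4 by simp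
  then have "k * (k - 1) div 2 = (4 * m + 3) * (2 * m + 1)" by (rule half_eq)
  then show ?thesis using 4 by (simp add: negaperiodic_sign_def)
qed

lemma P_seq_sign: "real_of_int ((- 1) ^ (k * (k - 1)\<^sup>2 div 2)) = perfect_sign (int k)"
proof (cases k rule: nat_cases_mod_4)
  case (1 m)
  have "k * (k - 1)\<^sup>2 = 2 * (2 * (m * (k - 1)\<^sup>2))" using 1 by simp
  then have "k * (k - 1)\<^sup>2 div 2 = 2 * (m * (k - 1)\<^sup>2)" by (rule half_eq)
  then show ?thesis using 1 by (simp add: perfect_sign_def)
next
  case (2 m)
  have "k * (k - 1)\<^sup>2 = 2 * (2 * (k * (4 * m\<^sup>2)))" using 2 by (simp add: power2_eq_square)
  then have "k * (k - 1)\<^sup>2 div 2 = 2 * (k * (4 * m\<^sup>2))" by (rule half_eq)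
  then show ?thesis using 2 by (simp add: perfect_sign_def)
next
  case (3 m)
  have "k * (k - 1)\<^sup>2 = 2 * ((2 * m + 1) * (4 * m + 1)\<^sup>2)" using 3 by simp
  then have "k * (k - 1)\<^sup>2 div 2 = (2 * m + 1) * (4 * m + 1)\<^sup>2" by (rule half_eq)
  then show ?thesis using 3 by (simp add: perfect_sign_def)
next
  case (4 m)
  have "k * (k - 1)\<^sup>2 = 2 * (2 * ((4 * m + 3) * (2 * m + 1)\<^sup>2))"
    using 4 by (simp add: power2_eq_square algebra_simps)
  then have "k * (k - 1)\<^sup>2 div 2 = 2 * ((4 * m + 3) * (2 * m + 1)\<^sup>2)" by (rule half_eq)
  then show ?thesis using 4 by (simp add: perfect_sign_def)
qed

context odd_prime_modulus
begin

lemma periodic_ext_legendre_seq: "real_of_int (periodic_ext (legendre_seq p) x) = filled_chi x"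
proof -
  have x: "0 \<le> x mod int p" "x mod int p < int p" using p_pos by simp_all
  then have "nat (x mod int p) < p" by linarith
  then have "real_of_int (periodic_ext (legendre_seq p) x) = (if x mod int p = 0 then 1 else chi (x mod int p))"
  proof (cases "x mod int p = 0")
    case False
    then have "0 < x mod int p" using x by linarith
    then show ?thesis using \<open>nat (x mod int p) < p\<close>
      by (simp add: periodic_ext_def legendre_seq_def chi_def)
  qed (use p_pos in \<open>simp add: periodic_ext_def legendre_seq_def\<close>)
  also have "\<dots> = filled_chi x"
    using chi_cong[of "x mod int p" x] by (simp add: filled_chi_def dvd_eq_mod_eq_0 cong_def)
  finally show ?thesis .
qed

text \<open>
  Since 4 and \<open>p\<close> divide the length \<open>4 * p\<close>, reducing the position modulo \<open>4 * p\<close> changes neither the sign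
  nor the symbol.
\<close>
lemma periodic_ext_signed_legendre_seq:
  fixes e :: "nat \<Rightarrow> int" and s :: "int \<Rightarrow> real"
  assumes e: "\<And>k. real_of_int (e k) = s (int k)" and s: "\<And>x y. x mod 4 = y mod 4 \<Longrightarrow> s x = s y"
  shows "real_of_int (periodic_ext (map (\<lambda>j. e j * periodic_ext (legendre_seq p) (int j)) [0..<4 * length (legendre_seq p)]) x)
    = s x * filled_chi x"
proof -
  let ?k = "nat (x mod (4 * int p))"
  have len: "length (legendre_seq p) = p" by (simp add: legendre_seq_def)
  have x: "0 \<le> x mod (4 * int p)" "x mod (4 * int p) < 4 * int p" using p_pos by simp_all
  then have k: "int ?k = x mod (4 * int p)" "?k < 4 * p" by linarith+
  have "(x mod (4 * int p)) mod 4 = x mod 4" by (rule mod_mod_cancel) simp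
  then have "s (x mod (4 * int p)) = s x" by (rule s)
  moreover have "(x mod (4 * int p)) mod int p = x mod int p" by (rule mod_mod_cancel) simp
  then have "filled_chi (x mod (4 * int p)) = filled_chi x"
    unfolding periodic_ext_legendre_seq [symmetric] by (simp add: periodic_ext_def len)
  ultimately show ?thesis
    using k e[of ?k] by (simp add: periodic_ext_def[of "map _ _"] len periodic_ext_legendre_seq)
qed

lemma periodic_ext_N_seq:
  "real_of_int (periodic_ext (N_seq (legendre_seq p)) x) = negaperiodic_sign x * filled_chi x"
  unfolding N_seq_def
  by (rule periodic_ext_signed_legendre_seq) (simp_all only: N_seq_sign negaperiodic_sign_def)

lemma periodic_ext_P_seq:
  "real_of_int (periodic_ext (P_seq (legendre_seq p)) x) = perfect_sign x * filled_chi x"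
  unfolding P_seq_def
  by (rule periodic_ext_signed_legendre_seq) (simp_all only: P_seq_sign perfect_sign_def)

end

lemma length_rotate_seq: "length (rotate_seq A r t) = t"
  by (simp add: rotate_seq_def)

lemma nth_rotate_seq: "j < t \<Longrightarrow> rotate_seq A r t ! j = periodic_ext A (r + int j)"
  by (simp add: rotate_seq_def add.commute)

theorem theorem2p1:
  fixes R T :: real and r :: "nat \<Rightarrow> int" and t :: "nat \<Rightarrow> nat"
  assumes "T > 0"
  shows
    "(((\<lambda>p. real_of_int (r p) / real p) \<longlongrightarrow> R) odd_primes_at_top \<and>
      ((\<lambda>p. real (t p) / real p) \<longlongrightarrow> T) odd_primes_at_top \<longrightarrow>
      ((\<lambda>p. merit_factor (rotate_seq (legendre_seq p) (r p) (t p)))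
         \<longlongrightarrow> g_fun R T) odd_primes_at_top)
     \<and>
     (((\<lambda>p. real_of_int (r p) / (2 * real p)) \<longlongrightarrow> R) odd_primes_at_top \<and>
      ((\<lambda>p. real (t p) / (2 * real p)) \<longlongrightarrow> T) odd_primes_at_top \<longrightarrow>
      ((\<lambda>p. merit_factor (rotate_seq (N_seq (legendre_seq p)) (r p) (t p)))
         \<longlongrightarrow> g_fun (R + 1 / 4) T) odd_primes_at_top)
     \<and>
     (((\<lambda>p. real_of_int (r p) / (4 * real p)) \<longlongrightarrow> R) odd_primes_at_top \<and>
      ((\<lambda>p. real (t p) / (4 * real p)) \<longlongrightarrow> T) odd_primes_at_top \<longrightarrow>
      ((\<lambda>p. merit_factor (rotate_seq (P_seq (legendre_seq p)) (r p) (t p)))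
         \<longlongrightarrow> g_fun R T) odd_primes_at_top)"
proof (intro conjI impI; elim conjE)
  assume "((\<lambda>p. real_of_int (r p) / real p) \<longlongrightarrow> R) odd_primes_at_top"
    "((\<lambda>p. real (t p) / real p) \<longlongrightarrow> T) odd_primes_at_top"
  then show "((\<lambda>p. merit_factor (rotate_seq (legendre_seq p) (r p) (t p))) \<longlongrightarrow> g_fun R T) odd_primes_at_top"
    using merit_factor_limit[where \<epsilon> = "\<lambda>_. 1" and d = 1 and \<sigma> = 0 and R = R and r = r and t = t
        and A = "\<lambda>p. rotate_seq (legendre_seq p) (r p) (t p)", OF _ _ assms]
    by (simp add: sign_pattern_const length_rotate_seq nth_rotate_seq
        odd_prime_modulus.periodic_ext_legendre_seq)
next
  assume "((\<lambda>p. real_of_int (r p) / (2 * real p)) \<longlongrightarrow> R) odd_primes_at_top"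
    "((\<lambda>p. real (t p) / (2 * real p)) \<longlongrightarrow> T) odd_primes_at_top"
  then show "((\<lambda>p. merit_factor (rotate_seq (N_seq (legendre_seq p)) (r p) (t p)))
      \<longlongrightarrow> g_fun (R + 1 / 4) T) odd_primes_at_top"
    using merit_factor_limit[where \<epsilon> = negaperiodic_sign and d = 2 and \<sigma> = 1 and R = R and r = r and t = t
        and A = "\<lambda>p. rotate_seq (N_seq (legendre_seq p)) (r p) (t p)", OF _ _ assms]
    by (simp add: sign_pattern_negaperiodic length_rotate_seq nth_rotate_seq
        odd_prime_modulus.periodic_ext_N_seq odd_prime_modulus.odd_p)
next
  assume "((\<lambda>p. real_of_int (r p) / (4 * real p)) \<longlongrightarrow> R) odd_primes_at_top"
    "((\<lambda>p. real (t p) / (4 * real p)) \<longlongrightarrow> T) odd_primes_at_top"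
  moreover have "coprime 4 p" if "odd_prime_modulus p" for p
    using coprime_power_left_iff[of 2 2 p] odd_prime_modulus.odd_p[OF that] by simp
  ultimately show "((\<lambda>p. merit_factor (rotate_seq (P_seq (legendre_seq p)) (r p) (t p)))
      \<longlongrightarrow> g_fun R T) odd_primes_at_top"
    using merit_factor_limit[where \<epsilon> = perfect_sign and d = 4 and \<sigma> = 0 and R = R and r = r and t = t
        and A = "\<lambda>p. rotate_seq (P_seq (legendre_seq p)) (r p) (t p)", OF _ _ assms]
    by (simp add: sign_pattern_perfect length_rotate_seq nth_rotate_seq
        odd_prime_modulus.periodic_ext_P_seq)
qed

end
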